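(* Let $a,b\in\overline{{}^\bullet\mathbb{R}}$ and let $J$ be a non-infinitesimal interval of ${}^\bullet\mathbb{R}$ with endpoints $a,b$. Let $f:J\to{}^\bullet\mathbb{R}$ be a smooth function and let $u\in J$. Then there exists one and only one smooth function $I:J\to{}^\bullet\mathbb{R}$ such that $I'=f$ on $J$ and $I(u)=0$.
   Context: Fermat reals: let $\mathbb{R}_o[t]$ be the set of maps $x:\mathbb{R}_{\ge0}\to\mathbb{R}$, $t\mapsto x_t$, of the form $x_t=r+\sum_{i=1}^k\alpha_i t^{a_i}+o(t)$ as $t\to0^+$, with $k\in\mathbb{N}$, $r,\alpha_i\in\mathbb{R}$, $a_i\in\mathbb{R}_{\ge0}$. Write $x\sim y$ iff $x_t=y_t+o(t)$ as $t\to0^+$. The ring of Fermat reals is ${}^\bullet\mathbb{R}:=\mathbb{R}_o[t]/\sim$ with pointwise operations; $\mathbb{R}\subseteq{}^\bullet\mathbb{R}$ via constants. The standard part of $x=[x_t]$ is ${}^\circ x:=x_0$ (componentwise on ${}^\bullet\mathbb{R}^n$). ${}^\bullet\mathbb{R}$ is totally ordered by: $x\le y$ iff for representatives there is $z\in\mathbb{R}_o[t]$ with $z\sim0$ and $x_t\le y_t+z_t$ for all small $t\ge0$. $\overline{{}^\bullet\mathbb{R}}:={}^\bullet\mathbb{R}\cup\{\pm\infty\}$, ${}^\circ(\pm\infty):=\pm\infty$. An interval is a set $[a,b],(a,b),[a,b),(a,b]$ of points of ${}^\bullet\mathbb{R}$ with $a\le b$ in $\overline{{}^\bullet\mathbb{R}}$;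 non-infinitesimal if ${}^\circ a<{}^\circ b$. The Fermat topology on ${}^\bullet\mathbb{R}^n$ has open sets ${}^\bullet V:=\{x:{}^\circ x\in V\}$, $V\subseteq\mathbb{R}^n$ open. For $\alpha\in C^\infty(W,\mathbb{R}^m)$, $W\subseteq\mathbb{R}^d$ open, ${}^\bullet\alpha([x_t]):=[\alpha(x_t)]$. A map $f:S\to{}^\bullet\mathbb{R}^m$, $S\subseteq{}^\bullet\mathbb{R}^n$, is smooth (quasi-standard smooth) if for every $x\in S$ there exist open $V\subseteq\mathbb{R}^n$ with $x\in{}^\bullet V$, open $P\subseteq\mathbb{R}^{\mathsf p}$, $p\in{}^\bullet P$ and $\alpha\in C^\infty(P\times V,\mathbb{R}^m)$ with $f(y)={}^\bullet\alpha(p,y)$ for all $y\in{}^\bullet V\cap S$. For $f$ smooth on a non-infinitesimal interval $J$ and $x\in J$, $f'(x):={}^\bullet(\partial_2\alpha)(p,x)$ for any such local representation of $f$ around $x$ (independent of the representation; equivalently $f'(x)=r(x,0)$ where $r$ is the unique smooth function with $f(x+h)=f(x)+h\,r(x,h)$ for all sufficiently small $h$ with $x+h\in J$). *)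

theory Defs
  imports "HOL-Analysis.Analysis"
begin

definition littleo :: "(real \<Rightarrow> real) \<Rightarrow> bool" where
  "littleo h \<longleftrightarrow> (\<forall>\<epsilon>>0. \<exists>\<delta>>0. \<forall>t. 0 \<le> t \<and> t < \<delta> \<longrightarrow> \<bar>h t\<bar> \<le> \<epsilon> * t)"

definition tpow :: "real \<Rightarrow> real \<Rightarrow> real" where
  "tpow t a = (if a = 0 then 1 else t powr a)"

definition Ro :: "(real \<Rightarrow> real) set" where
  "Ro = {x. \<exists>(r::real) (cs::(real \<times> real) list).
            (\<forall>(\<alpha>, a) \<in> set cs. 0 \<le> a) \<and>
            littleo (\<lambda>t. x t - r - (\<Sum>(\<alpha>, a)\<leftarrow>cs. \<alpha> * tpow t a))}"

definition fsim :: "(real \<Rightarrow> real) \<Rightarrow> (real \<Rightarrow> real) \<Rightarrow> bool" where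
  "fsim x y \<longleftrightarrow> x \<in> Ro \<and> y \<in> Ro \<and> littleo (\<lambda>t. x t - y t)"

lemma littleo_zero: "littleo (\<lambda>t. 0)"
  unfolding littleo_def by (auto intro: exI[of _ 1])

lemma littleo_sym: "littleo (\<lambda>t. x t - y t) \<Longrightarrow> littleo (\<lambda>t. y t - x t)"
  unfolding littleo_def by (simp add: abs_minus_commute)

lemma littleo_trans:
  assumes "littleo (\<lambda>t. x t - y t)" "littleo (\<lambda>t. y t - z t)"
  shows "littleo (\<lambda>t. x t - z t)"
  unfolding littleo_def
proof (intro allI impI)
  fix \<epsilon> :: real assume e: "\<epsilon> > 0"
  then have e2: "\<epsilon>/2 > 0" by simp
  obtain d1 where d1: "d1 > 0" "\<forall>t. 0 \<le> t \<and> t < d1 \<longrightarrow> \<bar>x t - y t\<bar> \<le> \<epsilon>/2 * t"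
    using assms(1) e2 unfolding littleo_def by blast
  obtain d2 where d2: "d2 > 0" "\<forall>t. 0 \<le> t \<and> t < d2 \<longrightarrow> \<bar>y t - z t\<bar> \<le> \<epsilon>/2 * t"
    using assms(2) e2 unfolding littleo_def by blast
  show "\<exists>\<delta>>0. \<forall>t. 0 \<le> t \<and> t < \<delta> \<longrightarrow> \<bar>x t - z t\<bar> \<le> \<epsilon> * t"
  proof (intro exI[of _ "min d1 d2"] conjI allI impI)
    show "min d1 d2 > 0" using d1 d2 by simp
  next
    fix t assume t: "0 \<le> t \<and> t < min d1 d2"
    then have "\<bar>x t - y t\<bar> \<le> \<epsilon>/2 * t" "\<bar>y t - z t\<bar> \<le> \<epsilon>/2 * t" using d1 d2 by auto
    then show "\<bar>x t - z t\<bar> \<le> \<epsilon> * t" by linarith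
  qed
qed

lemma zero_in_Ro: "(\<lambda>t. 0) \<in> Ro"
  unfolding Ro_def by (auto intro!: exI[of _ 0] exI[of _ "[]"] simp: littleo_zero)

lemma part_equivp_fsim: "part_equivp fsim"
proof (rule part_equivpI)
  show "\<exists>x. fsim x x" using zero_in_Ro littleo_zero by (auto simp: fsim_def)
  show "symp fsim" unfolding symp_def fsim_def using littleo_sym by blast
  show "transp fsim" unfolding transp_def fsim_def using littleo_trans by blast
qed

quotient_type fermat = "real \<Rightarrow> real" / partial: fsim
  by (rule part_equivp_fsim)

text \<open>Operations are defined on representatives (the paper shows they are well defined).\<close>
definition fzero :: fermat where "fzero = abs_fermat (\<lambda>t. 0)"

definition st :: "fermat \<Rightarrow> real" where "st x = rep_fermat x 0"

definition fle :: "fermat \<Rightarrow> fermat \<Rightarrow> bool" where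
  "fle x y \<longleftrightarrow> (\<exists>z \<in> Ro. littleo z \<and>
      (\<exists>\<delta>>0. \<forall>t. 0 \<le> t \<and> t < \<delta> \<longrightarrow> rep_fermat x t \<le> rep_fermat y t + z t))"

datatype fext = MInf | Fin fermat | PInf

fun ele :: "fext \<Rightarrow> fext \<Rightarrow> bool" where
  "ele MInf _ = True"
| "ele _ PInf = True"
| "ele (Fin x) (Fin y) = fle x y"
| "ele _ _ = False"

definition elt :: "fext \<Rightarrow> fext \<Rightarrow> bool" where
  "elt a b \<longleftrightarrow> ele a b \<and> a \<noteq> b"

fun est :: "fext \<Rightarrow> ereal" where
  "est MInf = -\<infinity>"
| "est PInf = \<infinity>"
| "est (Fin x) = ereal (st x)"

definition fermat_interval :: "fext \<Rightarrow> fext \<Rightarrow> fermat set \<Rightarrow> bool" where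
  "fermat_interval a b J \<longleftrightarrow> ele a b \<and>
     (J = {x. ele a (Fin x) \<and> ele (Fin x) b} \<or>
      J = {x. elt a (Fin x) \<and> elt (Fin x) b} \<or>
      J = {x. ele a (Fin x) \<and> elt (Fin x) b} \<or>
      J = {x. elt a (Fin x) \<and> ele (Fin x) b})"

text \<open>R^d is encoded as the maps nat => real vanishing at indices >= d.\<close>
definition embv :: "nat \<Rightarrow> (nat \<Rightarrow> real) set" where
  "embv d = {x. \<forall>i\<ge>d. x i = 0}"

definition dnorm :: "nat \<Rightarrow> (nat \<Rightarrow> real) \<Rightarrow> real" where
  "dnorm d x = sqrt (\<Sum>i<d. (x i)\<^sup>2)"

definition open_dim :: "nat \<Rightarrow> (nat \<Rightarrow> real) set \<Rightarrow> bool" where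
  "open_dim d U \<longleftrightarrow> U \<subseteq> embv d \<and>
     (\<forall>x\<in>U. \<exists>e>0. \<forall>y\<in>embv d. dnorm d (\<lambda>i. y i - x i) < e \<longrightarrow> y \<in> U)"

definition cont_dim :: "nat \<Rightarrow> (nat \<Rightarrow> real) set \<Rightarrow> ((nat \<Rightarrow> real) \<Rightarrow> real) \<Rightarrow> bool" where
  "cont_dim d U g \<longleftrightarrow> (\<forall>x\<in>U. \<forall>e>0. \<exists>\<delta>>0. \<forall>y\<in>U.
       dnorm d (\<lambda>i. y i - x i) < \<delta> \<longrightarrow> \<bar>g y - g x\<bar> < e)"

definition fpd :: "nat \<Rightarrow> ((nat \<Rightarrow> real) \<Rightarrow> real) \<Rightarrow> (nat \<Rightarrow> real) \<Rightarrow> real" where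
  "fpd i g x = deriv (\<lambda>s. g (x(i := s))) (x i)"

fun fpds :: "nat list \<Rightarrow> ((nat \<Rightarrow> real) \<Rightarrow> real) \<Rightarrow> (nat \<Rightarrow> real) \<Rightarrow> real" where
  "fpds [] g = g"
| "fpds (i # is) g = fpd i (fpds is g)"

definition smooth_dim :: "nat \<Rightarrow> (nat \<Rightarrow> real) set \<Rightarrow> ((nat \<Rightarrow> real) \<Rightarrow> real) \<Rightarrow> bool" where
  "smooth_dim d U g \<longleftrightarrow> open_dim d U \<and>
     (\<forall>is. set is \<subseteq> {..<d} \<longrightarrow>
        cont_dim d U (fpds is g) \<and>
        (\<forall>i<d. \<forall>x\<in>U. (\<lambda>s. fpds is g (x(i := s))) differentiable (at (x i))))"

definition prodset :: "nat \<Rightarrow> (nat \<Rightarrow> real) set \<Rightarrow> real set \<Rightarrow> (nat \<Rightarrow> real) set" where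
  "prodset p P V = {q(p := v) | q v. q \<in> P \<and> v \<in> V}"

text \<open>Standard part of a parameter vector in *R^p (only the first p coordinates are used).\<close>
definition pstd :: "nat \<Rightarrow> (nat \<Rightarrow> fermat) \<Rightarrow> nat \<Rightarrow> real" where
  "pstd p q = (\<lambda>i. if i < p then st (q i) else 0)"

definition ext_app :: "nat \<Rightarrow> ((nat \<Rightarrow> real) \<Rightarrow> real) \<Rightarrow> (nat \<Rightarrow> fermat) \<Rightarrow> fermat \<Rightarrow> fermat" where
  "ext_app p \<alpha> q y = abs_fermat (\<lambda>t. \<alpha> (\<lambda>i. if i < p then rep_fermat (q i) t
                                           else if i = p then rep_fermat y t else 0))"

definition loc_rep :: "fermat set \<Rightarrow> (fermat \<Rightarrow> fermat) \<Rightarrow> fermat \<Rightarrow> real set \<Rightarrow> nat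
     \<Rightarrow> (nat \<Rightarrow> real) set \<Rightarrow> (nat \<Rightarrow> fermat) \<Rightarrow> ((nat \<Rightarrow> real) \<Rightarrow> real) \<Rightarrow> bool" where
  "loc_rep S f x V p P q \<alpha> \<longleftrightarrow>
     open V \<and> st x \<in> V \<and> open_dim p P \<and> pstd p q \<in> P \<and>
     smooth_dim (Suc p) (prodset p P V) \<alpha> \<and>
     (\<forall>y\<in>S. st y \<in> V \<longrightarrow> f y = ext_app p \<alpha> q y)"

definition qsmooth :: "fermat set \<Rightarrow> (fermat \<Rightarrow> fermat) \<Rightarrow> bool" where
  "qsmooth S f \<longleftrightarrow> (\<forall>x\<in>S. \<exists>V p P q \<alpha>. loc_rep S f x V p P q \<alpha>)"

definition fermat_deriv :: "fermat set \<Rightarrow> (fermat \<Rightarrow> fermat) \<Rightarrow> fermat \<Rightarrow> fermat" where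
  "fermat_deriv S f x = (SOME v. \<exists>V p P q \<alpha>. loc_rep S f x V p P q \<alpha> \<and>
                                      v = ext_app p (fpd p \<alpha>) q x)"

end

theory Submission
  imports Defs
begin

text \<open>
  Locally f is \<open>y \<mapsto> \<alpha>(q, y)\<close>, so \<open>y \<mapsto> \<integral> \<alpha>(q, s) ds\<close> is a local antiderivative; the difficulty is
  that \<open>q\<close> and \<open>\<alpha>\<close> are far from unique. Along a segment \<open>x + h (y - x)\<close>, \<open>h \<in> [0,1]\<close>, of J a smooth
  function of Fermat reals has, by Taylor's formula, an expansion \<open>\<Sum> c\<^sub>a(h) t\<^sup>a + o(t)\<close> with
  continuous coefficients and an error uniform in h. If such a family is \<open>o(t)\<close> for every single h,
  linear independence of the powers up to t forces these coefficients to vanish, hence the family is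
  \<open>o(t)\<close> uniformly and may be integrated in h; likewise, if its h-primitive is pointwise \<open>o(t)\<close>,
  then the primitives of the coefficients vanish, and the family itself is \<open>o(t)\<close>. The second fact
  makes the derivative independent of the representation, the first shows that two antiderivatives
  differ by a constant, which allows local antiderivatives to be glued along segments of J.
\<close>

text \<open>Uniformity in h is the real obstacle. A family may be o(t) for every h without being so
  uniformly, and the h-derivative of a small family may be large: t^2 sin(h / t^2) has derivative
  cos(h / t^2). Continuous coefficients on finitely many powers exclude both. The threshold is the
  exponent 1, since t^a is itself o(t) for a > 1. The ring has nilpotent elements, so (y - x) c = 0
  yields c = 0 only when y - x is invertible, that is, when the standard parts of x and y differ.
  This is where a non-infinitesimal J enters: every point of J is joined by arbitrarily short
  segments to points with another standard part. A constant of integration is a Fermat real, in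
  general not a real number, so it cannot be absorbed into \<alpha>; it becomes a further parameter.
  Fermat neighbourhoods only see standard parts, so localisation and gluing take place over open
  sets of reals. These are kept convex in order that two of them overlap in an interval, on which
  the difference of two antiderivatives is constant.\<close>

section \<open>Uniform small-o expansions\<close>

text \<open>Unlike \<^term>\<open>at_right 0\<close>, this filter includes the point 0 itself, as \<^const>\<open>littleo\<close> does;
  thus \<open>o(t)\<close> families vanish at \<open>t = 0\<close>.\<close>

definition germ0 :: "real filter" where "germ0 = inf (nhds 0) (principal {0..})"

lemma eventually_germ0:
  "eventually P germ0 \<longleftrightarrow> (\<exists>\<delta>>0. \<forall>t. 0 \<le> t \<and> t < \<delta> \<longrightarrow> P t)"
proof -
  have "eventually P germ0 \<longleftrightarrow> (\<exists>\<delta>>0. \<forall>t. dist t 0 < \<delta> \<longrightarrow> t \<in> {0..} \<longrightarrow> P t)"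
    unfolding germ0_def eventually_inf_principal eventually_nhds_metric by simp
  also have "\<dots> \<longleftrightarrow> (\<exists>\<delta>>0. \<forall>t. 0 \<le> t \<and> t < \<delta> \<longrightarrow> P t)"
    by (intro ex_cong1 conj_cong refl) (auto simp: dist_real_def)
  finally show ?thesis .
qed

lemma littleo_iff: "littleo h \<longleftrightarrow> (\<forall>\<epsilon>>0. \<forall>\<^sub>F t in germ0. \<bar>h t\<bar> \<le> \<epsilon> * t)"
  unfolding littleo_def eventually_germ0 by simp

lemma eventually_germ0_at_0: "eventually P germ0 \<Longrightarrow> P 0"
  unfolding eventually_germ0 by auto

lemma eventually_germ0_lt: "0 < d \<Longrightarrow> \<forall>\<^sub>F t in germ0. 0 \<le> t \<and> t < d"
  unfolding eventually_germ0 by blast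

section \<open>Families that are o(t) or bounded uniformly for h in [0,1]\<close>

definition usmall :: "(real \<Rightarrow> real \<Rightarrow> real) \<Rightarrow> bool" where
  "usmall R \<longleftrightarrow> (\<forall>\<epsilon>>0. \<forall>\<^sub>F t in germ0. \<forall>h\<in>{0..1}. \<bar>R t h\<bar> \<le> \<epsilon> * t)"

lemma usmallD: "usmall R \<Longrightarrow> 0 < \<epsilon> \<Longrightarrow> \<forall>\<^sub>F t in germ0. \<forall>h\<in>{0..1}. \<bar>R t h\<bar> \<le> \<epsilon> * t"
  unfolding usmall_def by blast

definition ubounded :: "(real \<Rightarrow> real \<Rightarrow> real) \<Rightarrow> bool" where
  "ubounded R \<longleftrightarrow> (\<exists>C. \<forall>\<^sub>F t in germ0. \<forall>h\<in>{0..1}. \<bar>R t h\<bar> \<le> C)"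

text \<open>Reading an o(t) map as a family constant in h lets \<open>littleo\<close> inherit the
  calculus of \<open>usmall\<close>.\<close>

lemma littleo_usmall: "littleo h \<longleftrightarrow> usmall (\<lambda>t _. h t)"
  unfolding littleo_iff usmall_def by (simp add: ball_simps(5) Ball_def) (meson le_numeral_extra(1,3) zero_le_one)

lemma usmall_littleo: "usmall R \<Longrightarrow> h \<in> {0..1} \<Longrightarrow> littleo (\<lambda>t. R t h)"
  unfolding littleo_iff by (auto dest!: usmallD elim!: eventually_mono)

lemma usmall_0 [simp]: "usmall (\<lambda>t h. 0)"
  unfolding usmall_def by (auto simp: eventually_germ0 intro: exI[of _ 1])

lemma usmall_eventually_eq:
  assumes "usmall R" "\<forall>\<^sub>F t in germ0. \<forall>h\<in>{0..1}. S t h = R t h"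
  shows "usmall S"
  unfolding usmall_def
proof (intro allI impI)
  fix e :: real assume "e > 0"
  then have "\<forall>\<^sub>F t in germ0. \<forall>h\<in>{0..1}. \<bar>R t h\<bar> \<le> e * t" using assms(1) by (auto simp: usmall_def)
  with assms(2) show "\<forall>\<^sub>F t in germ0. \<forall>h\<in>{0..1}. \<bar>S t h\<bar> \<le> e * t"
    by eventually_elim auto
qed

lemma usmall_add:
  assumes "usmall R" "usmall S" shows "usmall (\<lambda>t h. R t h + S t h)"
  unfolding usmall_def
proof (intro allI impI)
  fix e :: real assume "e > 0"
  then have "0 < e/2" by simp
  then have "\<forall>\<^sub>F t in germ0. \<forall>h\<in>{0..1}. \<bar>R t h\<bar> \<le> e/2 * t" "\<forall>\<^sub>F t in germ0. \<forall>h\<in>{0..1}. \<bar>S t h\<bar> \<le> e/2 * t"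
    by (rule usmallD[OF assms(1)], rule usmallD[OF assms(2)])
  then show "\<forall>\<^sub>F t in germ0. \<forall>h\<in>{0..1}. \<bar>R t h + S t h\<bar> \<le> e * t"
  proof eventually_elim
    case (elim t)
    show ?case
    proof
      fix h :: real assume "h \<in> {0..1}"
      with elim have "\<bar>R t h\<bar> \<le> e/2 * t" "\<bar>S t h\<bar> \<le> e/2 * t" by auto
      then have "\<bar>R t h\<bar> * 2 \<le> e * t" "\<bar>S t h\<bar> * 2 \<le> e * t" by simp_all
      then show "\<bar>R t h + S t h\<bar> \<le> e * t" by linarith
    qed
  qed
qed

lemma usmall_mult:
  assumes "ubounded B" "usmall R" shows "usmall (\<lambda>t h. B t h * R t h)"
  unfolding usmall_def
proof (intro allI impI)
  fix e :: real assume e: "e > 0"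
  obtain C where C: "\<forall>\<^sub>F t in germ0. \<forall>h\<in>{0..1}. \<bar>B t h\<bar> \<le> C"
    using assms(1) by (auto simp: ubounded_def)
  \<comment> \<open>The bound \<open>C\<close> may be 0; \<open>D\<close> is a positive bound by
    which \<open>e\<close> can be divided.\<close>
  define D where "D = max C 1"
  have D: "D > 0" "C \<le> D" by (auto simp: D_def)
  have "\<forall>\<^sub>F t in germ0. \<forall>h\<in>{0..1}. \<bar>R t h\<bar> \<le> e / D * t"
    using assms(2) e D by (intro usmallD) auto
  with C show "\<forall>\<^sub>F t in germ0. \<forall>h\<in>{0..1}. \<bar>B t h * R t h\<bar> \<le> e * t"
  proof eventually_elim
    case (elim t)
    show ?case
    proof
      fix h :: real assume "h \<in> {0..1}"
      with elim have "\<bar>R t h\<bar> \<le> e / D * t" "\<bar>B t h\<bar> \<le> D" using D by force+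
      then have "\<bar>B t h\<bar> * \<bar>R t h\<bar> \<le> D * (e / D * t)" by (intro mult_mono) (use D in auto)
      then show "\<bar>B t h * R t h\<bar> \<le> e * t" using D by (simp add: abs_mult)
    qed
  qed
qed

lemma ubounded_const: "continuous_on {0..1} c \<Longrightarrow> ubounded (\<lambda>t h. c h)"
proof -
  assume "continuous_on {0..1} c"
  then have "bounded (c ` {0..1})" by (intro compact_imp_bounded compact_continuous_image) auto
  then obtain a where "\<forall>x\<in>c ` {0..1}. norm x \<le> a" unfolding bounded_iff by blast
  then show ?thesis unfolding ubounded_def by (intro exI[of _ a]) auto
qed

lemma usmall_cmult: "usmall R \<Longrightarrow> usmall (\<lambda>t h. k * R t h)"
  by (rule usmall_mult) (auto intro!: ubounded_const)

lemma usmall_minus: "usmall R \<Longrightarrow> usmall (\<lambda>t h. - R t h)"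
  using usmall_cmult[of R "-1"] by simp

lemma usmall_diff: "usmall R \<Longrightarrow> usmall S \<Longrightarrow> usmall (\<lambda>t h. R t h - S t h)"
  using usmall_add[OF _ usmall_minus] by simp

lemma ubounded_add:
  assumes "ubounded R" "ubounded S" shows "ubounded (\<lambda>t h. R t h + S t h)"
proof -
  from assms obtain C D where "\<forall>\<^sub>F t in germ0. \<forall>h\<in>{0..1}. \<bar>R t h\<bar> \<le> C" "\<forall>\<^sub>F t in germ0. \<forall>h\<in>{0..1}. \<bar>S t h\<bar> \<le> D"
    by (auto simp: ubounded_def)
  then have "\<forall>\<^sub>F t in germ0. \<forall>h\<in>{0..1}. \<bar>R t h + S t h\<bar> \<le> C + D"
    by eventually_elim (fastforce intro: abs_triangle_ineq[THEN order_trans])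
  then show ?thesis unfolding ubounded_def by blast
qed

lemma ubounded_mult:
  assumes "ubounded R" "ubounded S" shows "ubounded (\<lambda>t h. R t h * S t h)"
proof -
  from assms obtain C D where "\<forall>\<^sub>F t in germ0. \<forall>h\<in>{0..1}. \<bar>R t h\<bar> \<le> C" "\<forall>\<^sub>F t in germ0. \<forall>h\<in>{0..1}. \<bar>S t h\<bar> \<le> D"
    by (auto simp: ubounded_def)
  then have "\<forall>\<^sub>F t in germ0. \<forall>h\<in>{0..1}. \<bar>R t h * S t h\<bar> \<le> C * D"
  proof eventually_elim
    case (elim t)
    show ?case
    proof
      fix h :: real assume "h \<in> {0..1}"
      with elim have "\<bar>R t h\<bar> \<le> C" "\<bar>S t h\<bar> \<le> D" by auto
      then show "\<bar>R t h * S t h\<bar> \<le> C * D" by (auto simp: abs_mult intro!: mult_mono)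
    qed
  qed
  then show ?thesis unfolding ubounded_def by blast
qed

lemma usmall_ubounded: "usmall R \<Longrightarrow> ubounded R"
proof -
  assume "usmall R"
  then have "\<forall>\<^sub>F t in germ0. \<forall>h\<in>{0..1}. \<bar>R t h\<bar> \<le> 1 * t" unfolding usmall_def using zero_less_one by blast
  moreover have "\<forall>\<^sub>F t in germ0. 0 \<le> t \<and> t < 1" by (rule eventually_germ0_lt) simp
  ultimately have "\<forall>\<^sub>F t in germ0. \<forall>h\<in>{0..1}. \<bar>R t h\<bar> \<le> 1" by eventually_elim fastforce
  then show ?thesis unfolding ubounded_def by blast
qed

lemma usmall_powr:
  assumes "1 < a" shows "usmall (\<lambda>t h. t powr a)"
  unfolding usmall_def
proof (intro allI impI)
  fix e :: real assume e: "e > 0"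
  \<comment> \<open>The second entry is the solution t of t powr (a - 1) = e.\<close>
  define d where "d = min 1 (e powr (1/(a-1)))"
  have "d > 0" using e by (simp add: d_def)
  from eventually_germ0_lt[OF this] show "\<forall>\<^sub>F t in germ0. \<forall>h\<in>{0..1}. \<bar>t powr a\<bar> \<le> e * t"
  proof eventually_elim
    case (elim t)
    have "t powr (a - 1) \<le> (e powr (1/(a-1))) powr (a-1)"
      using elim assms by (intro powr_mono2) (auto simp: d_def)
    also have "\<dots> = e" using e assms by (simp add: powr_powr)
    finally have "t powr (a-1) * t \<le> e * t" using elim by (intro mult_right_mono) auto
    moreover have "t powr (a-1) * t = t powr a"
      using elim powr_mult_base[of t "a-1"] by (simp add: mult.commute)
    ultimately show ?case by simp
  qed
qed

section \<open>Expansions in real powers of t with coefficients depending on h\<close>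

lemma tpow_nonneg: "0 \<le> tpow t a" by (simp add: tpow_def)

lemma tpow_le_1: "0 \<le> t \<Longrightarrow> t \<le> 1 \<Longrightarrow> 0 \<le> a \<Longrightarrow> tpow t a \<le> 1"
  by (auto simp: tpow_def powr_le1)

lemma tpow_add: "0 \<le> a \<Longrightarrow> 0 \<le> b \<Longrightarrow> tpow t (a + b) = tpow t a * tpow t b"
  by (auto simp: tpow_def powr_add)

lemma tpow_at_0: "tpow 0 a = (if a = 0 then 1 else 0)" by (simp add: tpow_def)

text \<open>Terms form a list in which exponents may repeat. Sums are then concatenations and
  products are formed term by term; equal exponents are collected only when coefficients are
  compared.\<close>

definition psum :: "((real \<Rightarrow> real) \<times> real) list \<Rightarrow> real \<Rightarrow> real \<Rightarrow> real" where
  "psum cs t h = (\<Sum>(c, a)\<leftarrow>cs. c h * tpow t a)"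

definition admissible :: "((real \<Rightarrow> real) \<times> real) list \<Rightarrow> bool" where
  "admissible cs \<longleftrightarrow> (\<forall>(c, a)\<in>set cs. 0 \<le> a \<and> continuous_on {0..1} c)"

lemma psum_simps [simp]: "psum [] t h = 0" "psum ((c, a) # cs) t h = c h * tpow t a + psum cs t h"
  "psum (cs @ ds) t h = psum cs t h + psum ds t h"
  by (simp_all add: psum_def)

lemma admissible_simps [simp]: "admissible []"
  "admissible ((c, a) # cs) \<longleftrightarrow> 0 \<le> a \<and> continuous_on {0..1} c \<and> admissible cs"
  "admissible (cs @ ds) \<longleftrightarrow> admissible cs \<and> admissible ds"
  by (auto simp: admissible_def)

text \<open>The version of \<open>Ro\<close> with a parameter: for families constant in h the two
  notions agree, see \<open>Ro_iff_expandable\<close>.\<close>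

definition expandable :: "(real \<Rightarrow> real \<Rightarrow> real) \<Rightarrow> bool" where
  "expandable G \<longleftrightarrow> (\<exists>cs. admissible cs \<and> usmall (\<lambda>t h. G t h - psum cs t h))"

lemma expandableI: "admissible cs \<Longrightarrow> usmall (\<lambda>t h. G t h - psum cs t h) \<Longrightarrow> expandable G"
  unfolding expandable_def by blast

lemma expandable_cong_usmall:
  assumes "expandable G" "usmall (\<lambda>t h. H t h - G t h)" shows "expandable H"
proof -
  from assms obtain cs where cs: "admissible cs" "usmall (\<lambda>t h. G t h - psum cs t h)" by (auto simp: expandable_def)
  show ?thesis by (rule expandableI[OF cs(1)]) (use usmall_add[OF assms(2) cs(2)] in simp)
qed

lemma expandable_cong_eventually:
  assumes "expandable G" "\<forall>\<^sub>F t in germ0. \<forall>h\<in>{0..1}. H t h = G t h" shows "expandable H"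
  using assms(1)
proof (rule expandable_cong_usmall)
  show "usmall (\<lambda>t h. H t h - G t h)"
    by (rule usmall_eventually_eq[OF usmall_0]) (use assms(2) in \<open>eventually_elim, auto\<close>)
qed

lemma expandable_psum: "admissible cs \<Longrightarrow> expandable (psum cs)"
  by (rule expandableI) auto

lemma expandable_const: "continuous_on {0..1} c \<Longrightarrow> expandable (\<lambda>t h. c h)"
  using expandable_psum[of "[(c, 0)]"] by (simp add: tpow_def[abs_def] psum_def[abs_def])

lemma expandable_add:
  assumes "expandable G" "expandable H" shows "expandable (\<lambda>t h. G t h + H t h)"
proof -
  from assms obtain cs ds where cs: "admissible cs" "usmall (\<lambda>t h. G t h - psum cs t h)" 
    and ds: "admissible ds" "usmall (\<lambda>t h. H t h - psum ds t h)" by (auto simp: expandable_def)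
  show ?thesis 
    by (rule expandableI[of "cs @ ds"]) (use cs ds usmall_add[OF cs(2) ds(2)] in \<open>auto simp: algebra_simps\<close>)
qed

lemma tpow_ubounded: "0 \<le> a \<Longrightarrow> ubounded (\<lambda>t h. tpow t a)"
proof -
  assume a: "0 \<le> a"
  have "\<forall>\<^sub>F t in germ0. 0 \<le> t \<and> t < 1" by (rule eventually_germ0_lt) simp
  then have "\<forall>\<^sub>F t in germ0. \<forall>h\<in>{0..1::real}. \<bar>tpow t a\<bar> \<le> 1"
    by eventually_elim (use a in \<open>auto simp: tpow_nonneg tpow_le_1\<close>)
  then show ?thesis unfolding ubounded_def by blast
qed

lemma psum_ubounded: "admissible cs \<Longrightarrow> ubounded (psum cs)"
proof (induction cs)
  case Nil
  then show ?case using ubounded_const[of "\<lambda>_. 0"] by (simp add: psum_def[abs_def])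
next
  case (Cons ca cs)
  then show ?case
    by (cases ca) (auto simp: psum_simps(2)[abs_def] intro!: ubounded_add ubounded_mult ubounded_const tpow_ubounded)
qed

lemma expandable_ubounded: "expandable G \<Longrightarrow> ubounded G"
  unfolding expandable_def using ubounded_add[OF psum_ubounded usmall_ubounded] by fastforce

lemma psum_mult_single:
  "0 \<le> b \<Longrightarrow> admissible cs \<Longrightarrow> psum (map (\<lambda>(c, a). (\<lambda>h. d h * c h, b + a)) cs) t h = d h * tpow t b * psum cs t h"
  by (induction cs) (auto simp: tpow_add algebra_simps)

lemma admissible_mult_single:
  "0 \<le> b \<Longrightarrow> continuous_on {0..1} d \<Longrightarrow> admissible cs \<Longrightarrow> admissible (map (\<lambda>(c, a). (\<lambda>h. d h * c h, b + a)) cs)"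
  by (induction cs) (auto intro!: continuous_intros)

lemma expandable_mult_psum: "admissible cs \<Longrightarrow> admissible ds \<Longrightarrow> expandable (\<lambda>t h. psum cs t h * psum ds t h)"
proof (induction cs)
  case Nil
  then show ?case using expandable_psum[of "[]"] by (simp add: psum_def[abs_def])
next
  case (Cons ca cs)
  obtain c a where ca: "ca = (c, a)" by force
  have "expandable (\<lambda>t h. c h * tpow t a * psum ds t h)"
    using expandable_psum[OF admissible_mult_single[of a c ds]] Cons.prems psum_mult_single[of a ds c]
    by (simp add: ca expandable_def)
  then show ?case using Cons expandable_add by (simp add: ca distrib_right)
qed

lemma expandable_mult:
  assumes "expandable G" "expandable H" shows "expandable (\<lambda>t h. G t h * H t h)"
proof -
  from assms obtain cs ds where cs: "admissible cs" "usmall (\<lambda>t h. G t h - psum cs t h)" 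
    and ds: "admissible ds" "usmall (\<lambda>t h. H t h - psum ds t h)" by (auto simp: expandable_def)
  \<comment> \<open>The error of the product is split so that every small factor is multiplied by a
    bounded one.\<close>
  have "usmall (\<lambda>t h. G t h * (H t h - psum ds t h) + psum ds t h * (G t h - psum cs t h))"
    by (intro usmall_add usmall_mult expandable_ubounded psum_ubounded assms cs ds)
  then show ?thesis
    by (intro expandable_cong_usmall[OF expandable_mult_psum[OF cs(1) ds(1)]]) (simp add: algebra_simps)
qed

lemma expandable_minus: "expandable G \<Longrightarrow> expandable (\<lambda>t h. - G t h)"
  using expandable_mult[OF expandable_const[of "\<lambda>_. - 1"]] by simp

lemma expandable_diff: "expandable G \<Longrightarrow> expandable H \<Longrightarrow> expandable (\<lambda>t h. G t h - H t h)"
  using expandable_add[OF _ expandable_minus] by simp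

lemma expandable_sum: "(\<And>i. i \<in> A \<Longrightarrow> expandable (G i)) \<Longrightarrow> expandable (\<lambda>t h. \<Sum>i\<in>A. G i t h)"
  by (induction A rule: infinite_finite_induct) (auto intro!: expandable_add expandable_const)

lemma expandable_Ro:
  assumes "x \<in> Ro" shows "expandable (\<lambda>t h. x t)"
proof -
  from assms obtain r cs where cs: "\<forall>(\<alpha>, a)\<in>set cs. (0::real) \<le> a"
    and l: "littleo (\<lambda>t. x t - r - (\<Sum>(\<alpha>, a)\<leftarrow>cs. \<alpha> * tpow t a))" unfolding Ro_def by blast
  define ds where "ds = (\<lambda>h::real. r, 0::real) # map (\<lambda>(\<alpha>, a). (\<lambda>h. \<alpha>, a)) cs"
  have "admissible ds" using cs by (auto simp: ds_def admissible_def)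
  moreover have "psum ds t h = r + (\<Sum>(\<alpha>, a)\<leftarrow>cs. \<alpha> * tpow t a)" for t h
    by (simp add: ds_def tpow_at_0 tpow_def[of t 0] psum_def comp_def case_prod_unfold)
  ultimately show ?thesis using l by (intro expandableI[of ds]) (simp_all add: littleo_usmall diff_diff_eq)
qed

lemma Ro_expandable:
  assumes "expandable G" "h \<in> {0..1}" shows "(\<lambda>t. G t h) \<in> Ro"
proof -
  obtain cs where cs: "admissible cs" "usmall (\<lambda>t h. G t h - psum cs t h)" using assms by (auto simp: expandable_def)
  define ds where "ds = map (\<lambda>(c, a). (c h, a)) cs"
  have "psum cs t h = (\<Sum>(\<alpha>, a)\<leftarrow>ds. \<alpha> * tpow t a)" for t
    unfolding ds_def by (induction cs) (auto simp: psum_def)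
  \<comment> \<open>The constant of \<open>Ro\<close> is taken to be 0, because constants already
    occur as terms with exponent 0.\<close>
  then have "littleo (\<lambda>t. G t h - 0 - (\<Sum>(\<alpha>, a)\<leftarrow>ds. \<alpha> * tpow t a))"
    using usmall_littleo[OF cs(2) assms(2)] by simp
  moreover have "\<forall>(\<alpha>, a)\<in>set ds. 0 \<le> a" using cs(1) by (auto simp: ds_def admissible_def)
  ultimately show ?thesis unfolding Ro_def by blast
qed

section \<open>Linear independence of the powers up to t\<close>

definition coef :: "((real \<Rightarrow> real) \<times> real) list \<Rightarrow> real \<Rightarrow> real \<Rightarrow> real" where
  "coef cs a h = (\<Sum>(c, b)\<leftarrow>cs. if b = a then c h else 0)"

lemma continuous_on_coef: "admissible cs \<Longrightarrow> continuous_on {0..1} (coef cs a)"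
proof (induction cs)
  case (Cons cb cs)
  obtain c b where "cb = (c, b)" by force
  with Cons show ?case by (cases "b = a") (auto simp: coef_def[abs_def] intro!: continuous_intros)
qed (simp add: coef_def[abs_def])

text \<open>Linear independence concerns distinct exponents, so repeated ones are merged first. The
  set \<open>A\<close> may be larger than the set of exponents; this makes the induction on the list
  go through.\<close>

lemma psum_collect:
  "finite A \<Longrightarrow> snd ` set cs \<subseteq> A \<Longrightarrow> psum cs t h = (\<Sum>a\<in>A. coef cs a h * tpow t a)"
proof (induction cs)
  case (Cons cb cs)
  obtain c b where [simp]: "cb = (c, b)" by force
  have "(\<Sum>a\<in>A. coef (cb # cs) a h * tpow t a)
      = (\<Sum>a\<in>A. (if b = a then c h * tpow t a else 0)) + (\<Sum>a\<in>A. coef cs a h * tpow t a)"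
    by (subst sum.distrib[symmetric]) (auto simp: coef_def algebra_simps intro!: sum.cong)
  also have "(\<Sum>a\<in>A. (if b = a then c h * tpow t a else 0)) = c h * tpow t b"
    using Cons.prems by (simp add: sum.delta)
  finally show ?case using Cons by simp
qed (simp add: coef_def)

lemma eventually_germ0_at_right: "eventually P germ0 \<Longrightarrow> eventually P (at_right 0)"
  unfolding eventually_germ0 eventually_at_right_field by force

text \<open>Divide by t powr m, where m is the lowest exponent with nonzero coefficient; m is at
  most 1 because \<open>a\<close> is a candidate. The quotient tends to \<open>k m\<close>, and it
  tends to 0 because the sum is o(t), a contradiction.\<close>

lemma littleo_powers_independent:
  assumes A: "finite A" "A \<subseteq> {0..}" and o: "littleo (\<lambda>t. \<Sum>a\<in>A. k a * tpow t a)"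
    and a: "a \<in> A" "a \<le> 1"
  shows "k a = 0"
proof (rule ccontr)
  assume ka: "k a \<noteq> 0"
  define B where "B = {b\<in>A. k b \<noteq> 0}"
  have B: "finite B" "a \<in> B" using A a ka by (auto simp: B_def)
  define m where "m = Min B"
  have m: "m \<in> B" "m \<le> 1" "\<And>b. b \<in> B \<Longrightarrow> m \<le> b"
    using B a by (auto simp: m_def intro: Min_in Min.coboundedI[of B a, THEN order_trans])
  have lim: "((\<lambda>t. \<Sum>b\<in>B. k b * t powr (b - m)) \<longlongrightarrow> (\<Sum>b\<in>B. k b * (if b = m then 1 else 0))) (at_right 0)"
  proof (intro tendsto_sum tendsto_mult tendsto_const)
    fix b assume b: "b \<in> B"
    show "((\<lambda>t. t powr (b - m)) \<longlongrightarrow> (if b = m then 1 else 0)) (at_right 0)"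
    proof (cases "b = m")
      case True
      have "\<forall>\<^sub>F t in at_right 0. t powr (b - m) = (1::real)"
        using True by (auto simp: eventually_at_right_field intro: exI[of _ 1])
      then show ?thesis using True by (simp add: tendsto_eventually)
    next
      case False
      then have "b - m > 0" using m(3)[OF b] by simp
      then have "((\<lambda>t::real. t powr (b - m)) \<longlongrightarrow> 0 powr (b - m)) (at_right 0)"
        by (intro tendsto_powr' tendsto_intros) (auto simp: eventually_at_right_field intro: exI[of _ 1])
      then show ?thesis using False by simp
    qed
  qed
  have km: "(\<Sum>b\<in>B. k b * (if b = m then 1 else 0)) = k m"
    using B m by (simp add: if_distrib sum.delta cong: if_cong)
  have bound: "\<bar>k m\<bar> \<le> e" if "e > 0" for e
  proof (rule tendsto_upperbound)
    show "((\<lambda>t. \<bar>\<Sum>b\<in>B. k b * t powr (b - m)\<bar>) \<longlongrightarrow> \<bar>k m\<bar>) (at_right 0)"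
      using tendsto_rabs[OF lim] unfolding km .
    have "\<forall>\<^sub>F t in at_right 0. \<bar>\<Sum>a\<in>A. k a * tpow t a\<bar> \<le> e * t"
      using o that unfolding littleo_iff by (intro eventually_germ0_at_right) auto
    moreover have "\<forall>\<^sub>F t in at_right 0. (0::real) < t \<and> t < 1"
      by (auto simp: eventually_at_right_field intro: exI[of _ 1])
    ultimately show "\<forall>\<^sub>F t in at_right 0. \<bar>\<Sum>b\<in>B. k b * t powr (b - m)\<bar> \<le> e"
    proof eventually_elim
      case (elim t)
      have "(\<Sum>a\<in>A. k a * tpow t a) = (\<Sum>b\<in>B. k b * tpow t b)"
        by (rule sum.mono_neutral_right) (use A in \<open>auto simp: B_def\<close>)
      also have "\<dots> = t powr m * (\<Sum>b\<in>B. k b * t powr (b - m))"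
        unfolding sum_distrib_left
        by (rule sum.cong) (use elim in \<open>auto simp: tpow_def powr_diff\<close>)
      finally have "t powr m * \<bar>\<Sum>b\<in>B. k b * t powr (b - m)\<bar> \<le> e * t"
        using elim by (simp add: abs_mult)
      \<comment> \<open>Here t \<le> t powr m, as m \<le> 1 and 0 < t < 1.\<close>
      also have "\<dots> \<le> e * t powr m"
        using that elim m(2) powr_mono'[of m 1 t] by (intro mult_left_mono) auto
      finally show ?case using elim by (simp add: mult.commute[of e])
    qed
  qed simp
  have "\<bar>k m\<bar> \<le> 0" by (rule field_le_epsilon) (use bound in simp)
  then show False using m(1) by (simp add: B_def)
qed

text \<open>Powers above 1 are o(t) whatever their coefficients, so only the collected coefficients
  up to exponent 1 have to vanish.\<close>

lemma usmall_psum: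
  assumes "admissible cs" "\<And>a h. a \<le> 1 \<Longrightarrow> h \<in> {0..1} \<Longrightarrow> a \<in> snd ` set cs \<Longrightarrow> coef cs a h = 0"
  shows "usmall (psum cs)"
proof -
  have us: "usmall (\<lambda>t h. \<Sum>a\<in>A. F a t h)" if "finite A" "\<And>a. a \<in> A \<Longrightarrow> usmall (F a)" for A :: "real set" and F
    using that by (induction A rule: finite_induct) (auto intro!: usmall_add)
  have "usmall (\<lambda>t h. \<Sum>a\<in>snd ` set cs. coef cs a h * tpow t a)"
  proof (rule us)
    fix a assume a: "a \<in> snd ` set cs"
    show "usmall (\<lambda>t h. coef cs a h * tpow t a)"
    proof (cases "a \<le> 1")
      case True
      show ?thesis by (rule usmall_eventually_eq[OF usmall_0]) (use assms(2)[OF True _ a] in auto)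
    next
      case False
      then show ?thesis using usmall_powr[of a]
        by (intro usmall_mult ubounded_const continuous_on_coef assms) (auto simp: tpow_def[abs_def])
    qed
  qed simp
  also have "(\<lambda>t h. \<Sum>a\<in>snd ` set cs. coef cs a h * tpow t a) = psum cs"
    by (intro ext) (rule psum_collect[symmetric], auto)
  finally show ?thesis .
qed

lemma coef_eq_0:
  assumes "admissible cs" "littleo (\<lambda>t. \<Sum>a\<in>snd ` set cs. k a * tpow t a)" "a \<in> snd ` set cs" "a \<le> 1"
  shows "k a = 0"
  by (rule littleo_powers_independent[of "snd ` set cs" k a]) (use assms in \<open>auto simp: admissible_def\<close>)

lemma littleo_diff: "littleo x \<Longrightarrow> littleo y \<Longrightarrow> littleo (\<lambda>t. x t - y t)"
  using usmall_diff by (simp add: littleo_usmall)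

lemma littleo_add: "littleo x \<Longrightarrow> littleo y \<Longrightarrow> littleo (\<lambda>t. x t + y t)"
  using usmall_add by (simp add: littleo_usmall)

text \<open>Pointwise smallness of an expandable family is automatically uniform, because the
  coefficients of all powers up to 1 have to vanish.\<close>

lemma usmall_if_pointwise:
  assumes "expandable G" "\<And>h. h \<in> {0..1} \<Longrightarrow> littleo (\<lambda>t. G t h)"
  shows "usmall G"
proof -
  obtain cs where cs: "admissible cs" "usmall (\<lambda>t h. G t h - psum cs t h)" 
    using assms by (auto simp: expandable_def)
  have "usmall (psum cs)"
  proof (rule usmall_psum[OF cs(1)])
    fix a h :: real assume a: "a \<le> 1" "h \<in> {0..1}" "a \<in> snd ` set cs"
    have "littleo (\<lambda>t. psum cs t h)"
      using littleo_diff[OF assms(2)[OF a(2)] usmall_littleo[OF cs(2) a(2)]] by simp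
    then show "coef cs a h = 0"
      using coef_eq_0[OF cs(1) _ a(3,1), of "\<lambda>a. coef cs a h"] by (simp add: psum_collect[of "snd ` set cs" cs])
  qed
  from usmall_add[OF cs(2) this] show ?thesis by simp
qed

text \<open>The way from a small family to its derivative leads through the coefficients of
  \<open>G'\<close>: these are integrated, their primitives are shown to vanish on all of [0,1], and
  differentiating gives back the coefficients.\<close>

lemma usmall_derivative_if_pointwise:
  assumes G': "expandable G'" and small: "\<And>h. h \<in> {0..1} \<Longrightarrow> littleo (\<lambda>t. G t h)"
    and der: "\<forall>\<^sub>F t in germ0. \<forall>h\<in>{0..1}. (G t has_real_derivative G' t h) (at h within {0..1})"
  shows "usmall G'"
proof -
  obtain cs where cs: "admissible cs" "usmall (\<lambda>t h. G' t h - psum cs t h)" 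
    using assms by (auto simp: expandable_def)
  define C where "C a h = integral {0..h} (coef cs a)" for a h
  define H where "H t h = (\<Sum>a\<in>snd ` set cs. C a h * tpow t a)" for t h
  have C: "(C a has_real_derivative coef cs a h) (at h within {0..1})" if "h \<in> {0..1}" for a h
    unfolding C_def[abs_def] by (rule integral_has_real_derivative[OF continuous_on_coef[OF cs(1)] that])
  have H: "(H t has_real_derivative psum cs t h) (at h within {0..1})" if "h \<in> {0..1}" for t h
    unfolding H_def[abs_def] using that
    by (subst psum_collect[of "snd ` set cs"]) (auto intro!: derivative_eq_intros C)
  \<comment> \<open>Mean value theorem: the h-derivatives of \<open>G\<close> and \<open>H\<close>
    differ by at most e * t on [0,1].\<close>
  have "usmall (\<lambda>t h. (G t h - H t h) - (G t 0 - H t 0))"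
    unfolding usmall_def
  proof (intro allI impI)
    fix e :: real assume e: "e > 0"
    have "\<forall>\<^sub>F t in germ0. 0 \<le> t \<and> t < 1" by (rule eventually_germ0_lt) simp
    with usmallD[OF cs(2) e] der
    show "\<forall>\<^sub>F t in germ0. \<forall>h\<in>{0..1}. \<bar>(G t h - H t h) - (G t 0 - H t 0)\<bar> \<le> e * t"
    proof eventually_elim
      case (elim t)
      show ?case
      proof
        fix h :: real assume h: "h \<in> {0..1}"
        have "norm ((G t h - H t h) - (G t 0 - H t 0)) \<le> e * t * norm (h - 0)"
          by (rule field_differentiable_bound[of "{0..1}" _ "\<lambda>h. G' t h - psum cs t h"])
            (use elim H h in \<open>auto intro!: derivative_intros\<close>)
        also have "\<dots> \<le> e * t" using elim h e by (simp add: mult_left_le)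
        finally show "\<bar>(G t h - H t h) - (G t 0 - H t 0)\<bar> \<le> e * t" by simp
      qed
    qed
  qed
  moreover have H0: "H t 0 = 0" for t by (simp add: H_def C_def)
  ultimately have us: "usmall (\<lambda>t h. (G t h - H t h) - G t 0)" by simp
  \<comment> \<open>Smallness of \<open>G\<close> at h and at 0 is subtracted; only
    \<open>H\<close>, which vanishes at h = 0, remains.\<close>
  have Hs: "littleo (\<lambda>t. H t h)" if "h \<in> {0..1}" for h
    using littleo_diff[OF littleo_diff[OF small[OF that] small[of 0]] usmall_littleo[OF us that]] by simp
  have "usmall (psum cs)"
  proof (rule usmall_psum[OF cs(1)])
    fix a h :: real assume a: "a \<le> 1" "h \<in> {0..1}" "a \<in> snd ` set cs"
    have "C a x = 0" if "x \<in> {0..1}" for x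
      using coef_eq_0[OF cs(1) _ a(3,1), of "\<lambda>a. C a x"] Hs[OF that] by (simp add: H_def)
    \<comment> \<open>\<open>C a\<close> is 0 on the whole interval, so its derivative within [0,1]
      is 0, at the end points too; that derivative is the coefficient.\<close>
    then have "(C a has_real_derivative 0) (at h within {0..1})"
      using has_field_derivative_transform_within[OF DERIV_const zero_less_one a(2), of 0 "C a"] by simp
    with C[OF a(2)] show "coef cs a h = 0"
      using vector_derivative_unique_within_closed_interval[of 0 1 h "C a"] a(2)
      unfolding has_real_derivative_iff_has_vector_derivative by simp
  qed
  from usmall_add[OF cs(2) this] show ?thesis by simp
qed

text \<open>Mean value theorem on an interval of length 1, which preserves the bound e * t.\<close>

lemma usmall_integrated:
  assumes "usmall G'"
    and der: "\<forall>\<^sub>F t in germ0. \<forall>h\<in>{0..1}. (G t has_real_derivative G' t h) (at h within {0..1})"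
  shows "usmall (\<lambda>t h. G t h - G t 0)"
  unfolding usmall_def
proof (intro allI impI)
  fix e :: real assume e: "e > 0"
  have "\<forall>\<^sub>F t in germ0. 0 \<le> t \<and> t < 1" by (rule eventually_germ0_lt) simp
  with usmallD[OF assms(1) e] der
  show "\<forall>\<^sub>F t in germ0. \<forall>h\<in>{0..1}. \<bar>G t h - G t 0\<bar> \<le> e * t"
  proof eventually_elim
    case (elim t)
    show ?case
    proof
      fix h :: real assume h: "h \<in> {0..1}"
      have "norm (G t h - G t 0) \<le> e * t * norm (h - 0)"
        by (rule field_differentiable_bound[of "{0..1}" _ "G' t"]) (use elim h in auto)
      also have "\<dots> \<le> e * t" using elim h e by (simp add: mult_left_le)
      finally show "\<bar>G t h - G t 0\<bar> \<le> e * t" by simp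
    qed
  qed
qed

section \<open>Orders of magnitude and standard parts\<close>

definition uorder :: "real \<Rightarrow> (real \<Rightarrow> real \<Rightarrow> real) \<Rightarrow> bool" where
  "uorder a R \<longleftrightarrow> (\<exists>C. \<forall>\<^sub>F t in germ0. \<forall>h\<in>{0..1}. \<bar>R t h\<bar> \<le> C * t powr a)"

lemma uorder_mono:
  assumes "uorder a R" "b \<le> a" shows "uorder b R"
proof -
  from assms obtain C where C: "\<forall>\<^sub>F t in germ0. \<forall>h\<in>{0..1}. \<bar>R t h\<bar> \<le> C * t powr a" by (auto simp: uorder_def)
  have "\<forall>\<^sub>F t in germ0. 0 \<le> t \<and> t < 1" by (rule eventually_germ0_lt) simp
  with C have "\<forall>\<^sub>F t in germ0. \<forall>h\<in>{0..1}. \<bar>R t h\<bar> \<le> \<bar>C\<bar> * t powr b"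
  proof eventually_elim
    case (elim t)
    have "C * t powr a \<le> \<bar>C\<bar> * t powr b"
      using elim assms(2) by (intro mult_mono powr_mono') auto
    then show ?case using elim(1) by (meson order_trans)
  qed
  then show ?thesis by (auto simp: uorder_def)
qed

lemma uorder_add:
  assumes "uorder a R" "uorder a S" shows "uorder a (\<lambda>t h. R t h + S t h)"
proof -
  from assms obtain C D where C: "\<forall>\<^sub>F t in germ0. \<forall>h\<in>{0..1}. \<bar>R t h\<bar> \<le> C * t powr a"
     and D: "\<forall>\<^sub>F t in germ0. \<forall>h\<in>{0..1}. \<bar>S t h\<bar> \<le> D * t powr a" by (auto simp: uorder_def)
  from C D have "\<forall>\<^sub>F t in germ0. \<forall>h\<in>{0..1}. \<bar>R t h + S t h\<bar> \<le> (C + D) * t powr a"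
    by eventually_elim (simp add: distrib_right, meson abs_triangle_ineq[THEN order_trans] add_mono)
  then show ?thesis by (auto simp: uorder_def)
qed

lemma usmall_uorder: "usmall R \<Longrightarrow> uorder 1 R"
proof -
  assume "usmall R"
  then have "\<forall>\<^sub>F t in germ0. \<forall>h\<in>{0..1}. \<bar>R t h\<bar> \<le> 1 * t" by (rule usmallD) simp
  moreover have "\<forall>\<^sub>F t in germ0. 0 \<le> t \<and> t < (1::real)" by (rule eventually_germ0_lt) simp
  ultimately have "\<forall>\<^sub>F t in germ0. \<forall>h\<in>{0..1}. \<bar>R t h\<bar> \<le> 1 * t powr 1" by eventually_elim auto
  then show ?thesis unfolding uorder_def by blast
qed

lemma usmall_at_0: "usmall R \<Longrightarrow> h \<in> {0..1} \<Longrightarrow> R 0 h = 0"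
  using eventually_germ0_at_0[OF usmallD[of R 1]] by auto

text \<open>Subtracting the value at t = 0 removes exactly the terms with exponent 0. The order is
  the least remaining exponent, capped by 1 so that it also exists when no term remains.\<close>

lemma psum_uorder:
  "admissible cs \<Longrightarrow> \<exists>a>0. uorder a (\<lambda>t h. psum cs t h - psum cs 0 h)"
proof (induction cs)
  case Nil
  then show ?case by (intro exI[of _ 1]) (auto simp: usmall_uorder)
next
  case (Cons cb cs)
  obtain c b where cb: "cb = (c, b)" by force
  from Cons cb obtain a where a: "a > 0" "uorder a (\<lambda>t h. psum cs t h - psum cs 0 h)" by auto
  have "\<exists>b'>0. uorder b' (\<lambda>t h. c h * (tpow t b - tpow 0 b))"
  proof (cases "b = 0")
    case True
    then show ?thesis by (intro exI[of _ 1]) (auto simp: tpow_def usmall_uorder)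
  next
    case False
    have "ubounded (\<lambda>t h. c h)" using Cons.prems cb by (auto intro: ubounded_const)
    then obtain C where "\<forall>\<^sub>F t in germ0. \<forall>h\<in>{0..1}. \<bar>c h\<bar> \<le> C" by (auto simp: ubounded_def)
    then have "\<forall>\<^sub>F t in germ0. \<forall>h\<in>{0..1}. \<bar>c h * (tpow t b - tpow 0 b)\<bar> \<le> C * t powr b"
      by eventually_elim (use False in \<open>auto simp: tpow_def abs_mult intro!: mult_right_mono\<close>)
    then have "uorder b (\<lambda>t h. c h * (tpow t b - tpow 0 b))" unfolding uorder_def by blast
    then show ?thesis using False Cons.prems cb by (intro exI[of _ b]) auto
  qed
  then obtain b' where b': "b' > 0" "uorder b' (\<lambda>t h. c h * (tpow t b - tpow 0 b))" by blast
  have "uorder (min a b') (\<lambda>t h. c h * (tpow t b - tpow 0 b) + (psum cs t h - psum cs 0 h))"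
    by (intro uorder_add uorder_mono[OF a(2)] uorder_mono[OF b'(2)]) auto
  then show ?case using a b' cb by (intro exI[of _ "min a b'"]) (simp add: algebra_simps)
qed

text \<open>The o(t) error vanishes at t = 0, so \<open>G 0\<close> is the sum of the coefficients
  with exponent 0. The infinitesimal rest has some positive order, which later decides how far a
  Taylor expansion must go.\<close>

lemma expandable_standard_part:
  assumes "expandable G"
  shows "continuous_on {0..1} (G 0)" and "\<exists>a>0. uorder a (\<lambda>t h. G t h - G 0 h)"
proof -
  obtain cs where cs: "admissible cs" "usmall (\<lambda>t h. G t h - psum cs t h)" 
    using assms by (auto simp: expandable_def)
  have G0: "G 0 h = psum cs 0 h" if "h \<in> {0..1}" for h
    using usmall_at_0[OF cs(2) that] by simp
  have "continuous_on {0..1} (psum cs 0)" 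
    using cs(1) by (induction cs) (auto simp: psum_def[abs_def] intro!: continuous_intros)
  then show "continuous_on {0..1} (G 0)" by (rule continuous_on_eq) (simp add: G0)
  obtain a where a: "a > 0" "uorder a (\<lambda>t h. psum cs t h - psum cs 0 h)" using psum_uorder[OF cs(1)] by blast
  have "uorder (min a 1) (\<lambda>t h. (G t h - psum cs t h) + (psum cs t h - psum cs 0 h))"
    by (intro uorder_add uorder_mono[OF a(2)] uorder_mono[OF usmall_uorder[OF cs(2)]]) auto
  then have "uorder (min a 1) (\<lambda>t h. G t h - G 0 h)"
    unfolding uorder_def by (elim ex_forward eventually_mono) (auto simp: G0)
  then show "\<exists>a>0. uorder a (\<lambda>t h. G t h - G 0 h)" using a by (intro exI[of _ "min a 1"]) auto
qed

lemma usmall_of_order: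
  assumes "\<forall>\<^sub>F t in germ0. \<forall>h\<in>{0..1}. \<bar>R t h\<bar> \<le> C * t powr a" "1 < a"
  shows "usmall R"
  unfolding usmall_def
proof (intro allI impI)
  fix e :: real assume e: "e > 0"
  have "usmall (\<lambda>t h. C * t powr a)" by (rule usmall_cmult) (rule usmall_powr[OF assms(2)])
  from assms(1) usmallD[OF this e] show "\<forall>\<^sub>F t in germ0. \<forall>h\<in>{0..1}. \<bar>R t h\<bar> \<le> e * t"
    by eventually_elim fastforce
qed

text \<open>Lebesgue number argument: finitely many of the local radii cover [a,b], and by
  monotonicity their minimum works everywhere.\<close>

lemma local_imp_uniform:
  fixes Q :: "real \<Rightarrow> real \<Rightarrow> bool"
  assumes loc: "\<And>s0. s0 \<in> {a..b} \<Longrightarrow> \<exists>\<rho>>0. \<forall>s\<in>{a..b}. \<bar>s - s0\<bar> < \<rho> \<longrightarrow> Q s \<rho>"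
    and mono: "\<And>s \<rho> \<rho>'. Q s \<rho> \<Longrightarrow> 0 < \<rho>' \<Longrightarrow> \<rho>' \<le> \<rho> \<Longrightarrow> Q s \<rho>'"
  shows "\<exists>\<rho>>0. \<forall>s\<in>{a..b}. Q s \<rho>"
proof -
  obtain r where r: "\<And>s0. s0 \<in> {a..b} \<Longrightarrow> r s0 > 0" 
    "\<And>s0 s. s0 \<in> {a..b} \<Longrightarrow> s \<in> {a..b} \<Longrightarrow> \<bar>s - s0\<bar> < r s0 \<Longrightarrow> Q s (r s0)"
    using loc by metis
  obtain D where D: "D \<subseteq> {a..b}" "finite D" "{a..b} \<subseteq> (\<Union>c\<in>D. ball c (r c))"
    by (rule compactE_image[of "{a..b}" "{a..b}" "\<lambda>c. ball c (r c)"]) (use r in \<open>auto intro: centre_in_ball[THEN iffD2]\<close>)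
  \<comment> \<open>The inserted 1 keeps the minimum meaningful when [a,b], and with it
    \<open>D\<close>, is empty.\<close>
  define \<rho> where "\<rho> = Min (insert 1 (r ` D))"
  have "\<rho> > 0" using D r by (auto simp: \<rho>_def)
  moreover have "Q s \<rho>" if s: "s \<in> {a..b}" for s
  proof -
    obtain c where c: "c \<in> D" "s \<in> ball c (r c)" using D s by blast
    then have "Q s (r c)" using D s by (intro r(2)) (auto simp: dist_real_def abs_minus_commute)
    moreover have "\<rho> \<le> r c" using D c by (auto simp: \<rho>_def intro: Min_le)
    ultimately show ?thesis using mono \<open>\<rho> > 0\<close> by blast
  qed
  ultimately show ?thesis by blast
qed

section \<open>Smooth functions of expandable families\<close>

lemma dnorm_nhds:
  "(\<exists>e>0. \<forall>y\<in>S. dnorm d (\<lambda>i. y i - x i) < e \<longrightarrow> P y) \<longleftrightarrow>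
   (\<exists>\<rho>>0. \<forall>y\<in>S. (\<forall>i<d. \<bar>y i - x i\<bar> < \<rho>) \<longrightarrow> P y)"
proof safe
  fix e :: real assume e: "e > 0" "\<forall>y\<in>S. dnorm d (\<lambda>i. y i - x i) < e \<longrightarrow> P y"
  show "\<exists>\<rho>>0. \<forall>y\<in>S. (\<forall>i<d. \<bar>y i - x i\<bar> < \<rho>) \<longrightarrow> P y"
  \<comment> \<open>The Euclidean norm is at most the sum of d coordinates below e / (d + 1); the
    added 1 gives a strict bound and covers d = 0.\<close>
  proof (intro exI[of _ "e / (d + 1)"] conjI ballI impI)
    fix y assume y: "y \<in> S" "\<forall>i<d. \<bar>y i - x i\<bar> < e / real (d + 1)"
    have "dnorm d (\<lambda>i. y i - x i) \<le> (\<Sum>i<d. \<bar>y i - x i\<bar>)"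
      using L2_set_le_sum_abs[of "\<lambda>i. y i - x i" "{..<d}"] by (simp add: dnorm_def L2_set_def)
    also have "\<dots> \<le> (\<Sum>i<d. e / (d + 1))" by (rule sum_mono) (use y in \<open>auto intro: less_imp_le\<close>)
    also have "\<dots> < e" using e by (simp add: field_simps)
    finally show "P y" using e y by blast
  qed (use e in auto)
next
  fix e :: real assume e: "e > 0" "\<forall>y\<in>S. (\<forall>i<d. \<bar>y i - x i\<bar> < e) \<longrightarrow> P y"
  show "\<exists>\<rho>>0. \<forall>y\<in>S. dnorm d (\<lambda>i. y i - x i) < \<rho> \<longrightarrow> P y"
  proof (intro exI[of _ e] conjI ballI impI)
    fix y assume y: "y \<in> S" "dnorm d (\<lambda>i. y i - x i) < e"
    have "\<bar>y i - x i\<bar> < e" if "i < d" for i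
      using member_le_L2_set[of "{..<d}" i "\<lambda>i. \<bar>y i - x i\<bar>"] that y by (simp add: dnorm_def L2_set_def)
    then show "P y" using e y by blast
  qed (use e in auto)
qed

lemma open_dim_box:
  "open_dim d U \<longleftrightarrow> U \<subseteq> embv d \<and>
     (\<forall>x\<in>U. \<exists>\<rho>>0. \<forall>y\<in>embv d. (\<forall>i<d. \<bar>y i - x i\<bar> < \<rho>) \<longrightarrow> y \<in> U)"
  unfolding open_dim_def dnorm_nhds ..

lemma cont_dim_box:
  "cont_dim d U g \<longleftrightarrow> (\<forall>x\<in>U. \<forall>e>0. \<exists>\<rho>>0. \<forall>y\<in>U. (\<forall>i<d. \<bar>y i - x i\<bar> < \<rho>) \<longrightarrow> \<bar>g y - g x\<bar> < e)"
  unfolding cont_dim_def dnorm_nhds ..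

lemma cont_dim_cong: "(\<And>x. x \<in> U \<Longrightarrow> f x = g x) \<Longrightarrow> cont_dim d U f \<longleftrightarrow> cont_dim d U g"
  unfolding cont_dim_def by simp

lemma continuous_on_cont_dim:
  assumes g: "cont_dim d U g" and w: "\<And>i. i < d \<Longrightarrow> continuous_on T (\<lambda>z. w z i)"
    and U: "\<And>z. z \<in> T \<Longrightarrow> w z \<in> U"
  shows "continuous_on T (\<lambda>z. g (w z))"
  unfolding continuous_on_def
proof (intro ballI tendstoI)
  fix z0 e assume z0: "z0 \<in> T" and e: "(e::real) > 0"
  obtain \<rho> where \<rho>: "\<rho> > 0" "\<forall>y\<in>U. (\<forall>i<d. \<bar>y i - w z0 i\<bar> < \<rho>) \<longrightarrow> \<bar>g y - g (w z0)\<bar> < e"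
    using g U[OF z0] e unfolding cont_dim_box by blast
  have "\<forall>i\<in>{..<d}. \<forall>\<^sub>F z in at z0 within T. dist (w z i) (w z0 i) < \<rho>"
    using w z0 \<rho>(1) unfolding continuous_on_def by (auto intro: tendstoD)
  then have "\<forall>\<^sub>F z in at z0 within T. \<forall>i\<in>{..<d}. dist (w z i) (w z0 i) < \<rho>"
    by (rule eventually_ball_finite[rotated]) simp
  moreover have "\<forall>\<^sub>F z in at z0 within T. z \<in> T" by (simp add: eventually_at_filter)
  ultimately show "\<forall>\<^sub>F z in at z0 within T. dist (g (w z)) (g (w z0)) < e"
    by eventually_elim (use \<rho> U in \<open>auto simp: dist_real_def\<close>)
qed

lemma fpds_append: "fpds (is @ js) g = fpds is (fpds js g)"
  by (induction "is") auto

lemma smooth_dim_open: "smooth_dim d U g \<Longrightarrow> open_dim d U"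
  and smooth_dim_cont: "smooth_dim d U g \<Longrightarrow> cont_dim d U g"
  unfolding smooth_dim_def by (auto dest: spec[of _ "[]"])

lemma smooth_dim_embv: "smooth_dim d U g \<Longrightarrow> x \<in> U \<Longrightarrow> x \<in> embv d"
  unfolding smooth_dim_def open_dim_def by blast

lemma smooth_dim_fpd:
  assumes "smooth_dim d U g" "i < d" shows "smooth_dim d U (fpd i g)"
  unfolding smooth_dim_def
proof (intro conjI allI impI ballI)
  show "open_dim d U" using assms(1) by (rule smooth_dim_open)
  fix "is" assume "set is \<subseteq> {..<d}"
  then have *: "set (is @ [i]) \<subseteq> {..<d}" using assms by auto
  have "fpds is (fpd i g) = fpds (is @ [i]) g" by (simp add: fpds_append)
  then show "cont_dim d U (fpds is (fpd i g))" 
    using assms(1) * unfolding smooth_dim_def by metis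
  fix j x assume "j < d" "x \<in> U"
  then show "(\<lambda>s. fpds is (fpd i g) (x(j := s))) differentiable (at (x j))"
    using assms(1) * \<open>fpds is (fpd i g) = fpds (is @ [i]) g\<close> unfolding smooth_dim_def by metis
qed

lemma smooth_dim_DERIV:
  assumes "smooth_dim d U g" "i < d" "x(i := s) \<in> U"
  shows "((\<lambda>s. g (x(i := s))) has_real_derivative fpd i g (x(i := s))) (at s)"
proof -
  have "(\<lambda>r. g ((x(i := s))(i := r))) differentiable (at ((x(i := s)) i))"
    using assms unfolding smooth_dim_def by (force dest: spec[of _ "[]"])
  then show ?thesis by (auto simp: fpd_def DERIV_deriv_iff_real_differentiable)
qed

text \<open>Continuous partial derivatives give total differentiability: change the coordinates one
  at a time and apply the mean value theorem on each edge.\<close>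

lemma smooth_dim_total_derivative:
  assumes g: "smooth_dim d U g" and x: "x \<in> U" and e: "\<epsilon> > 0"
  shows "\<exists>\<rho>>0. \<forall>v\<in>embv d. (\<forall>i<d. \<bar>v i\<bar> < \<rho>) \<longrightarrow> 
     \<bar>g (\<lambda>i. x i + v i) - g x - (\<Sum>i<d. v i * fpd i g x)\<bar> \<le> \<epsilon> * (\<Sum>i<d. \<bar>v i\<bar>)"
proof -
  obtain \<rho>0 where \<rho>0: "\<rho>0 > 0" "\<forall>y\<in>embv d. (\<forall>i<d. \<bar>y i - x i\<bar> < \<rho>0) \<longrightarrow> y \<in> U"
    using smooth_dim_open[OF g] x unfolding open_dim_box by blast
  have "\<forall>i\<in>{..<d}. \<exists>\<rho>>0. \<forall>y\<in>U. (\<forall>j<d. \<bar>y j - x j\<bar> < \<rho>) \<longrightarrow> \<bar>fpd i g y - fpd i g x\<bar> < \<epsilon>"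
    using smooth_dim_cont[OF smooth_dim_fpd[OF g]] x e unfolding cont_dim_box by blast
  then obtain r where r: "\<And>i. i < d \<Longrightarrow> r i > 0" 
     "\<And>i y. i < d \<Longrightarrow> y \<in> U \<Longrightarrow> (\<forall>j<d. \<bar>y j - x j\<bar> < r i) \<Longrightarrow> \<bar>fpd i g y - fpd i g x\<bar> < \<epsilon>"
    unfolding bchoice_iff by auto
  define \<rho> where "\<rho> = Min (insert \<rho>0 (r ` {..<d}))"
  have \<rho>: "\<rho> > 0" "\<rho> \<le> \<rho>0" "\<And>i. i < d \<Longrightarrow> \<rho> \<le> r i" using \<rho>0 r by (auto simp: \<rho>_def)
  have xe: "x \<in> embv d" using smooth_dim_embv[OF g x] .
  show ?thesis
  proof (intro exI[of _ \<rho>] conjI ballI impI \<rho>(1))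
    fix v assume v: "v \<in> embv d" "\<forall>i<d. \<bar>v i\<bar> < \<rho>"
    \<comment> \<open>Corners of an edge path from x to x + v: the first k coordinates have already
      been moved.\<close>
    define y where "y k = (\<lambda>i. x i + (if i < k then v i else 0))" for k
    have "\<bar>g (y k) - g x - (\<Sum>i<k. v i * fpd i g x)\<bar> \<le> \<epsilon> * (\<Sum>i<k. \<bar>v i\<bar>)" if "k \<le> d" for k
      using that
    proof (induction k)
      case 0
      then show ?case by (simp add: y_def)
    next
      case (Suc k)
      then have k: "k < d" by simp
      let ?S = "closed_segment (x k) (x k + v k)"
      have seg: "\<bar>s - x k\<bar> < \<rho>" if "s \<in> ?S" for s
        using that v k unfolding closed_segment_eq_real_ivl by (auto split: if_splits)
      have inb: "\<bar>((y k)(k := s)) j - x j\<bar> < \<rho>" if "s \<in> ?S" "j < d" for s j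
        using seg[OF that(1)] v that \<rho> by (auto simp: y_def)
      have inU: "(y k)(k := s) \<in> U" if "s \<in> ?S" for s
      proof -
        have "(y k)(k := s) \<in> embv d" using xe v k by (auto simp: embv_def y_def)
        then show ?thesis
          by (rule \<rho>0(2)[rule_format]) (rule less_le_trans[OF inb[OF that] \<rho>(2)])
      qed
      \<comment> \<open>Along the k-th edge the linear part at x is subtracted, so the derivative of
        \<open>F\<close> is the deviation of a partial derivative from its value at x, which is
        below \<epsilon>.\<close>
      define F where "F = (\<lambda>s. g ((y k)(k := s)) - s * fpd k g x)"
      have "norm (F (x k + v k) - F (x k)) \<le> \<epsilon> * norm (x k + v k - x k)"
      proof (rule field_differentiable_bound[of ?S])
        fix s assume s: "s \<in> ?S"
        show "(F has_real_derivative fpd k g ((y k)(k := s)) - fpd k g x) (at s within ?S)"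
          unfolding F_def
          by (rule DERIV_diff[OF has_field_derivative_at_within[OF smooth_dim_DERIV[OF g k inU[OF s]]]])
            (auto intro!: derivative_eq_intros)
        show "norm (fpd k g ((y k)(k := s)) - fpd k g x) \<le> \<epsilon>"
        proof -
          have "\<forall>j<d. \<bar>((y k)(k := s)) j - x j\<bar> < r k"
            by (intro allI impI) (rule less_le_trans[OF inb[OF s] \<rho>(3)[OF k]])
          from r(2)[OF k inU[OF s] this] show ?thesis unfolding real_norm_def by (rule less_imp_le)
        qed
      qed auto
      moreover have "(y k)(k := x k + v k) = y (Suc k)" "(y k)(k := x k) = y k" by (auto simp: y_def)
      ultimately have "\<bar>g (y (Suc k)) - g (y k) - v k * fpd k g x\<bar> \<le> \<epsilon> * \<bar>v k\<bar>"
        by (simp add: F_def algebra_simps)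
      then show ?case using Suc by (simp add: algebra_simps)
    qed
    from this[of d] have "\<bar>g (y d) - g x - (\<Sum>i<d. v i * fpd i g x)\<bar> \<le> \<epsilon> * (\<Sum>i<d. \<bar>v i\<bar>)" by simp
    moreover have "y d = (\<lambda>i. x i + v i)" using v by (auto simp: y_def embv_def)
    ultimately show "\<bar>g (\<lambda>i. x i + v i) - g x - (\<Sum>i<d. v i * fpd i g x)\<bar> \<le> \<epsilon> * (\<Sum>i<d. \<bar>v i\<bar>)" by simp
  qed
qed

lemma smooth_dim_DERIV_line:
  assumes g: "smooth_dim d U g" and v: "v \<in> embv d" and s: "(\<lambda>i. x i + s * v i) \<in> U"
  shows "((\<lambda>s. g (\<lambda>i. x i + s * v i)) has_real_derivative (\<Sum>i<d. v i * fpd i g (\<lambda>i. x i + s * v i))) (at s)"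
  unfolding has_field_derivative_def has_derivative_at_alt
proof (intro conjI allI impI)
  fix e :: real assume e: "e > 0"
  \<comment> \<open>\<open>V\<close> is positive and bounds both the single |v i| and their sum; the
    first use gives the radius \<rho> / V, the second the error e / V.\<close>
  define V where "V = (\<Sum>i<d. \<bar>v i\<bar>) + 1"
  have V: "V > 0" "(\<Sum>i<d. \<bar>v i\<bar>) \<le> V" by (auto simp: V_def intro: add_nonneg_pos sum_nonneg)
  have vV: "\<bar>v i\<bar> \<le> V" if "i < d" for i
    using member_le_sum[of i "{..<d}" "\<lambda>i. \<bar>v i\<bar>"] that by (simp add: V_def)
  have "e / V > 0" using e V by simp
  from smooth_dim_total_derivative[OF g s this] obtain \<rho> where \<rho>: "\<rho> > 0" 
    and D: "\<And>u. u \<in> embv d \<Longrightarrow> (\<forall>i<d. \<bar>u i\<bar> < \<rho>) \<Longrightarrow> 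
     \<bar>g (\<lambda>i. x i + s * v i + u i) - g (\<lambda>i. x i + s * v i) - (\<Sum>i<d. u i * fpd i g (\<lambda>i. x i + s * v i))\<bar> \<le> e / V * (\<Sum>i<d. \<bar>u i\<bar>)"
    by blast
  show "\<exists>da>0. \<forall>y. norm (y - s) < da \<longrightarrow> norm (g (\<lambda>i. x i + y * v i) - g (\<lambda>i. x i + s * v i)
        - (\<Sum>i<d. v i * fpd i g (\<lambda>i. x i + s * v i)) * (y - s)) \<le> e * norm (y - s)"
  proof (intro exI[of _ "\<rho> / V"] conjI allI impI)
    fix y assume y: "norm (y - s) < \<rho> / V"
    have "\<bar>(y - s) * v i\<bar> < \<rho>" if "i < d" for i
    proof -
      have "\<bar>(y - s) * v i\<bar> \<le> \<bar>y - s\<bar> * V" using vV[OF that] by (simp add: abs_mult mult_left_mono)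
      also have "\<dots> < \<rho>" using y V by (simp add: field_simps)
      finally show ?thesis .
    qed
    then have "\<bar>g (\<lambda>i. x i + s * v i + (y - s) * v i) - g (\<lambda>i. x i + s * v i) - (\<Sum>i<d. (y - s) * v i * fpd i g (\<lambda>i. x i + s * v i))\<bar> \<le> e / V * (\<Sum>i<d. \<bar>(y - s) * v i\<bar>)"
      using v by (intro D) (auto simp: embv_def)
    also have "\<dots> = e * \<bar>y - s\<bar> * ((\<Sum>i<d. \<bar>v i\<bar>) / V)" by (simp add: abs_mult sum_distrib_left[symmetric])
    also have "\<dots> \<le> e * \<bar>y - s\<bar>" using V e by (intro mult_left_le) auto
    finally show "norm (g (\<lambda>i. x i + y * v i) - g (\<lambda>i. x i + s * v i)
        - (\<Sum>i<d. v i * fpd i g (\<lambda>i. x i + s * v i)) * (y - s)) \<le> e * norm (y - s)"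
      by (simp add: algebra_simps sum_distrib_left)
  qed (use \<rho> V in auto)
qed (rule bounded_linear_mult_right)

section \<open>Tubes around compact curves, and Taylor expansion along expandable vectors\<close>

definition tovec :: "nat \<Rightarrow> (nat \<Rightarrow> real) \<Rightarrow> nat \<Rightarrow> real" where
  "tovec d w = (\<lambda>i. if i < d then w i else 0)"

lemma tovec_embv [simp]: "tovec d w \<in> embv d" by (simp add: tovec_def embv_def)

lemma tovec_nth [simp]: "i < d \<Longrightarrow> tovec d w i = w i" by (simp add: tovec_def)

text \<open>Radius and bound are tied together as \<rho> and 1 / \<rho>: shrinking \<rho> weakens
  both claims at once, which is the monotonicity that \<open>local_imp_uniform\<close> asks
  for.\<close>

lemma uniform_tube:
  assumes U: "open_dim d U" and g: "cont_dim d U g" 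
    and w: "\<And>i. i < d \<Longrightarrow> continuous_on {0..1} (\<lambda>h. w h i)"
    and wU: "\<And>h. h \<in> {0..1} \<Longrightarrow> w h \<in> U"
  shows "\<exists>\<rho>>0. \<forall>h\<in>{0..1::real}. \<forall>y\<in>embv d. (\<forall>i<d. \<bar>y i - w h i\<bar> < \<rho>) \<longrightarrow> y \<in> U \<and> \<bar>g y\<bar> \<le> 1 / \<rho>"
proof (rule local_imp_uniform)
  fix h0 :: real assume h0: "h0 \<in> {0..1}"
  obtain \<rho>0 where \<rho>0: "\<rho>0 > 0" "\<forall>y\<in>embv d. (\<forall>i<d. \<bar>y i - w h0 i\<bar> < \<rho>0) \<longrightarrow> y \<in> U"
    using U wU[OF h0] unfolding open_dim_box by blast
  obtain \<rho>1 where \<rho>1: "\<rho>1 > 0" "\<forall>y\<in>U. (\<forall>i<d. \<bar>y i - w h0 i\<bar> < \<rho>1) \<longrightarrow> \<bar>g y - g (w h0)\<bar> < 1"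
    using g wU[OF h0] unfolding cont_dim_box by (meson zero_less_one)
  \<comment> \<open>Half of the radius is spent on moving from w h0 to w h, half on moving from w h
    to y.\<close>
  define r where "r = min \<rho>0 \<rho>1 / 2"
  have r: "r > 0" using \<rho>0 \<rho>1 by (simp add: r_def)
  have "\<forall>i\<in>{..<d}. \<forall>\<^sub>F h in at h0 within {0..1}. dist (w h i) (w h0 i) < r"
    using w h0 r unfolding continuous_on_def by (auto intro: tendstoD)
  then have "\<forall>\<^sub>F h in at h0 within {0..1}. \<forall>i\<in>{..<d}. dist (w h i) (w h0 i) < r"
    by (rule eventually_ball_finite[rotated]) simp
  then obtain \<eta> where \<eta>: "\<eta> > 0" "\<forall>h\<in>{0..1}. h \<noteq> h0 \<and> dist h h0 < \<eta> \<longrightarrow> (\<forall>i<d. \<bar>w h i - w h0 i\<bar> < r)"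
    unfolding eventually_at by (auto simp: dist_real_def)
  have near: "\<bar>w h i - w h0 i\<bar> < r" if "h \<in> {0..1}" "\<bar>h - h0\<bar> < \<eta>" "i < d" for h i
    using \<eta>(2) that r by (cases "h = h0") (auto simp: dist_real_def)
  define \<rho> where "\<rho> = Min {r, \<eta>, 1 / (\<bar>g (w h0)\<bar> + 1)}"
  have \<rho>: "\<rho> > 0" "\<rho> \<le> r" "\<rho> \<le> \<eta>" "\<rho> \<le> 1 / (\<bar>g (w h0)\<bar> + 1)"
    using r \<eta> by (auto simp: \<rho>_def)
  have b: "\<bar>g (w h0)\<bar> + 1 \<le> 1 / \<rho>"
    using \<rho>(1,4) by (simp add: field_simps)
  show "\<exists>\<rho>>0. \<forall>h\<in>{0..1}. \<bar>h - h0\<bar> < \<rho> \<longrightarrow>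
            (\<forall>y\<in>embv d. (\<forall>i<d. \<bar>y i - w h i\<bar> < \<rho>) \<longrightarrow> y \<in> U \<and> \<bar>g y\<bar> \<le> 1 / \<rho>)"
  proof (intro exI[of _ \<rho>] conjI ballI impI \<rho>(1))
    fix h y assume *: "h \<in> {0..1}" "\<bar>h - h0\<bar> < \<rho>" "y \<in> embv d" "\<forall>i<d. \<bar>y i - w h i\<bar> < \<rho>"
    have c: "\<bar>y i - w h0 i\<bar> < min \<rho>0 \<rho>1" if "i < d" for i
      using near[of h i] *(4)[rule_format, OF that] * \<rho> that unfolding r_def by linarith
    then show "y \<in> U" using \<rho>0 * by auto
    then have "\<bar>g y - g (w h0)\<bar> < 1" using \<rho>1 c by auto
    with b show "\<bar>g y\<bar> \<le> 1 / \<rho>" by linarith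
  qed
next
  fix s \<rho> \<rho>' :: real assume *: "\<forall>y\<in>embv d. (\<forall>i<d. \<bar>y i - w s i\<bar> < \<rho>) \<longrightarrow> y \<in> U \<and> \<bar>g y\<bar> \<le> 1 / \<rho>"
    and \<rho>: "0 < \<rho>'" "\<rho>' \<le> \<rho>"
  have "1 / \<rho> \<le> 1 / \<rho>'" using \<rho> by (intro divide_left_mono) auto
  then show "\<forall>y\<in>embv d. (\<forall>i<d. \<bar>y i - w s i\<bar> < \<rho>') \<longrightarrow> y \<in> U \<and> \<bar>g y\<bar> \<le> 1 / \<rho>'"
    using * \<rho> by (meson less_le_trans order_trans)
qed

lemma uorder_small:
  assumes "uorder a R" "0 < a" "0 < \<rho>"
  shows "\<forall>\<^sub>F t in germ0. \<forall>h\<in>{0..1}. \<bar>R t h\<bar> < \<rho>"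
proof -
  from assms obtain C where C: "\<forall>\<^sub>F t in germ0. \<forall>h\<in>{0..1}. \<bar>R t h\<bar> \<le> C * t powr a" by (auto simp: uorder_def)
  define K where "K = \<rho> / (\<bar>C\<bar> + 1)"
  have K: "K > 0" using assms by (simp add: K_def)
  then have "K powr (1 / a) > 0" by simp
  from eventually_germ0_lt[OF this] C show ?thesis
  proof eventually_elim
    case (elim t)
    have "t powr a < (K powr (1 / a)) powr a" using elim assms by (intro powr_less_mono2) auto
    also have "\<dots> = K" using K assms by (simp add: powr_powr)
    finally have t: "t powr a < K" .
    have "C * t powr a \<le> (\<bar>C\<bar> + 1) * t powr a" by (intro mult_right_mono) auto
    also have "\<dots> < (\<bar>C\<bar> + 1) * K" using t by (intro mult_strict_left_mono) auto
    also have "\<dots> = \<rho>" by (simp add: K_def)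
    finally show ?case using elim by force
  qed
qed

text \<open>Power rule in the shifted form produced by integrating a Taylor polynomial from
  0.\<close>

lemma DERIV_scaled_power_sum:
  fixes c :: "nat \<Rightarrow> real"
  shows "((\<lambda>s. \<Sum>k<N. s ^ Suc k * (c k / real (Suc k))) has_real_derivative (\<Sum>k<N. s ^ k * c k)) (at s within S)"
proof (rule DERIV_sum)
  fix k 
  have "((\<lambda>s. s ^ Suc k * (c k / real (Suc k))) has_real_derivative (real (Suc k) * s ^ (Suc k - Suc 0) * (c k / real (Suc k)))) (at s within S)"
    by (rule DERIV_cmult_right[OF DERIV_pow[of "Suc k" s S]])
  then show "((\<lambda>s. s ^ Suc k * (c k / real (Suc k))) has_real_derivative s ^ k * c k) (at s within S)"
    by (simp del: of_nat_Suc power_Suc)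
qed

text \<open>Only the standard part is required to lie in U. That the whole vector lies in U for
  small t, uniformly in h, is a consequence of compactness, see \<open>eventually_U\<close>.\<close>

locale expandable_vector =
  fixes d :: nat and U :: "(nat \<Rightarrow> real) set" and w :: "nat \<Rightarrow> real \<Rightarrow> real \<Rightarrow> real"
  assumes w: "\<And>i. i < d \<Longrightarrow> expandable (w i)"
    and wU: "\<And>h. h \<in> {0..1} \<Longrightarrow> tovec d (\<lambda>i. w i 0 h) \<in> U"
begin

text \<open>Standard part and infinitesimal part of the vector; the auxiliary variable s in [0,1]
  leads from \<open>w0 h\<close> to the vector itself.\<close>

definition "w0 h = tovec d (\<lambda>i. w i 0 h)"
definition "dw t h = tovec d (\<lambda>i. w i t h - w i 0 h)"

lemma w0_cont: "i < d \<Longrightarrow> continuous_on {0..1} (\<lambda>h. w0 h i)"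
  using expandable_standard_part(1)[OF w] by (simp add: w0_def cong: continuous_on_cong)

lemma w0_U: "h \<in> {0..1} \<Longrightarrow> w0 h \<in> U" using wU by (simp add: w0_def)

lemma dw_embv [simp]: "dw t h \<in> embv d" by (simp add: dw_def)

lemma line_embv: "(\<lambda>i. w0 h i + s * dw t h i) \<in> embv d"
  by (simp add: w0_def dw_def tovec_def embv_def)

lemma line_1: "(\<lambda>i. w0 h i + 1 * dw t h i) = tovec d (\<lambda>i. w i t h)"
  by (auto simp: w0_def dw_def tovec_def)

lemma dw_expandable: "i < d \<Longrightarrow> expandable (\<lambda>t h. dw t h i)"
  unfolding dw_def using w expandable_standard_part(1)[OF w]
  by (auto intro!: expandable_diff[OF _ expandable_const])

lemma dw_uorder: "\<exists>a>0. \<forall>i<d. uorder a (\<lambda>t h. dw t h i)"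
proof -
  have "\<forall>i\<in>{..<d}. \<exists>a>0. uorder a (\<lambda>t h. dw t h i)"
    using expandable_standard_part(2)[OF w] by (simp add: dw_def)
  then obtain a where a: "\<And>i. i < d \<Longrightarrow> a i > 0" "\<And>i. i < d \<Longrightarrow> uorder (a i) (\<lambda>t h. dw t h i)" 
    unfolding bchoice_iff by auto
  \<comment> \<open>The inserted 1 serves d = 0.\<close>
  define m where "m = Min (insert 1 (a ` {..<d}))"
  have "m > 0" "\<And>i. i < d \<Longrightarrow> m \<le> a i" using a by (auto simp: m_def)
  then show ?thesis using uorder_mono[OF a(2)] by blast
qed

lemma line_bound:
  assumes U: "open_dim d U" and g: "cont_dim d U g"
  shows "\<exists>C. \<forall>\<^sub>F t in germ0. \<forall>h\<in>{0..1}. \<forall>s\<in>{0..1}. 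
    (\<lambda>i. w0 h i + s * dw t h i) \<in> U \<and> \<bar>g (\<lambda>i. w0 h i + s * dw t h i)\<bar> \<le> C"
proof -
  obtain \<rho> where \<rho>: "\<rho> > 0" "\<forall>h\<in>{0..1}. \<forall>y\<in>embv d. (\<forall>i<d. \<bar>y i - w0 h i\<bar> < \<rho>) \<longrightarrow> y \<in> U \<and> \<bar>g y\<bar> \<le> 1 / \<rho>"
    using uniform_tube[OF U g w0_cont w0_U] by auto
  obtain a where a: "a > 0" "\<forall>i<d. uorder a (\<lambda>t h. dw t h i)" using dw_uorder by blast
  have "\<forall>i\<in>{..<d}. \<forall>\<^sub>F t in germ0. \<forall>h\<in>{0..1}. \<bar>dw t h i\<bar> < \<rho>"
    using uorder_small a \<rho> by auto
  then have "\<forall>\<^sub>F t in germ0. \<forall>i\<in>{..<d}. \<forall>h\<in>{0..1}. \<bar>dw t h i\<bar> < \<rho>"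
    by (rule eventually_ball_finite[rotated]) simp
  then have "\<forall>\<^sub>F t in germ0. \<forall>h\<in>{0..1}. \<forall>s\<in>{0..1}. 
    (\<lambda>i. w0 h i + s * dw t h i) \<in> U \<and> \<bar>g (\<lambda>i. w0 h i + s * dw t h i)\<bar> \<le> 1 / \<rho>"
  proof eventually_elim
    case (elim t)
    show ?case
    proof (intro ballI)
      fix h s :: real assume hs: "h \<in> {0..1}" "s \<in> {0..1}"
      have "\<bar>s * dw t h i\<bar> < \<rho>" if "i < d" for i
      proof -
        have "\<bar>s * dw t h i\<bar> \<le> \<bar>dw t h i\<bar>" using hs by (simp add: abs_mult mult_left_le_one_le)
        also have "\<dots> < \<rho>" using elim hs that by auto
        finally show ?thesis .
      qed
      then show "(\<lambda>i. w0 h i + s * dw t h i) \<in> U \<and> \<bar>g (\<lambda>i. w0 h i + s * dw t h i)\<bar> \<le> 1 / \<rho>"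
        using \<rho>(2)[rule_format, OF hs(1) line_embv] by simp
    qed
  qed
  then show ?thesis by blast
qed

lemma eventually_U: "open_dim d U \<Longrightarrow> \<forall>\<^sub>F t in germ0. \<forall>h\<in>{0..1}. tovec d (\<lambda>i. w i t h) \<in> U"
proof -
  assume U: "open_dim d U"
  have "cont_dim d U (\<lambda>_. 0)" by (auto simp: cont_dim_def intro: exI[of _ 1])
  from line_bound[OF U this] obtain C where "\<forall>\<^sub>F t in germ0. \<forall>h\<in>{0..1}. \<forall>s\<in>{0..1}. 
    (\<lambda>i. w0 h i + s * dw t h i) \<in> U \<and> \<bar>0::real\<bar> \<le> C" by blast
  then show ?thesis
  proof eventually_elim
    case (elim t)
    show ?case using elim[rule_format, of _ 1] unfolding line_1 by simp
  qed
qed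

text \<open>Taylor expansion along the segment from \<open>w0 h\<close> to \<open>w0 h + dw t h\<close>, obtained by integrating
  the expansions of the partial derivatives; each step gains one factor of the size of \<open>dw\<close>.\<close>

lemma taylor_expansion:
  assumes g: "smooth_dim d U g" and a: "\<forall>i<d. uorder a (\<lambda>t h. dw t h i)"
  shows "\<exists>e C. (\<forall>k<N. expandable (e k)) \<and> (\<forall>\<^sub>F t in germ0. \<forall>h\<in>{0..1}. \<forall>s\<in>{0..1}.
     \<bar>g (\<lambda>i. w0 h i + s * dw t h i) - (\<Sum>k<N. s ^ k * e k t h)\<bar> \<le> C * (t powr a) ^ N)"
  using g
proof (induction N arbitrary: g)
  case 0
  from line_bound[OF smooth_dim_open[OF 0] smooth_dim_cont[OF 0]] obtain C 
    where "\<forall>\<^sub>F t in germ0. \<forall>h\<in>{0..1}. \<forall>s\<in>{0..1}. (\<lambda>i. w0 h i + s * dw t h i) \<in> U \<and> \<bar>g (\<lambda>i. w0 h i + s * dw t h i)\<bar> \<le> C"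
    by blast
  then have "\<forall>\<^sub>F t in germ0. \<forall>h\<in>{0..1}. \<forall>s\<in>{0..1}. \<bar>g (\<lambda>i. w0 h i + s * dw t h i)\<bar> \<le> C"
    by eventually_elim blast
  then show ?case by auto
next
  case (Suc N)
  have "\<forall>i\<in>{..<d}. \<exists>e C. (\<forall>k<N. expandable (e k)) \<and> (\<forall>\<^sub>F t in germ0. \<forall>h\<in>{0..1}. \<forall>s\<in>{0..1}.
     \<bar>fpd i g (\<lambda>i. w0 h i + s * dw t h i) - (\<Sum>k<N. s ^ k * e k t h)\<bar> \<le> C * (t powr a) ^ N)"
    using Suc.IH[OF smooth_dim_fpd[OF Suc.prems]] by blast
  then obtain e C where e: "\<And>i k. i < d \<Longrightarrow> k < N \<Longrightarrow> expandable (e i k)"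
    and C: "\<forall>i\<in>{..<d}. \<forall>\<^sub>F t in germ0. \<forall>h\<in>{0..1}. \<forall>s\<in>{0..1}.
     \<bar>fpd i g (\<lambda>i. w0 h i + s * dw t h i) - (\<Sum>k<N. s ^ k * e i k t h)\<bar> \<le> C i * (t powr a) ^ N"
    unfolding bchoice_iff by auto
  have "\<forall>i\<in>{..<d}. \<exists>D. \<forall>\<^sub>F t in germ0. \<forall>h\<in>{0..1}. \<bar>dw t h i\<bar> \<le> D * t powr a"
    using a by (simp add: uorder_def)
  then obtain D where D: "\<forall>i\<in>{..<d}. \<forall>\<^sub>F t in germ0. \<forall>h\<in>{0..1}. \<bar>dw t h i\<bar> \<le> D i * t powr a"
    unfolding bchoice_iff by blast
  \<comment> \<open>By the chain rule \<open>c t h k\<close> is the coefficient of s^k in the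
    expansion of the s-derivative of g along the segment; integrating over s moves it to s^(k+1) and
    divides by k + 1.\<close>
  define c where "c t h k = (\<Sum>i<d. dw t h i * e i k t h)" for t h k
  define e' where "e' k t h = (case k of 0 \<Rightarrow> g (w0 h) | Suc k \<Rightarrow> c t h k / real (Suc k))" for k t h
  have "expandable (e' k)" if "k < Suc N" for k
  proof (cases k)
    case 0
    show ?thesis unfolding e'_def[abs_def] 0 nat.case
      by (intro expandable_const continuous_on_cont_dim[OF smooth_dim_cont[OF Suc.prems] w0_cont w0_U])
  next
    case (Suc j)
    have "expandable (\<lambda>t h. inverse (real (Suc j)) * (\<Sum>i<d. dw t h i * e i j t h))"
      using that Suc by (intro expandable_mult expandable_sum expandable_const dw_expandable e continuous_on_const) auto
    then show ?thesis by (simp add: e'_def[abs_def] c_def Suc divide_inverse mult.commute del: of_nat_Suc)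
  qed
  moreover have "\<forall>\<^sub>F t in germ0. \<forall>h\<in>{0..1}. \<forall>s\<in>{0..1}.
     \<bar>g (\<lambda>i. w0 h i + s * dw t h i) - (\<Sum>k<Suc N. s ^ k * e' k t h)\<bar> \<le> (\<Sum>i<d. D i * C i) * (t powr a) ^ Suc N"
  proof -
    obtain B where "\<forall>\<^sub>F t in germ0. \<forall>h\<in>{0..1}. \<forall>s\<in>{0..1}. 
        (\<lambda>i. w0 h i + s * dw t h i) \<in> U \<and> \<bar>g (\<lambda>i. w0 h i + s * dw t h i)\<bar> \<le> B"
      using line_bound[OF smooth_dim_open[OF Suc.prems] smooth_dim_cont[OF Suc.prems]] by blast
    then have "\<forall>\<^sub>F t in germ0. \<forall>h\<in>{0..1}. \<forall>s\<in>{0..1}. (\<lambda>i. w0 h i + s * dw t h i) \<in> U"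
      by eventually_elim blast
    moreover have "\<forall>\<^sub>F t in germ0. \<forall>i\<in>{..<d}. \<forall>h\<in>{0..1}. \<forall>s\<in>{0..1}.
     \<bar>fpd i g (\<lambda>i. w0 h i + s * dw t h i) - (\<Sum>k<N. s ^ k * e i k t h)\<bar> \<le> C i * (t powr a) ^ N"
      by (rule eventually_ball_finite[rotated]) (use C in auto)
    moreover have "\<forall>\<^sub>F t in germ0. \<forall>i\<in>{..<d}. \<forall>h\<in>{0..1}. \<bar>dw t h i\<bar> \<le> D i * t powr a"
      by (rule eventually_ball_finite[rotated]) (use D in auto)
    ultimately show ?thesis
    proof eventually_elim
      case (elim t)
      show ?case
      proof (intro ballI)
        fix h s :: real assume hs: "h \<in> {0..1}" "s \<in> {0..1}"
        define L where "L s = (\<lambda>i. w0 h i + s * dw t h i)" for s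
        \<comment> \<open>The remainder with the constant term still included, so \<open>F 0\<close>
          is g (w0 h). Its derivative \<open>F'\<close> combines the remainders of the partial
          derivatives with the factors \<open>dw\<close>, which give the extra t powr a.\<close>
        define F where "F s = g (L s) - (\<Sum>k<N. s ^ Suc k * (c t h k / real (Suc k)))" for s
        define F' where "F' s = (\<Sum>i<d. dw t h i * (fpd i g (L s) - (\<Sum>k<N. s ^ k * e i k t h)))" for s
        have "(\<Sum>k<N. r ^ k * c t h k) = (\<Sum>i<d. dw t h i * (\<Sum>k<N. r ^ k * e i k t h))" for r
          unfolding c_def sum_distrib_left by (subst sum.swap) (simp add: mult_ac)
        then have F'_eq: "F' r = (\<Sum>i<d. dw t h i * fpd i g (L r)) - (\<Sum>k<N. r ^ k * c t h k)" for r
          by (simp add: F'_def right_diff_distrib sum_subtractf)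
        have "norm (F s - F 0) \<le> (\<Sum>i<d. D i * C i) * (t powr a) ^ Suc N * norm (s - 0)"
        proof (rule field_differentiable_bound[of "{0..1}" F F'])
          fix r :: real assume r: "r \<in> {0..1}"
          then have "L r \<in> U" using elim hs by (simp add: L_def)
          then show "(F has_field_derivative F' r) (at r within {0..1})"
            unfolding F'_eq F_def[abs_def] L_def
            by (intro DERIV_diff DERIV_scaled_power_sum has_field_derivative_at_within[OF smooth_dim_DERIV_line[OF Suc.prems]]) auto
          have "\<bar>F' r\<bar> \<le> (\<Sum>i<d. \<bar>dw t h i\<bar> * \<bar>fpd i g (L r) - (\<Sum>k<N. r ^ k * e i k t h)\<bar>)"
            unfolding F'_def by (rule sum_abs[THEN order_trans]) (simp add: abs_mult)
          also have "\<dots> \<le> (\<Sum>i<d. (D i * t powr a) * (C i * (t powr a) ^ N))"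
          proof (rule sum_mono)
            fix i assume i: "i \<in> {..<d}"
            have "\<bar>dw t h i\<bar> \<le> D i * t powr a" using elim(3) i hs by blast
            moreover have "\<bar>fpd i g (L r) - (\<Sum>k<N. r ^ k * e i k t h)\<bar> \<le> C i * (t powr a) ^ N"
              using elim(2) i hs r unfolding L_def by blast
            ultimately show "\<bar>dw t h i\<bar> * \<bar>fpd i g (L r) - (\<Sum>k<N. r ^ k * e i k t h)\<bar> \<le> (D i * t powr a) * (C i * (t powr a) ^ N)"
              by (rule mult_mono') auto
          qed
          also have "\<dots> = (\<Sum>i<d. D i * C i) * (t powr a) ^ Suc N"
            unfolding sum_distrib_right by (simp add: mult_ac)
          finally show "norm (F' r) \<le> (\<Sum>i<d. D i * C i) * (t powr a) ^ Suc N" by simp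
        qed (use hs in auto)
        also have "\<dots> \<le> (\<Sum>i<d. D i * C i) * (t powr a) ^ Suc N"
        proof (rule mult_left_le)
          \<comment> \<open>\<open>C i\<close> and \<open>D i\<close> may be negative; the products
            are nonnegative because they bound absolute values.\<close>
          have "0 \<le> D i * C i * (t powr a) ^ Suc N" if "i < d" for i
          proof -
            have "0 \<le> D i * t powr a"
              by (rule order_trans[OF abs_ge_zero elim(3)[rule_format, of i h]]) (use that hs in auto)
            moreover have "0 \<le> C i * (t powr a) ^ N"
              by (rule order_trans[OF abs_ge_zero elim(2)[rule_format, of i h s]]) (use that hs in auto)
            ultimately show ?thesis using mult_nonneg_nonneg by (fastforce simp: mult_ac)
          qed
          then show "0 \<le> (\<Sum>i<d. D i * C i) * (t powr a) ^ Suc N" unfolding sum_distrib_right by (intro sum_nonneg) auto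
        qed (use hs in auto)
        finally have "\<bar>F s - F 0\<bar> \<le> (\<Sum>i<d. D i * C i) * (t powr a) ^ Suc N" by simp
        moreover have "F 0 = e' 0 t h" by (simp add: F_def L_def e'_def)
        moreover have "F s = g (L s) - (\<Sum>k<N. s ^ Suc k * e' (Suc k) t h)" by (simp add: F_def e'_def)
        ultimately show "\<bar>g (\<lambda>i. w0 h i + s * dw t h i) - (\<Sum>k<Suc N. s ^ k * e' k t h)\<bar> \<le> (\<Sum>i<d. D i * C i) * (t powr a) ^ Suc N"
          unfolding sum.lessThan_Suc_shift L_def[symmetric] by (simp add: algebra_simps)
      qed
    qed
  qed
  ultimately show ?case by blast
qed

lemma expandable_smooth:
  assumes g: "smooth_dim d U g"
  shows "expandable (\<lambda>t h. g (tovec d (\<lambda>i. w i t h)))"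
proof -
  obtain a where a: "a > 0" "\<forall>i<d. uorder a (\<lambda>t h. dw t h i)" using dw_uorder by blast
  \<comment> \<open>The Taylor remainder has order N * a; beyond 1 it is o(t).\<close>
  obtain N where N: "1 < real N * a" using ex_less_of_nat_mult[OF a(1)] by blast
  then have N0: "N > 0" by (cases N) auto
  obtain e C where e: "\<forall>k<N. expandable (e k)" and C: "\<forall>\<^sub>F t in germ0. \<forall>h\<in>{0..1}. \<forall>s\<in>{0..1}.
     \<bar>g (\<lambda>i. w0 h i + s * dw t h i) - (\<Sum>k<N. s ^ k * e k t h)\<bar> \<le> C * (t powr a) ^ N"
    using taylor_expansion[OF g a(2)] by blast
  show ?thesis
  proof (rule expandable_cong_usmall)
    show "expandable (\<lambda>t h. \<Sum>k<N. e k t h)" using e by (auto intro: expandable_sum)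
    show "usmall (\<lambda>t h. g (tovec d (\<lambda>i. w i t h)) - (\<Sum>k<N. e k t h))"
    proof (rule usmall_of_order[OF _ N])
      show "\<forall>\<^sub>F t in germ0. \<forall>h\<in>{0..1}. \<bar>g (tovec d (\<lambda>i. w i t h)) - (\<Sum>k<N. e k t h)\<bar> \<le> C * t powr (real N * a)"
        using C
      proof eventually_elim
        case (elim t)
        \<comment> \<open>At t = 0 this depends on N > 0, since \<open>0 ^ 0\<close> is 1 whereas
          \<open>0 powr 0\<close> is 0.\<close>
        have "(t powr a) ^ N = t powr (real N * a)"
          using N0 by (cases "t = 0") (auto simp: powr_power mult.commute)
        moreover have "\<bar>g (tovec d (\<lambda>i. w i t h)) - (\<Sum>k<N. e k t h)\<bar> \<le> C * (t powr a) ^ N" if "h \<in> {0..1}" for h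
          using elim[rule_format, OF that, of 1] unfolding line_1 by simp
        ultimately show ?case by simp
      qed
    qed
  qed
qed

end

section \<open>Constructing smooth functions\<close>

lemma open_dim_eventually_line:
  assumes "open_dim d U" "x \<in> U" "i < d"
  shows "\<forall>\<^sub>F s in nhds (x i). x(i := s) \<in> U"
proof -
  obtain \<rho> where \<rho>: "\<rho> > 0" "\<forall>y\<in>embv d. (\<forall>j<d. \<bar>y j - x j\<bar> < \<rho>) \<longrightarrow> y \<in> U"
    using assms unfolding open_dim_box by blast
  have "x \<in> embv d" using assms unfolding open_dim_def by blast
  then have "x(i := s) \<in> embv d" for s using assms(3) by (auto simp: embv_def)
  then have "x(i := s) \<in> U" if "dist s (x i) < \<rho>" for s
    by (rule \<rho>(2)[rule_format]) (use that \<rho>(1) in \<open>auto simp: dist_real_def\<close>)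
  then show ?thesis unfolding eventually_nhds_metric using \<rho>(1) by blast
qed

text \<open>If every member of a class of continuous functions has its partial derivatives in the
  class, all iterated ones stay there. They agree with members only on U, since \<open>fpd\<close>
  says nothing definite about them outside.\<close>

lemma smooth_dim_coinduct:
  assumes U: "open_dim d U" and g: "g \<in> \<C>"
    and cont: "\<And>g. g \<in> \<C> \<Longrightarrow> cont_dim d U g"
    and step: "\<And>g i. g \<in> \<C> \<Longrightarrow> i < d \<Longrightarrow>
      \<exists>g'\<in>\<C>. \<forall>x\<in>U. ((\<lambda>s. g (x(i := s))) has_real_derivative g' x) (at (x i))"
  shows "smooth_dim d U g"
proof -
  \<comment> \<open>U is open, so agreement on U persists on a short coordinate line through x and
    passes to the derivative.\<close>
  have transfer: "((\<lambda>s. f (x(i := s))) has_real_derivative g'' x) (at (x i))"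
    if "\<forall>x\<in>U. f x = g' x" "((\<lambda>s. g' (x(i := s))) has_real_derivative g'' x) (at (x i))" "i < d" "x \<in> U"
    for f g' g'' and i x
  proof -
    have "\<forall>\<^sub>F s in nhds (x i). f (x(i := s)) = g' (x(i := s))"
      using open_dim_eventually_line[OF U that(4,3)] by eventually_elim (use that(1) in blast)
    from DERIV_cong_ev[OF refl this refl] that(2) show ?thesis by blast
  qed
  have *: "\<exists>g'\<in>\<C>. \<forall>x\<in>U. fpds is g x = g' x" if "set is \<subseteq> {..<d}" for "is"
    using that
  proof (induction "is")
    case Nil
    then show ?case using g by auto
  next
    case (Cons i "is")
    then obtain g' where g': "g' \<in> \<C>" "\<forall>x\<in>U. fpds is g x = g' x" by auto
    have i: "i < d" using Cons.prems by simp
    from step[OF g'(1) i] obtain g'' 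
      where g'': "g'' \<in> \<C>" "\<forall>x\<in>U. ((\<lambda>s. g' (x(i := s))) has_real_derivative g'' x) (at (x i))" by blast
    have "fpds (i # is) g x = g'' x" if "x \<in> U" for x
      using DERIV_imp_deriv[OF transfer[where f="fpds is g" and g'="g'" and g''="g''", OF g'(2) g''(2)[rule_format, OF that] i that]] 
      by (simp add: fpd_def)
    then show ?case using g''(1) by blast
  qed
  show ?thesis unfolding smooth_dim_def
  proof (intro conjI allI impI ballI U)
    fix "is" assume "is": "set is \<subseteq> {..<d}"
    from *[OF this] obtain g' where g': "g' \<in> \<C>" "\<forall>x\<in>U. fpds is g x = g' x" by auto
    show "cont_dim d U (fpds is g)" using cont[OF g'(1)] g'(2) cont_dim_cong by metis
    fix i x assume ix: "i < d" "x \<in> U"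
    from step[OF g'(1) ix(1)] obtain g'' 
      where g'': "\<forall>x\<in>U. ((\<lambda>s. g' (x(i := s))) has_real_derivative g'' x) (at (x i))" by blast
    show "(\<lambda>s. fpds is g (x(i := s))) differentiable at (x i)"
      using transfer[where f="fpds is g" and g'="g'" and g''="g''", OF g'(2) g''[rule_format, OF ix(2)] ix]
      by (auto simp: real_differentiable_def)
  qed
qed

lemma smooth_dim_subset:
  assumes "smooth_dim d U g" "open_dim d U'" "U' \<subseteq> U" shows "smooth_dim d U' g"
  using assms unfolding smooth_dim_def cont_dim_def by (meson subsetD)

section \<open>Product domains and integration in the last variable\<close>

lemma mem_prodset:
  assumes "P \<subseteq> embv p" shows "x \<in> prodset p P V \<longleftrightarrow> x(p := 0) \<in> P \<and> x p \<in> V"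
proof
  assume "x \<in> prodset p P V"
  then obtain q v where q: "x = q(p := v)" "q \<in> P" "v \<in> V" by (auto simp: prodset_def)
  then have "q p = 0" using assms by (auto simp: embv_def)
  then show "x(p := 0) \<in> P \<and> x p \<in> V" using q by (simp add: fun_upd_idem)
next
  assume "x(p := 0) \<in> P \<and> x p \<in> V"
  then show "x \<in> prodset p P V" unfolding prodset_def
    by (auto intro!: exI[of _ "x(p := 0)"] exI[of _ "x p"])
qed

lemma open_dim_prodset:
  assumes P: "open_dim p P" and V: "open V" shows "open_dim (Suc p) (prodset p P V)"
proof -
  have Pe: "P \<subseteq> embv p" using P by (simp add: open_dim_def)
  show ?thesis unfolding open_dim_box
  proof (intro conjI ballI)
    show "prodset p P V \<subseteq> embv (Suc p)" using Pe by (auto simp: prodset_def embv_def)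
    fix x assume "x \<in> prodset p P V"
    then have x: "x(p := 0) \<in> P" "x p \<in> V" using mem_prodset[OF Pe] by auto
    obtain \<rho> where \<rho>: "\<rho> > 0" "\<forall>y\<in>embv p. (\<forall>i<p. \<bar>y i - (x(p := 0)) i\<bar> < \<rho>) \<longrightarrow> y \<in> P"
      using P x(1) unfolding open_dim_box by blast
    obtain e where e: "e > 0" "\<forall>y. dist y (x p) < e \<longrightarrow> y \<in> V"
      using V x(2) unfolding open_dist by blast
    show "\<exists>\<rho>>0. \<forall>y\<in>embv (Suc p). (\<forall>i<Suc p. \<bar>y i - x i\<bar> < \<rho>) \<longrightarrow> y \<in> prodset p P V"
    proof (intro exI[of _ "min \<rho> e"] conjI ballI impI)
      fix y assume y: "y \<in> embv (Suc p)" "\<forall>i<Suc p. \<bar>y i - x i\<bar> < min \<rho> e"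
      have "y(p := 0) \<in> embv p" using y(1) by (auto simp: embv_def)
      then have "y(p := 0) \<in> P" by (rule \<rho>(2)[rule_format]) (use y(2) in auto)
      moreover have "y p \<in> V" using e y(2) by (simp add: dist_real_def)
      ultimately show "y \<in> prodset p P V" using mem_prodset[OF Pe] by blast
    qed (use \<rho> e in auto)
  qed
qed

lemma prodset_mono: "V \<subseteq> V' \<Longrightarrow> prodset p P V \<subseteq> prodset p P V'"
  unfolding prodset_def by blast

definition last_integral :: "nat \<Rightarrow> real \<Rightarrow> ((nat \<Rightarrow> real) \<Rightarrow> real) \<Rightarrow> (nat \<Rightarrow> real) \<Rightarrow> real" where
  "last_integral p l g x = integral {l..x p} (\<lambda>s. g (x(p := s)))"

text \<open>The integral may run over nearly all of [l,r], so the closed interval has to lie in V;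
  the primitive is studied over the open interval, where derivatives are two-sided.\<close>

locale integration_box =
  fixes p :: nat and P :: "(nat \<Rightarrow> real) set" and V :: "real set" and l r :: real
  assumes P: "open_dim p P" and V: "open V" and lrV: "{l..r} \<subseteq> V"
begin

abbreviation "U \<equiv> prodset p P V"
abbreviation "U' \<equiv> prodset p P {l<..<r}"

lemma Pe: "P \<subseteq> embv p" using P by (simp add: open_dim_def)

lemma U'_sub: "U' \<subseteq> U" using lrV by (intro prodset_mono) auto

lemma U'_open: "open_dim (Suc p) U'" using open_dim_prodset[OF P] by simp

lemma U'_upd: "x \<in> U' \<Longrightarrow> s \<in> {l..r} \<Longrightarrow> x(p := s) \<in> U"
  using lrV by (auto simp: mem_prodset[OF Pe])

lemma U'_last: "x \<in> U' \<Longrightarrow> x p \<in> {l<..<r}" by (auto simp: mem_prodset[OF Pe])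

lemma continuous_on_last:
  assumes g: "cont_dim (Suc p) U g" and x: "x \<in> U'"
  shows "continuous_on {l..r} (\<lambda>s. g (x(p := s)))"
proof (rule continuous_on_cont_dim[OF g])
  show "continuous_on {l..r} (\<lambda>s. (x(p := s)) i)" for i
    by (cases "i = p") (auto intro: continuous_intros)
qed (rule U'_upd[OF x])

text \<open>Two effects are separated: the change of the integrand, controlled uniformly in s by
  compactness of [l,r], and the change of the upper limit.\<close>

lemma cont_last_integral:
  assumes g: "cont_dim (Suc p) U g"
  shows "cont_dim (Suc p) U' (last_integral p l g)"
  unfolding cont_dim_box
proof (intro ballI allI impI)
  fix x and e :: real assume x: "x \<in> U'" and e: "e > 0"
  \<comment> \<open>Integrated over a length of at most r - l, an integrand error \<open>e1\<close>
    costs e / 2; the other half is left for the upper limit.\<close>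
  define e1 where "e1 = e / (2 * (r - l))"
  have lr: "l < r" using U'_last[OF x] by auto
  have e1: "e1 > 0" using e lr by (simp add: e1_def)
  have "\<exists>\<rho>>0. \<forall>s\<in>{l..r}. \<forall>y\<in>U. (\<forall>i<Suc p. \<bar>y i - (x(p := s)) i\<bar> < \<rho>) \<longrightarrow> \<bar>g y - g (x(p := s))\<bar> < e1"
  proof (rule local_imp_uniform)
    fix s0 assume s0: "s0 \<in> {l..r}"
    have "e1 / 2 > 0" using e1 by simp
    then obtain \<rho>0 where \<rho>0: "\<rho>0 > 0" "\<forall>y\<in>U. (\<forall>i<Suc p. \<bar>y i - (x(p := s0)) i\<bar> < \<rho>0) \<longrightarrow> \<bar>g y - g (x(p := s0))\<bar> < e1 / 2"
      using g U'_upd[OF x s0] unfolding cont_dim_box by blast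
    show "\<exists>\<rho>>0. \<forall>s\<in>{l..r}. \<bar>s - s0\<bar> < \<rho> \<longrightarrow> (\<forall>y\<in>U. (\<forall>i<Suc p. \<bar>y i - (x(p := s)) i\<bar> < \<rho>) \<longrightarrow> \<bar>g y - g (x(p := s))\<bar> < e1)"
    proof (intro exI[of _ "\<rho>0 / 2"] conjI ballI impI)
      fix s y assume s: "s \<in> {l..r}" "\<bar>s - s0\<bar> < \<rho>0 / 2" and y: "y \<in> U" "\<forall>i<Suc p. \<bar>y i - (x(p := s)) i\<bar> < \<rho>0 / 2"
      have 1: "\<bar>y i - (x(p := s0)) i\<bar> < \<rho>0" if "i < Suc p" for i
      proof (cases "i = p")
        case True
        then show ?thesis using y(2)[rule_format, OF that] s(2) unfolding True fun_upd_same by linarith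
      next
        case False
        then show ?thesis using y(2)[rule_format, OF that] \<rho>0(1) by simp
      qed
      have 2: "\<bar>(x(p := s)) i - (x(p := s0)) i\<bar> < \<rho>0" if "i < Suc p" for i
        using s(2) \<rho>0(1) by (cases "i = p") simp_all
      have "\<bar>g y - g (x(p := s0))\<bar> < e1 / 2" using 1 by (intro \<rho>0(2)[rule_format] y(1))
      moreover have "\<bar>g (x(p := s)) - g (x(p := s0))\<bar> < e1 / 2" using 2 by (intro \<rho>0(2)[rule_format] U'_upd x s)
      ultimately show "\<bar>g y - g (x(p := s))\<bar> < e1" by linarith
    qed (use \<rho>0 in auto)
  qed (meson less_le_trans)
  then obtain \<rho> where \<rho>: "\<rho> > 0" 
    "\<And>s y. s \<in> {l..r} \<Longrightarrow> y \<in> U \<Longrightarrow> (\<And>i. i < Suc p \<Longrightarrow> \<bar>y i - (x(p := s)) i\<bar> < \<rho>) \<Longrightarrow> \<bar>g y - g (x(p := s))\<bar> < e1"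
    by blast
  have "continuous_on {l..r} (\<lambda>s. integral {l..s} (\<lambda>s. g (x(p := s))))"
    by (rule indefinite_integral_continuous_1[OF integrable_continuous_real[OF continuous_on_last[OF g x]]])
  moreover have "x p \<in> {l..r}" using U'_last[OF x] by simp
  moreover have "e / 2 > 0" using e by simp
  ultimately obtain \<eta> where \<eta>: "\<eta> > 0" and "\<forall>s\<in>{l..r}. dist s (x p) < \<eta> \<longrightarrow> 
      dist (integral {l..s} (\<lambda>s. g (x(p := s)))) (integral {l..x p} (\<lambda>s. g (x(p := s)))) < e / 2"
    unfolding continuous_on_iff by blast
  then have \<eta>': "\<bar>integral {l..s} (\<lambda>s. g (x(p := s))) - integral {l..x p} (\<lambda>s. g (x(p := s)))\<bar> < e / 2"
    if "s \<in> {l..r}" "\<bar>s - x p\<bar> < \<eta>" for s using that by (auto simp: dist_real_def)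
  show "\<exists>\<rho>>0. \<forall>y\<in>U'. (\<forall>i<Suc p. \<bar>y i - x i\<bar> < \<rho>) \<longrightarrow> \<bar>last_integral p l g y - last_integral p l g x\<bar> < e"
  proof (intro exI[of _ "min \<rho> \<eta>"] conjI ballI impI)
    fix y assume y: "y \<in> U'" "\<forall>i<Suc p. \<bar>y i - x i\<bar> < min \<rho> \<eta>"
    have yp: "y p \<in> {l..r}" "l \<le> y p" using U'_last[OF y(1)] by auto
    have sub: "{l..y p} \<subseteq> {l..r}" using yp by auto
    have int: "(\<lambda>s. g (z(p := s))) integrable_on {l..y p}" if "z \<in> U'" for z
      by (rule integrable_continuous_real[OF continuous_on_subset[OF continuous_on_last[OF g that] sub]])
    have "norm (integral {l..y p} (\<lambda>s. g (y(p := s)) - g (x(p := s)))) \<le> e1 * (y p - l)"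
    proof (rule integral_bound)
      show "continuous_on {l..y p} (\<lambda>s. g (y(p := s)) - g (x(p := s)))"
        by (intro continuous_on_diff continuous_on_subset[OF continuous_on_last[OF g] sub] x y)
      fix s assume s: "s \<in> {l..y p}"
      then have s': "s \<in> {l..r}" using sub by blast
      have "\<bar>g (y(p := s)) - g (x(p := s))\<bar> < e1"
        using y(2) by (intro \<rho>(2) U'_upd s' y) (simp_all add: \<rho>(1))
      then show "norm (g (y(p := s)) - g (x(p := s))) \<le> e1" by simp
    qed (rule yp)
    also have "\<dots> \<le> e1 * (r - l)" using yp e1 by (intro mult_left_mono) auto
    also have "\<dots> = e / 2"
    proof -
      have "e / (2 * D) * D = e / 2" if "D \<noteq> 0" for D using that by simp
      from this[of "r - l"] lr show ?thesis by (simp only: e1_def)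
    qed
    also have "integral {l..y p} (\<lambda>s. g (y(p := s)) - g (x(p := s))) 
        = last_integral p l g y - integral {l..y p} (\<lambda>s. g (x(p := s)))"
      unfolding last_integral_def by (rule integral_diff[OF int int]) (use x y in auto)
    finally show "\<bar>last_integral p l g y - last_integral p l g x\<bar> < e"
      using \<eta>'[OF yp(1)] y(2)[rule_format, of p] unfolding last_integral_def[of p l g x] real_norm_def by linarith
  qed (use \<rho> \<eta> in auto)
qed

lemma DERIV_last_integral_last:
  assumes g: "cont_dim (Suc p) U g" and x: "x \<in> U'"
  shows "((\<lambda>s. last_integral p l g (x(p := s))) has_real_derivative g x) (at (x p))"
proof -
  have "((\<lambda>s. integral {l..s} (\<lambda>s. g (x(p := s)))) has_real_derivative g (x(p := x p))) (at (x p) within {l..r})"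
    by (rule integral_has_real_derivative[OF continuous_on_last[OF g x]]) (use U'_last[OF x] in auto)
  then show ?thesis using U'_last[OF x] by (simp add: at_within_Icc_at last_integral_def)
qed

text \<open>The limits stay fixed when a parameter coordinate i < p varies, so this is
  differentiation under the integral.\<close>

lemma DERIV_last_integral_param:
  assumes g: "smooth_dim (Suc p) U g" and x: "x \<in> U'" and i: "i < p"
  shows "((\<lambda>s. last_integral p l g (x(i := s))) has_real_derivative last_integral p l (fpd i g) x) (at (x i))"
proof -
  have i': "i < Suc p" using i by simp
  from open_dim_eventually_line[OF U'_open x i'] obtain e where e: "e > 0" "\<And>s. dist s (x i) < e \<Longrightarrow> x(i := s) \<in> U'"
    unfolding eventually_nhds_metric by blast
  let ?B = "ball (x i) e"
  have B: "x(i := s) \<in> U'" if "s \<in> ?B" for s using e(2) that by (simp add: dist_commute)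
  have xp: "l \<le> x p" "{l..x p} \<subseteq> {l..r}" using U'_last[OF x] by auto
  have up: "x(i := \<xi>, p := s) \<in> U" if "\<xi> \<in> ?B" "s \<in> {l..x p}" for \<xi> s
    using U'_upd[OF B[OF that(1)]] that(2) xp by blast
  have "((\<lambda>\<xi>. integral (cbox l (x p)) (\<lambda>s. g (x(i := \<xi>, p := s)))) has_field_derivative
        integral (cbox l (x p)) (\<lambda>s. fpd i g (x(i := x i, p := s)))) (at (x i) within ?B)"
  proof (rule leibniz_rule_field_derivative)
    fix \<xi> s assume xs: "\<xi> \<in> ?B" "s \<in> cbox l (x p)"
    have eq: "x(i := \<xi>, p := s) = (x(p := s))(i := \<xi>)" for \<xi> using i by (simp add: fun_upd_twist)
    show "((\<lambda>\<xi>. g (x(i := \<xi>, p := s))) has_field_derivative fpd i g (x(i := \<xi>, p := s))) (at \<xi> within ?B)"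
    proof -
      have "x(i := \<xi>, p := s) \<in> U" by (rule up) (use xs in auto)
      then have "(x(p := s))(i := \<xi>) \<in> U" unfolding eq .
      from has_field_derivative_at_within[OF smooth_dim_DERIV[OF g i' this]] show ?thesis unfolding eq .
    qed
  next
    fix \<xi> assume xs: "\<xi> \<in> ?B"
    show "(\<lambda>s. g (x(i := \<xi>, p := s))) integrable_on cbox l (x p)"
      using continuous_on_subset[OF continuous_on_last[OF smooth_dim_cont[OF g] B[OF xs]] xp(2)]
      by (simp add: integrable_continuous_real)
  next
    have "continuous_on (?B \<times> cbox l (x p)) (\<lambda>z. fpd i g (x(i := fst z, p := snd z)))"
    proof (rule continuous_on_cont_dim[OF smooth_dim_cont[OF smooth_dim_fpd[OF g i']]])
      fix z assume "z \<in> ?B \<times> cbox l (x p)"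
      then show "x(i := fst z, p := snd z) \<in> U" by (intro up) auto
    next
      show "continuous_on (?B \<times> cbox l (x p)) (\<lambda>z. (x(i := fst z, p := snd z)) j)" for j
        by (cases "j = p"; cases "j = i") (auto intro: continuous_intros)
    qed
    then show "continuous_on (?B \<times> cbox l (x p)) (\<lambda>(\<xi>, s). fpd i g (x(i := \<xi>, p := s)))"
      by (simp add: case_prod_unfold)
  qed (use e in auto)
  moreover have "at (x i) within ?B = at (x i)" using e by (intro at_within_open) auto
  ultimately show ?thesis using i by (simp add: last_integral_def)
qed

lemma smooth_last_integral:
  assumes g: "smooth_dim (Suc p) U g"
  shows "smooth_dim (Suc p) U' (last_integral p l g)"
proof (rule smooth_dim_coinduct[OF U'_open])
  \<comment> \<open>Differentiating an integral in the last coordinate gives its integrand, and in a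
    parameter the integral of a partial derivative, so this union is closed.\<close>
  let ?C = "{g. smooth_dim (Suc p) U' g} \<union> last_integral p l ` {g. smooth_dim (Suc p) U g}"
  show "last_integral p l g \<in> ?C" using g by blast
  fix h assume h: "h \<in> ?C"
  show "cont_dim (Suc p) U' h" using h cont_last_integral smooth_dim_cont by blast
  fix i assume i: "i < Suc p"
  from h consider "smooth_dim (Suc p) U' h" | k where "smooth_dim (Suc p) U k" "h = last_integral p l k" by blast
  then show "\<exists>g'\<in>?C. \<forall>x\<in>U'. ((\<lambda>s. h (x(i := s))) has_real_derivative g' x) (at (x i))"
  proof cases
    case 1
    have "((\<lambda>s. h (x(i := s))) has_real_derivative fpd i h x) (at (x i))" if "x \<in> U'" for x
      using smooth_dim_DERIV[OF 1 i, of x "x i"] that by simp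
    then show ?thesis using smooth_dim_fpd[OF 1 i] by blast
  next
    case 2
    show ?thesis
    proof (cases "i = p")
      case True
      have "smooth_dim (Suc p) U' k" by (rule smooth_dim_subset[OF 2(1) U'_open U'_sub])
      then show ?thesis using DERIV_last_integral_last[OF smooth_dim_cont[OF 2(1)]] 2(2) True by blast
    next
      case False
      then have ip: "i < p" using i by simp
      then show ?thesis using DERIV_last_integral_param[OF 2(1) _ ip] smooth_dim_fpd[OF 2(1) i] 2(2) by blast
    qed
  qed
qed

lemma fpd_last_integral:
  assumes "smooth_dim (Suc p) U g" "x \<in> U'"
  shows "fpd p (last_integral p l g) x = g x"
  unfolding fpd_def by (rule DERIV_imp_deriv[OF DERIV_last_integral_last[OF smooth_dim_cont[OF assms(1)] assms(2)]])

end

text \<open>The freed coordinate p will carry an integration constant as an additional parameter.\<close>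

definition drop_coord :: "nat \<Rightarrow> (nat \<Rightarrow> real) \<Rightarrow> nat \<Rightarrow> real" where
  "drop_coord p z = z(p := z (Suc p), Suc p := 0)"

lemma drop_coord_upd:
  "i < p \<Longrightarrow> drop_coord p (z(i := s)) = (drop_coord p z)(i := s)"
  "drop_coord p (z(p := s)) = drop_coord p z"
  "drop_coord p (z(Suc p := s)) = (drop_coord p z)(p := s)"
  by (auto simp: drop_coord_def)

lemma drop_coord_nth: "i < p \<Longrightarrow> drop_coord p z i = z i" "drop_coord p z p = z (Suc p)"
  by (auto simp: drop_coord_def)

lemma cont_dim_add:
  assumes "cont_dim d U f" "cont_dim d U g" shows "cont_dim d U (\<lambda>x. f x + g x)"
  unfolding cont_dim_box
proof (intro ballI allI impI)
  fix x and e :: real assume x: "x \<in> U" and e: "e > 0"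
  then have e2: "e / 2 > 0" by simp
  obtain a where a: "a > 0" "\<forall>y\<in>U. (\<forall>i<d. \<bar>y i - x i\<bar> < a) \<longrightarrow> \<bar>f y - f x\<bar> < e / 2"
    using assms(1) x e2 unfolding cont_dim_box by blast
  obtain b where b: "b > 0" "\<forall>y\<in>U. (\<forall>i<d. \<bar>y i - x i\<bar> < b) \<longrightarrow> \<bar>g y - g x\<bar> < e / 2"
    using assms(2) x e2 unfolding cont_dim_box by blast
  show "\<exists>\<rho>>0. \<forall>y\<in>U. (\<forall>i<d. \<bar>y i - x i\<bar> < \<rho>) \<longrightarrow> \<bar>f y + g y - (f x + g x)\<bar> < e"
  proof (intro exI[of _ "min a b"] conjI ballI impI)
    fix y assume "y \<in> U" "\<forall>i<d. \<bar>y i - x i\<bar> < min a b"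
    then have "\<bar>f y - f x\<bar> < e / 2" "\<bar>g y - g x\<bar> < e / 2" using a b by auto
    then show "\<bar>f y + g y - (f x + g x)\<bar> < e" by linarith
  qed (use a b in auto)
qed

lemma cont_dim_cmult:
  assumes "cont_dim d U f" shows "cont_dim d U (\<lambda>x. c * f x)"
  unfolding cont_dim_box
proof (intro ballI allI impI)
  fix x and e :: real assume x: "x \<in> U" and e: "e > 0"
  then have "e / (\<bar>c\<bar> + 1) > 0" by simp
  then obtain a where a: "a > 0" "\<forall>y\<in>U. (\<forall>i<d. \<bar>y i - x i\<bar> < a) \<longrightarrow> \<bar>f y - f x\<bar> < e / (\<bar>c\<bar> + 1)"
    using assms x unfolding cont_dim_box by blast
  show "\<exists>\<rho>>0. \<forall>y\<in>U. (\<forall>i<d. \<bar>y i - x i\<bar> < \<rho>) \<longrightarrow> \<bar>c * f y - c * f x\<bar> < e"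
  proof (intro exI[of _ a] conjI ballI impI)
    fix y assume "y \<in> U" "\<forall>i<d. \<bar>y i - x i\<bar> < a"
    then have *: "\<bar>f y - f x\<bar> < e / (\<bar>c\<bar> + 1)" using a by auto
    have "\<bar>c * f y - c * f x\<bar> = \<bar>c\<bar> * \<bar>f y - f x\<bar>" by (simp add: abs_mult[symmetric] right_diff_distrib)
    also have "\<dots> \<le> (\<bar>c\<bar> + 1) * \<bar>f y - f x\<bar>" by (intro mult_right_mono) auto
    also have "\<dots> < e" using * by (simp add: field_simps)
    finally show "\<bar>c * f y - c * f x\<bar> < e" .
  qed (use a in auto)
qed

lemma drop_coord_prodset:
  assumes "P \<subseteq> embv p" "z \<in> prodset (Suc p) (prodset p P UNIV) V" 
  shows "drop_coord p z \<in> prodset p P V"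
proof -
  have "prodset p P UNIV \<subseteq> embv (Suc p)" using assms(1) by (auto simp: prodset_def embv_def)
  then have "z (Suc p) \<in> V" "z(Suc p := 0) \<in> prodset p P UNIV" using assms(2) by (auto simp: mem_prodset)
  then have "z(Suc p := 0, p := 0) \<in> P" "z (Suc p) \<in> V" using assms(1) by (auto simp: mem_prodset)
  then show ?thesis using assms(1) by (auto simp: mem_prodset drop_coord_def fun_upd_twist)
qed

text \<open>The coordinates below p are the old parameters, coordinate p is the added constant, and
  the variable moves to coordinate p + 1.\<close>

lemma smooth_dim_add_coord:
  assumes P: "open_dim p P" and V: "open V" and g: "smooth_dim (Suc p) (prodset p P V) g"
  shows "smooth_dim (Suc (Suc p)) (prodset (Suc p) (prodset p P UNIV) V) (\<lambda>z. g (drop_coord p z) + z p)"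
proof -
  let ?U = "prodset (Suc p) (prodset p P UNIV) V"
  \<comment> \<open>\<open>?K\<close> contains the added summand and its derivatives. The factor
    \<open>c\<close> in \<open>?C\<close> is there to become 0 when coordinate p, on which
    \<open>drop_coord p z\<close> does not depend, is differentiated.\<close>
  let ?K = "{\<lambda>z::nat\<Rightarrow>real. z p, \<lambda>_. 1, \<lambda>_. 0}"
  let ?C = "{\<lambda>z. c * k (drop_coord p z) + \<kappa> z | (c::real) k \<kappa>. smooth_dim (Suc p) (prodset p P V) k \<and> \<kappa> \<in> ?K}"
  have Pe: "P \<subseteq> embv p" using P by (simp add: open_dim_def)
  have contk: "cont_dim (Suc (Suc p)) ?U (\<lambda>z. k (drop_coord p z))" if ck: "cont_dim (Suc p) (prodset p P V) k" for k
    unfolding cont_dim_box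
  proof (intro ballI allI impI)
    fix z and e :: real assume z: "z \<in> ?U" and e: "e > 0"
    obtain a where a: "a > 0" "\<forall>y\<in>prodset p P V. (\<forall>i<Suc p. \<bar>y i - drop_coord p z i\<bar> < a) \<longrightarrow> \<bar>k y - k (drop_coord p z)\<bar> < e"
      using ck[unfolded cont_dim_box, THEN bspec, OF drop_coord_prodset[OF Pe z]] e by auto
    show "\<exists>\<rho>>0. \<forall>y\<in>?U. (\<forall>i<Suc (Suc p). \<bar>y i - z i\<bar> < \<rho>) \<longrightarrow> \<bar>k (drop_coord p y) - k (drop_coord p z)\<bar> < e"
    proof (intro exI[of _ a] conjI ballI impI a(1))
      fix y assume y: "y \<in> ?U" "\<forall>i<Suc (Suc p). \<bar>y i - z i\<bar> < a"
      show "\<bar>k (drop_coord p y) - k (drop_coord p z)\<bar> < e"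
        by (rule a(2)[rule_format, OF drop_coord_prodset[OF Pe y(1)]])
          (use y(2) in \<open>auto simp: less_Suc_eq drop_coord_nth\<close>)
    qed
  qed
  show ?thesis
  proof (rule smooth_dim_coinduct[where \<C> = ?C])
    show "open_dim (Suc (Suc p)) ?U" by (intro open_dim_prodset P V open_UNIV)
    show "(\<lambda>z. g (drop_coord p z) + z p) \<in> ?C" using g 
      by (intro CollectI exI[of _ 1] exI[of _ g] exI[of _ "\<lambda>z. z p"]) simp
    fix h assume "h \<in> ?C"
    then obtain c k \<kappa> where h: "h = (\<lambda>z. c * k (drop_coord p z) + \<kappa> z)" and k: "smooth_dim (Suc p) (prodset p P V) k" and \<kappa>: "\<kappa> \<in> ?K"
      by (elim CollectE exE conjE) (rule that)
    have "cont_dim (Suc (Suc p)) ?U \<kappa>" using \<kappa> by (auto simp: cont_dim_box intro: exI[of _ 1])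
    then show "cont_dim (Suc (Suc p)) ?U h" unfolding h
      by (intro cont_dim_add cont_dim_cmult contk smooth_dim_cont[OF k])
    fix i assume i: "i < Suc (Suc p)"
    have *: "((\<lambda>s. k ((drop_coord p z)(j := s))) has_real_derivative fpd j k (drop_coord p z)) (at (drop_coord p z j))"
      if "j < Suc p" "z \<in> ?U" for j z
      using smooth_dim_DERIV[OF k that(1), of "drop_coord p z" "drop_coord p z j"] drop_coord_prodset[OF Pe that(2)] by simp
    consider "i < p" | "i = p" | "i = Suc p" using i by linarith
    then show "\<exists>g'\<in>?C. \<forall>x\<in>?U. ((\<lambda>s. h (x(i := s))) has_real_derivative g' x) (at (x i))"
    proof cases
      case 1
      have "((\<lambda>s. h (z(i := s))) has_real_derivative c * fpd i k (drop_coord p z) + 0) (at (z i))" if "z \<in> ?U" for z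
        unfolding h drop_coord_upd(1)[OF 1] using *[of i z] 1 that \<kappa>
        by (intro DERIV_add DERIV_cmult) (auto simp: drop_coord_nth)
      moreover have "(\<lambda>z. c * fpd i k (drop_coord p z) + 0) \<in> ?C" using smooth_dim_fpd[OF k, of i] 1
        by (intro CollectI exI[of _ c] exI[of _ "fpd i k"] exI[of _ "\<lambda>z. 0"]) simp
      ultimately show ?thesis by (intro bexI[of _ "\<lambda>z. c * fpd i k (drop_coord p z) + 0"]) auto
    next
      case 3
      have "((\<lambda>s. h (z(i := s))) has_real_derivative c * fpd p k (drop_coord p z) + 0) (at (z i))" if "z \<in> ?U" for z
        unfolding h 3 drop_coord_upd(3) using *[of p z] that \<kappa>
        by (intro DERIV_add DERIV_cmult) (auto simp: drop_coord_nth)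
      moreover have "(\<lambda>z. c * fpd p k (drop_coord p z) + 0) \<in> ?C" using smooth_dim_fpd[OF k, of p]
        by (intro CollectI exI[of _ c] exI[of _ "fpd p k"] exI[of _ "\<lambda>z. 0"]) simp
      ultimately show ?thesis by (intro bexI[of _ "\<lambda>z. c * fpd p k (drop_coord p z) + 0"]) auto
    next
      case 2
      obtain \<kappa>' where \<kappa>': "\<kappa>' \<in> ?K" "\<And>z. ((\<lambda>s. \<kappa> (z(p := s))) has_real_derivative \<kappa>' z) (at (z p))"
      proof (cases "\<kappa> = (\<lambda>z. z p)")
        case True
        then show ?thesis by (intro that[of "\<lambda>_. 1"]) auto
      next
        case False
        then show ?thesis using \<kappa> by (intro that[of "\<lambda>_. 0"]) auto
      qed
      have "((\<lambda>s. h (z(i := s))) has_real_derivative 0 * k (drop_coord p z) + \<kappa>' z) (at (z i))" for z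
        unfolding h 2 drop_coord_upd(2) using \<kappa>'(2) by (intro DERIV_add) auto
      moreover have "(\<lambda>z. 0 * k (drop_coord p z) + \<kappa>' z) \<in> ?C" using k \<kappa>'(1)
        by (intro CollectI exI[of _ 0] exI[of _ k] exI[of _ \<kappa>']) simp
      ultimately show ?thesis by (intro bexI[of _ "\<lambda>z. 0 * k (drop_coord p z) + \<kappa>' z"]) auto
    qed
  qed
qed

lemma fpd_add_coord:
  "fpd (Suc p) (\<lambda>z. g (drop_coord p z) + z p) z = fpd p g (drop_coord p z)"
proof -
  \<comment> \<open>\<open>deriv\<close> is a choice determined by which numbers are derivatives;
    equivalence of these predicates gives equal values even where no derivative exists.\<close>
  have "DERIV (\<lambda>s. g ((drop_coord p z)(p := s)) + z p) x :> D \<longleftrightarrow> DERIV (\<lambda>s. g ((drop_coord p z)(p := s))) x :> D" for x D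
  proof
    assume "DERIV (\<lambda>s. g ((drop_coord p z)(p := s)) + z p) x :> D"
    from DERIV_diff[OF this DERIV_const[of "z p"]] show "DERIV (\<lambda>s. g ((drop_coord p z)(p := s))) x :> D" by simp
  next
    assume "DERIV (\<lambda>s. g ((drop_coord p z)(p := s))) x :> D"
    from DERIV_add[OF this DERIV_const[of "z p"]] show "DERIV (\<lambda>s. g ((drop_coord p z)(p := s)) + z p) x :> D" by simp
  qed
  then show ?thesis by (simp add: fpd_def deriv_def drop_coord_upd drop_coord_nth)
qed

section \<open>Fermat reals and charts\<close>

lemma fsim_rep: "fsim (rep_fermat x) (rep_fermat x)"
  by (rule Quotient3_rep_reflp[OF Quotient3_fermat])

lemma rep_Ro [simp]: "rep_fermat x \<in> Ro"
  using fsim_rep[of x] by (simp add: fsim_def)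

lemma abs_rep [simp]: "abs_fermat (rep_fermat x) = x"
  by (rule Quotient3_abs_rep[OF Quotient3_fermat])

lemma fsim_refl: "x \<in> Ro \<Longrightarrow> fsim x x"
  by (simp add: fsim_def littleo_zero)

lemma abs_eq_iff: "x \<in> Ro \<Longrightarrow> y \<in> Ro \<Longrightarrow> abs_fermat x = abs_fermat y \<longleftrightarrow> littleo (\<lambda>t. x t - y t)"
  using Quotient3_rel[OF Quotient3_fermat, of x y] by (auto simp: fsim_refl) (auto simp: fsim_def)

lemma rep_abs: "x \<in> Ro \<Longrightarrow> littleo (\<lambda>t. rep_fermat (abs_fermat x) t - x t)"
  using abs_eq_iff[of "rep_fermat (abs_fermat x)" x] by simp

lemma fermat_eq_iff: "x = y \<longleftrightarrow> littleo (\<lambda>t. rep_fermat x t - rep_fermat y t)"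
  using abs_eq_iff[of "rep_fermat x" "rep_fermat y"] by simp

lemma littleo_at_0: "littleo h \<Longrightarrow> h 0 = 0"
  using usmall_at_0[of "\<lambda>t _. h t" 0] by (simp add: littleo_usmall)

text \<open>Representatives of one Fermat real agree exactly at t = 0, because
  \<open>littleo\<close> includes this point.\<close>

lemma st_abs: "x \<in> Ro \<Longrightarrow> st (abs_fermat x) = x 0"
  using littleo_at_0[OF rep_abs[of x]] by (simp add: st_def)

lemma Ro_iff_expandable: "x \<in> Ro \<longleftrightarrow> expandable (\<lambda>t _. x t)"
  using expandable_Ro Ro_expandable[of "\<lambda>t _. x t" 0] by auto

lemma expandable_line: 
  "x \<in> Ro \<Longrightarrow> y \<in> Ro \<Longrightarrow> expandable (\<lambda>t h. x t + h * (y t - x t))"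
  by (intro expandable_add expandable_mult expandable_diff expandable_Ro expandable_const[of "\<lambda>h. h"] continuous_on_id)

lemma Ro_line: "x \<in> Ro \<Longrightarrow> y \<in> Ro \<Longrightarrow> h \<in> {0..1} \<Longrightarrow> (\<lambda>t. x t + h * (y t - x t)) \<in> Ro"
  by (rule Ro_expandable[OF expandable_line])

lemma Ro_add: "x \<in> Ro \<Longrightarrow> y \<in> Ro \<Longrightarrow> (\<lambda>t. x t + y t) \<in> Ro"
  unfolding Ro_iff_expandable by (rule expandable_add)

lemma Ro_diff: "x \<in> Ro \<Longrightarrow> y \<in> Ro \<Longrightarrow> (\<lambda>t. x t - y t) \<in> Ro"
  unfolding Ro_iff_expandable by (rule expandable_diff)

lemma Ro_const: "(\<lambda>_. r) \<in> Ro"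
  unfolding Ro_iff_expandable by (rule expandable_const) simp

lemma Ro_continuous_at_0:
  assumes "x \<in> Ro" "\<rho> > 0" shows "\<forall>\<^sub>F t in germ0. \<bar>x t - x 0\<bar> < \<rho>"
proof -
  obtain a where "a > 0" "uorder a (\<lambda>t (h::real). x t - x 0)"
    using expandable_standard_part(2)[OF expandable_Ro[OF assms(1)]] by blast
  from uorder_small[OF this(2,1) assms(2)] show ?thesis by eventually_elim force
qed

text \<open>The point (1 - h) x + h y. Its chosen representative may vary irregularly with h, but by
  \<open>rep_fseg\<close> it is within o(t) of an affine function of h.\<close>

definition fseg :: "fermat \<Rightarrow> fermat \<Rightarrow> real \<Rightarrow> fermat" where
  "fseg x y h = abs_fermat (\<lambda>t. rep_fermat x t + h * (rep_fermat y t - rep_fermat x t))"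

lemma rep_fseg: "h \<in> {0..1} \<Longrightarrow>
   littleo (\<lambda>t. rep_fermat (fseg x y h) t - (rep_fermat x t + h * (rep_fermat y t - rep_fermat x t)))"
  unfolding fseg_def by (intro rep_abs Ro_line) auto

lemma st_fseg: "h \<in> {0..1} \<Longrightarrow> st (fseg x y h) = st x + h * (st y - st x)"
  unfolding fseg_def by (subst st_abs) (auto intro: Ro_line simp: st_def)

lemma fseg_0 [simp]: "fseg x y 0 = x" and fseg_1 [simp]: "fseg x y 1 = y"
  by (simp_all add: fseg_def)

definition fadd :: "fermat \<Rightarrow> fermat \<Rightarrow> fermat" where
  "fadd x y = abs_fermat (\<lambda>t. rep_fermat x t + rep_fermat y t)"

lemma rep_fadd: "littleo (\<lambda>t. rep_fermat (fadd x y) t - (rep_fermat x t + rep_fermat y t))"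
  unfolding fadd_def by (intro rep_abs Ro_add) auto

text \<open>The last argument is an arbitrary map instead of a chosen representative, so that
  segments can be inserted explicitly; \<open>ext_congruence\<close> shows that the class of the
  result is unaffected.\<close>

definition argv :: "nat \<Rightarrow> (nat \<Rightarrow> fermat) \<Rightarrow> (real \<Rightarrow> real) \<Rightarrow> real \<Rightarrow> nat \<Rightarrow> real" where
  "argv p q z t = tovec (Suc p) (\<lambda>i. if i < p then rep_fermat (q i) t else z t)"

lemma ext_app_argv: "ext_app p \<alpha> q y = abs_fermat (\<lambda>t. \<alpha> (argv p q (rep_fermat y) t))"
proof -
  have "(\<lambda>i. if i < p then rep_fermat (q i) t else if i = p then rep_fermat y t else 0) = argv p q (rep_fermat y) t" for t
    by (auto simp: argv_def tovec_def)
  then show ?thesis by (simp add: ext_app_def)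
qed

text \<open>The part of \<open>loc_rep\<close> that mentions neither the function nor the point. It
  is shared by all points over V and inherited by \<open>fpd p \<alpha>\<close>.\<close>

locale chart =
  fixes V :: "real set" and p :: nat and P :: "(nat \<Rightarrow> real) set" and q :: "nat \<Rightarrow> fermat" 
    and \<alpha> :: "(nat \<Rightarrow> real) \<Rightarrow> real"
  assumes V: "open V" and P: "open_dim p P" and q: "pstd p q \<in> P"
    and smooth: "smooth_dim (Suc p) (prodset p P V) \<alpha>"

lemma loc_rep_iff_chart:
  "loc_rep S f x V p P q \<alpha> \<longleftrightarrow> chart V p P q \<alpha> \<and> st x \<in> V \<and> (\<forall>y\<in>S. st y \<in> V \<longrightarrow> f y = ext_app p \<alpha> q y)"
  by (auto simp: loc_rep_def chart_def)

context chart
begin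

lemma chart_fpd: "chart V p P q (fpd p \<alpha>)"
  using V P q smooth_dim_fpd[OF smooth, of p] by (simp add: chart_def)

lemma chart_subset: "open W \<Longrightarrow> W \<subseteq> V \<Longrightarrow> chart W p P q \<alpha>"
  using P q smooth_dim_subset[OF smooth open_dim_prodset[OF P] prodset_mono] by (simp add: chart_def)

lemma argv_0: "z 0 \<in> V \<Longrightarrow> argv p q z 0 \<in> prodset p P V"
proof -
  assume z: "z 0 \<in> V"
  have "(argv p q z 0)(p := 0) = pstd p q" by (auto simp: argv_def tovec_def pstd_def st_def)
  then show ?thesis using z q P by (subst mem_prodset) (auto simp: open_dim_def argv_def)
qed

lemma line_vector:
  assumes "\<xi> \<in> Ro" "\<eta> \<in> Ro" and "\<forall>h\<in>{0..1}. \<xi> 0 + h * (\<eta> 0 - \<xi> 0) \<in> V"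
  shows "expandable_vector (Suc p) (prodset p P V) (\<lambda>i t h. if i < p then rep_fermat (q i) t else \<xi> t + h * (\<eta> t - \<xi> t))"
proof
  fix i assume "i < Suc p"
  show "expandable (\<lambda>t h. if i < p then rep_fermat (q i) t else \<xi> t + h * (\<eta> t - \<xi> t))"
    using expandable_line[OF assms(1,2)] expandable_Ro[OF rep_Ro[of "q i"]] by (cases "i < p") simp_all
next
  fix h :: real assume "h \<in> {0..1}"
  from argv_0[of "\<lambda>t. \<xi> t + h * (\<eta> t - \<xi> t)", OF assms(3)[rule_format, OF this]]
  show "tovec (Suc p) (\<lambda>i. if i < p then rep_fermat (q i) 0 else \<xi> 0 + h * (\<eta> 0 - \<xi> 0)) \<in> prodset p P V"
    by (simp add: argv_def)
qed

lemma expandable_on_line: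
  assumes "\<xi> \<in> Ro" "\<eta> \<in> Ro" and "\<forall>h\<in>{0..1}. \<xi> 0 + h * (\<eta> 0 - \<xi> 0) \<in> V"
  shows "expandable (\<lambda>t h. \<alpha> (argv p q (\<lambda>t. \<xi> t + h * (\<eta> t - \<xi> t)) t))"
  using expandable_vector.expandable_smooth[OF line_vector[OF assms] smooth] by (simp add: argv_def)

lemma DERIV_on_line:
  assumes "\<xi> \<in> Ro" "\<eta> \<in> Ro" and "\<forall>h\<in>{0..1}. \<xi> 0 + h * (\<eta> 0 - \<xi> 0) \<in> V"
  shows "\<forall>\<^sub>F t in germ0. \<forall>h\<in>{0..1}. ((\<lambda>h. \<alpha> (argv p q (\<lambda>t. \<xi> t + h * (\<eta> t - \<xi> t)) t)) has_real_derivative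
     (\<eta> t - \<xi> t) * fpd p \<alpha> (argv p q (\<lambda>t. \<xi> t + h * (\<eta> t - \<xi> t)) t)) (at h within {0..1})"
  using expandable_vector.eventually_U[OF line_vector[OF assms] smooth_dim_open[OF smooth]]
proof eventually_elim
  case (elim t)
  show ?case
  proof
    fix h :: real assume h: "h \<in> {0..1}"
    \<comment> \<open>Moving h changes only the last coordinate, with speed \<eta> t - \<xi>
      t.\<close>
    define v where "v = (\<lambda>i. if i = p then \<eta> t - \<xi> t else 0)"
    have eq: "(\<lambda>i. argv p q \<xi> t i + h * v i) = argv p q (\<lambda>t. \<xi> t + h * (\<eta> t - \<xi> t)) t" for h
      by (auto simp: argv_def tovec_def v_def)
    have v: "v \<in> embv (Suc p)" by (auto simp: v_def embv_def)
    have U: "(\<lambda>i. argv p q \<xi> t i + h * v i) \<in> prodset p P V" 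
      using elim[rule_format, OF h] unfolding eq by (simp add: argv_def)
    have "(\<Sum>i<Suc p. v i * g i) = (\<eta> t - \<xi> t) * g p" for g :: "nat \<Rightarrow> real"
      by (simp add: v_def)
    with has_field_derivative_at_within[OF smooth_dim_DERIV_line[OF smooth v U], of "{0..1}"]
    show "((\<lambda>h. \<alpha> (argv p q (\<lambda>t. \<xi> t + h * (\<eta> t - \<xi> t)) t)) has_real_derivative
     (\<eta> t - \<xi> t) * fpd p \<alpha> (argv p q (\<lambda>t. \<xi> t + h * (\<eta> t - \<xi> t)) t)) (at h within {0..1})"
      unfolding eq by (simp del: sum.lessThan_Suc)
  qed
qed

lemma ext_Ro:
  assumes "z \<in> Ro" "z 0 \<in> V" shows "(\<lambda>t. \<alpha> (argv p q z t)) \<in> Ro"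
  using Ro_expandable[OF expandable_on_line[of z z], of 0] assms by simp

lemma eventually_argv:
  assumes "z \<in> Ro" "z 0 \<in> V" shows "\<forall>\<^sub>F t in germ0. argv p q z t \<in> prodset p P V"
proof -
  have "\<forall>h\<in>{0..1}. z 0 + h * (z 0 - z 0) \<in> V" using assms by simp
  from expandable_vector.eventually_U[OF line_vector[OF assms(1,1) this] smooth_dim_open[OF smooth]]
  show ?thesis
  proof eventually_elim
    case (elim t)
    show ?case using elim[rule_format, of 0] by (simp add: argv_def cong: if_cong)
  qed
qed

text \<open>Along the line from \<xi> to \<eta> the derivative is a bounded family times \<eta> -
  \<xi>, hence uniformly o(t), and integration keeps it so.\<close>

lemma ext_congruence:
  assumes "\<xi> \<in> Ro" "\<eta> \<in> Ro" "\<xi> 0 \<in> V" and o: "littleo (\<lambda>t. \<eta> t - \<xi> t)"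
  shows "littleo (\<lambda>t. \<alpha> (argv p q \<eta> t) - \<alpha> (argv p q \<xi> t))"
proof -
  have 0: "\<forall>h\<in>{0..1}. \<xi> 0 + h * (\<eta> 0 - \<xi> 0) \<in> V" using assms littleo_at_0[OF o] by simp
  interpret D: chart V p P q "fpd p \<alpha>" by (rule chart_fpd)
  have "usmall (\<lambda>t h. fpd p \<alpha> (argv p q (\<lambda>t. \<xi> t + h * (\<eta> t - \<xi> t)) t) * (\<eta> t - \<xi> t))"
    using o[unfolded littleo_usmall] D.expandable_on_line[OF assms(1,2) 0] 
    by (intro usmall_mult expandable_ubounded) auto
  then have "usmall (\<lambda>t h. (\<eta> t - \<xi> t) * fpd p \<alpha> (argv p q (\<lambda>t. \<xi> t + h * (\<eta> t - \<xi> t)) t))"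
    by (simp add: mult.commute)
  from usmall_littleo[OF usmall_integrated[OF this DERIV_on_line[OF assms(1,2) 0]], of 1]
  show ?thesis by simp
qed

lemma rep_ext_app:
  assumes "z \<in> Ro" "z 0 \<in> V" "littleo (\<lambda>t. rep_fermat y t - z t)"
  shows "littleo (\<lambda>t. rep_fermat (ext_app p \<alpha> q y) t - \<alpha> (argv p q z t))"
proof -
  have y: "rep_fermat y 0 \<in> V" using littleo_at_0[OF assms(3)] assms(2) by simp
  show ?thesis unfolding ext_app_argv
    using littleo_trans[OF rep_abs[OF ext_Ro[OF rep_Ro y]] ext_congruence[OF assms(1) rep_Ro assms(2,3)]] .
qed

text \<open>The argument vector need only lie in the domain for small t, and only these t matter for
  the class. This applies where \<beta> is an \<open>fpd\<close> whose values outside the domain are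
  unknown.\<close>

lemma ext_app_eqI:
  assumes \<beta>: "\<And>x. x \<in> prodset p P V \<Longrightarrow> \<beta> x = \<alpha> x" and y: "st y \<in> V"
  shows "ext_app p \<beta> q y = ext_app p \<alpha> q y"
proof -
  have y': "rep_fermat y 0 \<in> V" using y by (simp add: st_def)
  let ?a = "\<lambda>t. \<alpha> (argv p q (rep_fermat y) t)" and ?b = "\<lambda>t. \<beta> (argv p q (rep_fermat y) t)"
  have ev: "\<forall>\<^sub>F t in germ0. ?b t = ?a t"
    using eventually_argv[OF rep_Ro y'] by eventually_elim (rule \<beta>)
  have a: "?a \<in> Ro" by (rule ext_Ro[OF rep_Ro y'])
  have "?b \<in> Ro" unfolding Ro_iff_expandable
    by (rule expandable_cong_eventually[OF a[unfolded Ro_iff_expandable]]) (use ev in \<open>auto elim: eventually_mono\<close>)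
  moreover have "littleo (\<lambda>t. ?b t - ?a t)" unfolding littleo_usmall
    by (rule usmall_eventually_eq[OF usmall_0]) (use ev in \<open>auto elim: eventually_mono\<close>)
  ultimately show ?thesis unfolding ext_app_argv using abs_eq_iff a by blast
qed

end

lemma chart_add_constant:
  assumes "chart V p P q \<alpha>"
  defines "\<alpha>' \<equiv> \<lambda>z. \<alpha> (drop_coord p z) + z p"
  shows "chart V (Suc p) (prodset p P UNIV) (q(p := c)) \<alpha>'"
    and "st y \<in> V \<Longrightarrow> ext_app (Suc p) \<alpha>' (q(p := c)) y = fadd (ext_app p \<alpha> q y) c"
    and "ext_app (Suc p) (fpd (Suc p) \<alpha>') (q(p := c)) y = ext_app p (fpd p \<alpha>) q y"
proof -
  interpret chart V p P q \<alpha> by fact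
  have Pe: "P \<subseteq> embv p" using P by (simp add: open_dim_def)
  have "(pstd (Suc p) (q(p := c)))(p := 0) = pstd p q" by (auto simp: pstd_def)
  then have "pstd (Suc p) (q(p := c)) \<in> prodset p P UNIV" using q by (simp add: mem_prodset[OF Pe])
  then show "chart V (Suc p) (prodset p P UNIV) (q(p := c)) \<alpha>'"
    unfolding chart_def \<alpha>'_def using V open_dim_prodset[OF P open_UNIV] smooth_dim_add_coord[OF P V smooth] by blast
  have drop: "drop_coord p (argv (Suc p) (q(p := c)) z t) = argv p q z t" for z t
    by (auto simp: drop_coord_def argv_def tovec_def)
  have pth: "argv (Suc p) (q(p := c)) z t p = rep_fermat c t" for z t by (simp add: argv_def)
  show "ext_app (Suc p) (fpd (Suc p) \<alpha>') (q(p := c)) y = ext_app p (fpd p \<alpha>) q y"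
    unfolding ext_app_argv \<alpha>'_def fpd_add_coord drop ..
  assume "st y \<in> V"
  then have y: "rep_fermat y 0 \<in> V" by (simp add: st_def)
  let ?F = "\<lambda>t. \<alpha> (argv p q (rep_fermat y) t)"
  \<comment> \<open>\<open>fadd\<close> adds the chosen representative of the class of
    \<open>?F\<close>, which differs from \<open>?F\<close> by o(t).\<close>
  have "abs_fermat (\<lambda>t. ?F t + rep_fermat c t) = abs_fermat (\<lambda>t. rep_fermat (abs_fermat ?F) t + rep_fermat c t)"
    using littleo_sym[OF rep_abs[OF ext_Ro[OF rep_Ro y]]] by (subst abs_eq_iff) (auto intro!: Ro_add ext_Ro y)
  then show "ext_app (Suc p) \<alpha>' (q(p := c)) y = fadd (ext_app p \<alpha> q y) c"
    unfolding ext_app_argv \<alpha>'_def drop pth fadd_def .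
qed

section \<open>The order, and segments inside intervals\<close>

definition one_sided :: "real \<Rightarrow> fermat \<Rightarrow> fermat \<Rightarrow> bool" where
  "one_sided \<sigma> a x \<longleftrightarrow> (\<forall>\<epsilon>>0. \<forall>\<^sub>F t in germ0. \<sigma> * (rep_fermat a t - rep_fermat x t) \<le> \<epsilon> * t)"

lemma fle_iff: "fle x y \<longleftrightarrow> (\<forall>\<epsilon>>0. \<forall>\<^sub>F t in germ0. rep_fermat x t - rep_fermat y t \<le> \<epsilon> * t)"
proof
  assume "fle x y"
  then obtain z where z: "littleo z" "\<forall>\<^sub>F t in germ0. rep_fermat x t \<le> rep_fermat y t + z t"
    unfolding fle_def eventually_germ0 by blast
  show "\<forall>\<epsilon>>0. \<forall>\<^sub>F t in germ0. rep_fermat x t - rep_fermat y t \<le> \<epsilon> * t"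
  proof (intro allI impI)
    fix e :: real assume "e > 0"
    then have "\<forall>\<^sub>F t in germ0. \<bar>z t\<bar> \<le> e * t" using z(1) by (simp add: littleo_iff)
    with z(2) show "\<forall>\<^sub>F t in germ0. rep_fermat x t - rep_fermat y t \<le> e * t" by eventually_elim linarith
  qed
next
  assume *: "\<forall>\<epsilon>>0. \<forall>\<^sub>F t in germ0. rep_fermat x t - rep_fermat y t \<le> \<epsilon> * t"
  \<comment> \<open>The smallest nonnegative correction that restores the inequality
    pointwise.\<close>
  define z where "z t = max 0 (rep_fermat x t - rep_fermat y t)" for t
  have "littleo z" unfolding littleo_iff
  proof (intro allI impI)
    fix e :: real assume e: "e > 0"
    have "\<forall>\<^sub>F t in germ0. 0 \<le> t \<and> t < (1::real)" by (rule eventually_germ0_lt) simp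
    with *[rule_format, OF e] show "\<forall>\<^sub>F t in germ0. \<bar>z t\<bar> \<le> e * t"
      by eventually_elim (use e in \<open>auto simp: z_def\<close>)
  qed
  moreover have "z \<in> Ro" unfolding Ro_def using \<open>littleo z\<close> by (auto intro!: exI[of _ 0] exI[of _ "[]"])
  moreover have "\<forall>\<^sub>F t in germ0. rep_fermat x t \<le> rep_fermat y t + z t"
    by (auto simp: z_def eventually_germ0 intro: exI[of _ 1])
  ultimately show "fle x y" unfolding fle_def eventually_germ0 by blast
qed

text \<open>The sign \<sigma> lets lower bounds (1) and upper bounds (-1) share one proof.\<close>

lemma one_sided_fle: "fle a x \<longleftrightarrow> one_sided 1 a x" "fle x a \<longleftrightarrow> one_sided (-1) a x"
  by (simp_all add: fle_iff one_sided_def algebra_simps)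

text \<open>A convex combination of the two given bounds; half of \<epsilon> is reserved for the
  o(t) between the affine expression and the chosen representative.\<close>

lemma one_sided_fseg:
  assumes \<sigma>: "\<bar>\<sigma>\<bar> = 1" and x: "one_sided \<sigma> a x" and y: "one_sided \<sigma> a y" and h: "h \<in> {0..1}"
  shows "one_sided \<sigma> a (fseg x y h)"
  unfolding one_sided_def
proof (intro allI impI)
  fix e :: real assume e: "e > 0"
  then have e2: "e / 2 > 0" by simp
  from x[unfolded one_sided_def, rule_format, OF e2] y[unfolded one_sided_def, rule_format, OF e2]
    rep_fseg[OF h, of x y, unfolded littleo_iff, rule_format, OF e2]
  show "\<forall>\<^sub>F t in germ0. \<sigma> * (rep_fermat a t - rep_fermat (fseg x y h) t) \<le> e * t"
  proof eventually_elim
    case (elim t)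
    let ?z = "rep_fermat x t + h * (rep_fermat y t - rep_fermat x t)"
    have "\<sigma> * (rep_fermat a t - ?z) 
        = (1 - h) * (\<sigma> * (rep_fermat a t - rep_fermat x t)) + h * (\<sigma> * (rep_fermat a t - rep_fermat y t))"
      by (simp add: algebra_simps)
    also have "\<dots> \<le> (1 - h) * (e / 2 * t) + h * (e / 2 * t)"
      using h elim by (intro add_mono mult_left_mono) auto
    also have "\<dots> = ((1 - h) + h) * (e / 2 * t)" by (simp only: distrib_right)
    also have "\<dots> = e / 2 * t" by simp
    finally have 1: "\<sigma> * (rep_fermat a t - ?z) \<le> e / 2 * t" .
    have 2: "\<sigma> * (?z - rep_fermat (fseg x y h) t) \<le> e / 2 * t"
      using abs_ge_self[of "\<sigma> * (?z - rep_fermat (fseg x y h) t)"] elim(3) \<sigma> by (simp add: abs_mult abs_minus_commute)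
    have "\<sigma> * (rep_fermat a t - rep_fermat (fseg x y h) t) 
       = \<sigma> * (rep_fermat a t - ?z) + \<sigma> * (?z - rep_fermat (fseg x y h) t)" by (simp add: algebra_simps)
    also have "\<dots> \<le> e / 2 * t + e / 2 * t" using 1 2 by (rule add_mono)
    finally show ?case by simp
  qed
qed

text \<open>Needed for open ends. If x and y lie on the same side of a, then (1 - h) (x - a) and h
  (y - a) have the same sign and cancel, so for h < 1 already x = a.\<close>

lemma one_sided_fseg_strict:
  assumes \<sigma>: "\<bar>\<sigma>\<bar> = 1" and x: "one_sided \<sigma> a x" and y: "one_sided \<sigma> a y" and h: "h \<in> {0..1}"
    and a: "fseg x y h = a"
  shows "x = a \<or> y = a"
proof (cases "h = 1")
  case True
  then show ?thesis using a by simp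
next
  case False
  then have h1: "1 - h > 0" using h by simp
  have \<sigma>\<sigma>: "\<sigma> * \<sigma> = 1" using \<sigma> by (metis abs_mult_self_eq mult_1)
  have "littleo (\<lambda>t. rep_fermat x t - rep_fermat a t)" unfolding littleo_iff
  proof (intro allI impI)
    fix e :: real assume e: "e > 0"
    \<comment> \<open>Two errors of size e' * t are divided by 1 - h at the end.\<close>
    define e' where "e' = e * (1 - h) / 2"
    have e': "e' > 0" using e h1 by (simp add: e'_def)
    have "\<forall>\<^sub>F t in germ0. 0 \<le> t \<and> t < (1::real)" by (rule eventually_germ0_lt) simp
    with x[unfolded one_sided_def, rule_format, OF e'] y[unfolded one_sided_def, rule_format, OF e'] x[unfolded one_sided_def, rule_format, OF e]
      rep_fseg[OF h, of x y, unfolded littleo_iff a, rule_format, OF e']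
    show "\<forall>\<^sub>F t in germ0. \<bar>rep_fermat x t - rep_fermat a t\<bar> \<le> e * t"
    proof eventually_elim
      case (elim t)
      let ?X = "\<sigma> * (rep_fermat x t - rep_fermat a t)" and ?Y = "\<sigma> * (rep_fermat y t - rep_fermat a t)"
      let ?E = "rep_fermat a t - (rep_fermat x t + h * (rep_fermat y t - rep_fermat x t))"
      have "(1 - h) * ?X = - \<sigma> * ?E - h * ?Y" by (simp add: algebra_simps)
      moreover have "- \<sigma> * ?E \<le> e' * t"
        using abs_ge_self[of "- \<sigma> * ?E"] elim(4) \<sigma> by (simp add: abs_mult)
      moreover have "- h * ?Y \<le> e' * t"
      proof -
        have "- ?Y \<le> e' * t" using elim(2) by (simp add: algebra_simps)
        then have "h * - ?Y \<le> h * (e' * t)" using h by (intro mult_left_mono) auto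
        also have "\<dots> \<le> e' * t" using h e' elim(5) by (intro mult_left_le_one_le) auto
        finally show ?thesis by simp
      qed
      ultimately have "(1 - h) * ?X \<le> 2 * e' * t" by linarith
      also have "\<dots> = (1 - h) * (e * t)" by (simp add: e'_def)
      finally have "?X \<le> e * t" using h1 by simp
      moreover have "- ?X \<le> e * t" using elim(3) by (simp add: algebra_simps)
      ultimately have "\<bar>?X\<bar> \<le> e * t" by linarith
      then show ?case using \<sigma> by (simp add: abs_mult)
    qed
  qed
  then show ?thesis by (simp add: fermat_eq_iff)
qed

lemma fle_fseg:
  assumes "h \<in> {0..1}"
  shows "fle a x \<Longrightarrow> fle a y \<Longrightarrow> fle a (fseg x y h)"
    and "fle x a \<Longrightarrow> fle y a \<Longrightarrow> fle (fseg x y h) a"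
  using one_sided_fseg[of 1 a x y h] one_sided_fseg[of "-1" a x y h] assms
  unfolding one_sided_fle(1)[of a] one_sided_fle(2)[of _ a] by simp_all

lemma fseg_eq_bound:
  assumes "h \<in> {0..1}" "fseg x y h = a"
  shows "fle a x \<Longrightarrow> fle a y \<Longrightarrow> x = a \<or> y = a"
    and "fle x a \<Longrightarrow> fle y a \<Longrightarrow> x = a \<or> y = a"
  using one_sided_fseg_strict[of 1 a x y h] one_sided_fseg_strict[of "-1" a x y h] assms
  unfolding one_sided_fle(1)[of a] one_sided_fle(2)[of _ a] by simp_all

lemma ele_fseg:
  assumes "h \<in> {0..1}"
  shows "ele a (Fin x) \<Longrightarrow> ele a (Fin y) \<Longrightarrow> ele a (Fin (fseg x y h))"
    and "ele (Fin x) a \<Longrightarrow> ele (Fin y) a \<Longrightarrow> ele (Fin (fseg x y h)) a"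
  by (cases a; simp add: fle_fseg[OF assms])+

lemma elt_fseg:
  assumes "h \<in> {0..1}"
  shows "elt a (Fin x) \<Longrightarrow> elt a (Fin y) \<Longrightarrow> elt a (Fin (fseg x y h))"
    and "elt (Fin x) a \<Longrightarrow> elt (Fin y) a \<Longrightarrow> elt (Fin (fseg x y h)) a"
  unfolding elt_def
  by (cases a; use fle_fseg[OF assms] fseg_eq_bound[OF assms] in \<open>simp; metis\<close>)+

lemma fle_if_st_less: "st x < st y \<Longrightarrow> fle x y"
  unfolding fle_iff
proof (intro allI impI)
  fix e :: real assume xy: "st x < st y" and e: "e > 0"
  then have d: "(st y - st x) / 2 > 0" by simp
  have "\<forall>\<^sub>F t in germ0. 0 \<le> t \<and> t < (1::real)" by (rule eventually_germ0_lt) simp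
  with Ro_continuous_at_0[OF rep_Ro d, of x] Ro_continuous_at_0[OF rep_Ro d, of y]
  show "\<forall>\<^sub>F t in germ0. rep_fermat x t - rep_fermat y t \<le> e * t"
  proof eventually_elim
    case (elim t)
    have "rep_fermat x t - rep_fermat x 0 < (st y - st x) / 2" "- (rep_fermat y t - rep_fermat y 0) < (st y - st x) / 2"
      by (rule order.strict_trans1[OF abs_ge_self elim(1)], rule order.strict_trans1[OF abs_ge_minus_self elim(2)])
    then have "rep_fermat x t - rep_fermat y t \<le> 0" by (simp add: st_def field_simps)
    also have "0 \<le> e * t" using e elim by simp
    finally show ?case .
  qed
qed

lemma st_const: "st (abs_fermat (\<lambda>_. r)) = r"
  by (rule st_abs[OF Ro_const])

text \<open>All that the construction uses of an interval; the kinds of end points are dealt with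
  once, in the next lemma.\<close>

locale fermat_segment_set =
  fixes J :: "fermat set"
  assumes seg: "x \<in> J \<Longrightarrow> y \<in> J \<Longrightarrow> h \<in> {0..1} \<Longrightarrow> fseg x y h \<in> J"
    and nontrivial: "\<exists>x\<in>J. \<exists>y\<in>J. st x \<noteq> st y"

lemma fermat_segment_set_interval:
  assumes "fermat_interval a b J" "est a < est b"
  shows "fermat_segment_set J"
proof
  fix x y and h :: real assume "x \<in> J" "y \<in> J" "h \<in> {0..1}"
  then show "fseg x y h \<in> J"
    using assms(1) ele_fseg[of h] elt_fseg[of h] unfolding fermat_interval_def by auto
next
  \<comment> \<open>A real strictly between the standard parts satisfies both strict comparisons
    with the end points, hence belongs to each of the four kinds of interval.\<close>
  have inJ: "abs_fermat (\<lambda>_. r) \<in> J" if r: "est a < ereal r" "ereal r < est b" for r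
  proof -
    have "elt a (Fin (abs_fermat (\<lambda>_. r)))"
      using r(1) fle_if_st_less[of _ "abs_fermat (\<lambda>_. r)"] by (cases a) (auto simp: elt_def st_const)
    moreover have "elt (Fin (abs_fermat (\<lambda>_. r))) b"
      using r(2) fle_if_st_less[of "abs_fermat (\<lambda>_. r)"] by (cases b) (auto simp: elt_def st_const)
    ultimately show ?thesis using assms(1) unfolding fermat_interval_def elt_def by auto
  qed
  obtain r where r: "est a < ereal r" "ereal r < est b" using ereal_dense2[OF assms(2)] by blast
  obtain s where s: "ereal r < ereal s" "ereal s < est b" using ereal_dense2[OF r(2)] by blast
  have "abs_fermat (\<lambda>_. r) \<in> J" "abs_fermat (\<lambda>_. s) \<in> J" using inJ[OF r] inJ[OF less_trans[OF r(1) s(1)] s(2)] .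
  moreover have "st (abs_fermat (\<lambda>_. r)) \<noteq> st (abs_fermat (\<lambda>_. s))" using s by (simp add: st_const)
  ultimately show "\<exists>x\<in>J. \<exists>y\<in>J. st x \<noteq> st y" by blast
qed

section \<open>Antiderivatives\<close>

lemma littleo_cancel:
  assumes o: "littleo (\<lambda>t. a t * b t)" and a: "a \<in> Ro" "a 0 \<noteq> 0"
  shows "littleo b"
  unfolding littleo_iff
proof (intro allI impI)
  fix e :: real assume e: "e > 0"
  \<comment> \<open>By continuity at 0, |a t| stays above half of the nonzero value |a 0|.\<close>
  define D where "D = \<bar>a 0\<bar> / 2"
  have D: "D > 0" using a by (simp add: D_def)
  have "\<forall>\<^sub>F t in germ0. \<bar>a t * b t\<bar> \<le> (D * e) * t" using o D e by (simp add: littleo_iff)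
  with Ro_continuous_at_0[OF a(1) D] show "\<forall>\<^sub>F t in germ0. \<bar>b t\<bar> \<le> e * t"
  proof eventually_elim
    case (elim t)
    have "D \<le> \<bar>a t\<bar>" using elim(1) unfolding D_def by linarith
    then have "D * \<bar>b t\<bar> \<le> \<bar>a t\<bar> * \<bar>b t\<bar>" by (intro mult_right_mono) auto
    also have "\<dots> \<le> D * (e * t)" using elim(2) by (simp add: abs_mult mult.assoc)
    finally show ?case using D by simp
  qed
qed

lemma chart_rep_fseg:
  assumes "chart V p P q \<alpha>" "h \<in> {0..1}" "st (fseg x y h) \<in> V"
  shows "littleo (\<lambda>t. rep_fermat (ext_app p \<alpha> q (fseg x y h)) t -
    \<alpha> (argv p q (\<lambda>t. rep_fermat x t + h * (rep_fermat y t - rep_fermat x t)) t))"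
  using assms(3) by (intro chart.rep_ext_app[OF assms(1)] Ro_line assms rep_fseg rep_Ro)
    (simp add: st_fseg[OF assms(2)], simp add: st_def)

context fermat_segment_set
begin

text \<open>A segment to some point with another standard part may leave V; its initial piece does
  not, and still changes the standard part.\<close>

lemma nearby:
  assumes x: "x \<in> J" and V: "open V" "st x \<in> V"
  shows "\<exists>y\<in>J. st y \<noteq> st x \<and> (\<forall>h\<in>{0..1}. st (fseg x y h) \<in> V)"
proof -
  obtain z where z: "z \<in> J" "st z \<noteq> st x" using nontrivial by metis
  obtain e where e: "e > 0" "\<forall>s. dist s (st x) < e \<longrightarrow> s \<in> V" using V unfolding open_dist by blast
  define d where "d = \<bar>st z - st x\<bar>"
  \<comment> \<open>The standard part moves by k * d, which is at most e / 2.\<close>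
  define k where "k = min 1 (e / (2 * d))"
  have d: "d > 0" using z by (simp add: d_def)
  have k: "k > 0" "k \<in> {0..1}" using e d by (auto simp: k_def)
  have "k * d \<le> e / (2 * d) * d" using d by (intro mult_right_mono) (auto simp: k_def)
  also have "\<dots> = e / 2" using d by simp
  finally have kd: "k * d < e" using e by simp
  let ?y = "fseg x z k"
  have "st ?y \<noteq> st x" using k z by (simp add: st_fseg)
  moreover have "st (fseg x ?y h) \<in> V" if h: "h \<in> {0..1}" for h
  proof -
    have "dist (st (fseg x ?y h)) (st x) = h * (k * d)"
      using h k by (simp add: st_fseg dist_real_def abs_mult d_def)
    also have "\<dots> \<le> k * d" using h k d by (intro mult_left_le_one_le) auto
    finally show ?thesis using kd e by auto
  qed
  ultimately show ?thesis using seg[OF x z(1) k(2)] by blast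
qed

text \<open>A segment issuing from x with distinct standard parts lies in J, and differentiating along it
  recovers the derivative at x after cancelling the invertible factor \<open>y - x\<close>.\<close>

lemma ext_fpd_unique:
  assumes x: "x \<in> J" and r1: "loc_rep J g x V1 p1 P1 q1 \<alpha>1" and r2: "loc_rep J g x V2 p2 P2 q2 \<alpha>2"
  shows "ext_app p1 (fpd p1 \<alpha>1) q1 x = ext_app p2 (fpd p2 \<alpha>2) q2 x"
proof -
  interpret C1: chart V1 p1 P1 q1 \<alpha>1 using r1 by (simp add: loc_rep_iff_chart)
  interpret C2: chart V2 p2 P2 q2 \<alpha>2 using r2 by (simp add: loc_rep_iff_chart)
  interpret D1: chart V1 p1 P1 q1 "fpd p1 \<alpha>1" by (rule C1.chart_fpd)
  interpret D2: chart V2 p2 P2 q2 "fpd p2 \<alpha>2" by (rule C2.chart_fpd)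
  have stx: "st x \<in> V1 \<inter> V2" using r1 r2 by (simp add: loc_rep_iff_chart)
  obtain y where y: "y \<in> J" "st y \<noteq> st x" and seg_in: "\<forall>h\<in>{0..1}. st (fseg x y h) \<in> V1 \<inter> V2"
    using nearby[OF x open_Int[OF C1.V C2.V] stx] by blast
  let ?X = "rep_fermat x" and ?Y = "rep_fermat y"
  let ?l = "\<lambda>h t. ?X t + h * (?Y t - ?X t)"
  have l1: "\<forall>h\<in>{0..1}. ?X 0 + h * (?Y 0 - ?X 0) \<in> V1" and l2: "\<forall>h\<in>{0..1}. ?X 0 + h * (?Y 0 - ?X 0) \<in> V2"
    using seg_in by (auto simp: st_fseg) (auto simp: st_def)
  define G where "G t h = \<alpha>1 (argv p1 q1 (?l h) t) - \<alpha>2 (argv p2 q2 (?l h) t)" for t h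
  define G' where "G' t h = (?Y t - ?X t) * (fpd p1 \<alpha>1 (argv p1 q1 (?l h) t) - fpd p2 \<alpha>2 (argv p2 q2 (?l h) t))" for t h
  have "usmall G'"
  proof (rule usmall_derivative_if_pointwise)
    show "expandable G'" unfolding G'_def[abs_def]
      by (intro expandable_mult expandable_diff expandable_Ro rep_Ro D1.expandable_on_line D2.expandable_on_line l1 l2)
    fix h :: real assume h: "h \<in> {0..1}"
    let ?z = "fseg x y h"
    have z: "?z \<in> J" "st ?z \<in> V1" "st ?z \<in> V2" using seg[OF x y(1) h] seg_in h by auto
    have g1: "g ?z = ext_app p1 \<alpha>1 q1 ?z" and g2: "g ?z = ext_app p2 \<alpha>2 q2 ?z"
      using r1 r2 z unfolding loc_rep_def by blast+
    have "littleo (\<lambda>t. \<alpha>1 (argv p1 q1 (?l h) t) - rep_fermat (g ?z) t)"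
      unfolding g1 by (rule littleo_sym[OF chart_rep_fseg[OF C1.chart_axioms h z(2)]])
    moreover have "littleo (\<lambda>t. rep_fermat (g ?z) t - \<alpha>2 (argv p2 q2 (?l h) t))"
      unfolding g2 by (rule chart_rep_fseg[OF C2.chart_axioms h z(3)])
    ultimately show "littleo (\<lambda>t. G t h)" unfolding G_def by (rule littleo_trans)
  next
    from C1.DERIV_on_line[OF rep_Ro rep_Ro l1] C2.DERIV_on_line[OF rep_Ro rep_Ro l2]
    show "\<forall>\<^sub>F t in germ0. \<forall>h\<in>{0..1}. (G t has_real_derivative G' t h) (at h within {0..1})"
    proof eventually_elim
      case (elim t)
      show ?case
      proof
        fix h :: real assume h: "h \<in> {0..1}"
        show "(G t has_real_derivative G' t h) (at h within {0..1})"
          using DERIV_diff[OF elim(1)[rule_format, OF h] elim(2)[rule_format, OF h]]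
          unfolding G_def[abs_def] G'_def by (simp only: right_diff_distrib)
      qed
    qed
  qed
  \<comment> \<open>At h = 0 the segment is at x itself.\<close>
  from usmall_littleo[OF this, of 0]
  have "littleo (\<lambda>t. (?Y t - ?X t) * (fpd p1 \<alpha>1 (argv p1 q1 ?X t) - fpd p2 \<alpha>2 (argv p2 q2 ?X t)))"
    by (simp add: G'_def)
  then have d: "littleo (\<lambda>t. fpd p1 \<alpha>1 (argv p1 q1 ?X t) - fpd p2 \<alpha>2 (argv p2 q2 ?X t))"
    by (rule littleo_cancel) (use y in \<open>auto intro!: Ro_diff simp: st_def\<close>)
  show ?thesis unfolding ext_app_argv using d stx
    by (subst abs_eq_iff) (auto intro!: D1.ext_Ro D2.ext_Ro simp: st_def)
qed

lemma fermat_deriv_eq: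
  assumes "x \<in> J" "loc_rep J g x V p P q \<alpha>"
  shows "fermat_deriv J g x = ext_app p (fpd p \<alpha>) q x"
  unfolding fermat_deriv_def
  by (rule some_equality) (use assms ext_fpd_unique in blast)+

text \<open>The derivative is read off from representations over subsets of V, which makes the
  notion local: it restricts and glues. Over the whole line it is the condition of the theorem, see
  \<open>antideriv_on_UNIV\<close>.\<close>

definition antideriv_on :: "(fermat \<Rightarrow> fermat) \<Rightarrow> real set \<Rightarrow> (fermat \<Rightarrow> fermat) \<Rightarrow> bool" where
  "antideriv_on f V g \<longleftrightarrow> (\<forall>x\<in>J. st x \<in> V \<longrightarrow>
     (\<exists>W p P q \<alpha>. W \<subseteq> V \<and> loc_rep J g x W p P q \<alpha> \<and> f x = ext_app p (fpd p \<alpha>) q x))"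

lemma antideriv_onE:
  assumes "antideriv_on f V g" "x \<in> J" "st x \<in> V"
  obtains W p P q \<alpha> where "W \<subseteq> V" "loc_rep J g x W p P q \<alpha>" "f x = ext_app p (fpd p \<alpha>) q x"
  using assms(1)[unfolded antideriv_on_def, THEN bspec, OF assms(2), THEN mp, OF assms(3)]
  by (elim exE conjE) (rule that)

lemma antideriv_on_UNIV:
  "antideriv_on f UNIV g \<longleftrightarrow> qsmooth J g \<and> (\<forall>x\<in>J. fermat_deriv J g x = f x)"
proof
  assume "antideriv_on f UNIV g"
  then show "qsmooth J g \<and> (\<forall>x\<in>J. fermat_deriv J g x = f x)"
    unfolding antideriv_on_def qsmooth_def using fermat_deriv_eq by fastforce
next
  assume *: "qsmooth J g \<and> (\<forall>x\<in>J. fermat_deriv J g x = f x)"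
  show "antideriv_on f UNIV g" unfolding antideriv_on_def
  proof (intro ballI impI)
    fix x assume x: "x \<in> J"
    then obtain W p P q \<alpha> where r: "loc_rep J g x W p P q \<alpha>" using * unfolding qsmooth_def by blast
    show "\<exists>W p P q \<alpha>. W \<subseteq> UNIV \<and> loc_rep J g x W p P q \<alpha> \<and> f x = ext_app p (fpd p \<alpha>) q x"
      using fermat_deriv_eq[OF x r] r * x by (intro exI[of _ W] exI[of _ p] exI[of _ P] exI[of _ q] exI[of _ \<alpha>]) simp
  qed
qed

lemma loc_rep_subset:
  assumes "loc_rep J g x W p P q \<alpha>" "open V" "st x \<in> V"
  shows "loc_rep J g x (W \<inter> V) p P q \<alpha>"
  using assms chart.chart_subset[of W p P q \<alpha> "W \<inter> V"] chart.V[of W p P q \<alpha>] by (auto simp: loc_rep_iff_chart)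

lemma antideriv_on_subset:
  assumes "antideriv_on f V g" "open V'" "V' \<subseteq> V" shows "antideriv_on f V' g"
  unfolding antideriv_on_def
proof (intro ballI impI)
  fix x assume x: "x \<in> J" "st x \<in> V'"
  then obtain W p P q \<alpha> where "W \<subseteq> V" "loc_rep J g x W p P q \<alpha>" "f x = ext_app p (fpd p \<alpha>) q x"
    using antideriv_onE[OF assms(1) x(1) subsetD[OF assms(3) x(2)]] by blast
  then show "\<exists>W p P q \<alpha>. W \<subseteq> V' \<and> loc_rep J g x W p P q \<alpha> \<and> f x = ext_app p (fpd p \<alpha>) q x"
    using loc_rep_subset[OF _ assms(2) x(2)] by (meson Int_lower2)
qed

lemma antideriv_on_cong:
  assumes "antideriv_on f V g" "\<And>y. y \<in> J \<Longrightarrow> st y \<in> V \<Longrightarrow> g' y = g y"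
  shows "antideriv_on f V g'"
  unfolding antideriv_on_def
proof (intro ballI impI)
  fix x assume x: "x \<in> J" "st x \<in> V"
  then obtain W p P q \<alpha> where W: "W \<subseteq> V" "loc_rep J g x W p P q \<alpha>" "f x = ext_app p (fpd p \<alpha>) q x"
    by (elim antideriv_onE[OF assms(1)])
  then have "loc_rep J g' x W p P q \<alpha>" using assms(2) by (auto simp: loc_rep_def)
  with W show "\<exists>W p P q \<alpha>. W \<subseteq> V \<and> loc_rep J g' x W p P q \<alpha> \<and> f x = ext_app p (fpd p \<alpha>) q x" by blast
qed

lemma antideriv_on_Un:
  "antideriv_on f V g \<Longrightarrow> antideriv_on f V' g \<Longrightarrow> antideriv_on f (V \<union> V') g"
  unfolding antideriv_on_def by (metis (no_types, lifting) Un_iff le_supI1 le_supI2)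

lemma antideriv_on_add_constant:
  assumes "antideriv_on f V g" shows "antideriv_on f V (\<lambda>y. fadd (g y) c)"
  unfolding antideriv_on_def
proof (intro ballI impI)
  fix x assume x: "x \<in> J" "st x \<in> V"
  then obtain W p P q \<alpha> where W: "W \<subseteq> V" "loc_rep J g x W p P q \<alpha>" "f x = ext_app p (fpd p \<alpha>) q x"
    by (elim antideriv_onE[OF assms(1)])
  then have C: "chart W p P q \<alpha>" by (simp add: loc_rep_iff_chart)
  have "loc_rep J (\<lambda>y. fadd (g y) c) x W (Suc p) (prodset p P UNIV) (q(p := c)) (\<lambda>z. \<alpha> (drop_coord p z) + z p)"
    using W(2) chart_add_constant(1,2)[OF C] by (simp add: loc_rep_iff_chart)
  then show "\<exists>W p P q \<alpha>. W \<subseteq> V \<and> loc_rep J (\<lambda>y. fadd (g y) c) x W p P q \<alpha> \<and> f x = ext_app p (fpd p \<alpha>) q x"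
    using W(1,3) chart_add_constant(3)[OF C, of c x] by metis
qed

text \<open>\<open>antideriv_on\<close> supplies one suitable representation per point. By
  uniqueness of the derivative, any representation of g gives f at all points it covers in V, so a
  whole segment can be treated in one chart.\<close>

lemma antideriv_on_ext_fpd:
  assumes "antideriv_on f V g" "loc_rep J g x W p P q \<alpha>" "y \<in> J" "st y \<in> W" "st y \<in> V"
  shows "f y = ext_app p (fpd p \<alpha>) q y"
proof -
  obtain W' p' P' q' \<alpha>' where "W' \<subseteq> V" and W: "loc_rep J g y W' p' P' q' \<alpha>'" "f y = ext_app p' (fpd p' \<alpha>') q' y"
    using antideriv_onE[OF assms(1,3,5)] .
  moreover have "loc_rep J g y W p P q \<alpha>" using assms(2,4) by (simp add: loc_rep_iff_chart)
  ultimately show ?thesis using ext_fpd_unique[OF assms(3)] by metis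
qed

section \<open>Two antiderivatives of one function differ by a constant\<close>

definition constant_diff :: "(fermat \<Rightarrow> fermat) \<Rightarrow> (fermat \<Rightarrow> fermat) \<Rightarrow> fermat \<Rightarrow> fermat \<Rightarrow> bool" where
  "constant_diff g1 g2 x y \<longleftrightarrow> 
    littleo (\<lambda>t. (rep_fermat (g1 y) t - rep_fermat (g2 y) t) - (rep_fermat (g1 x) t - rep_fermat (g2 x) t))"

lemma constant_diff_refl: "constant_diff g1 g2 x x"
  by (simp add: constant_diff_def littleo_zero)

lemma constant_diff_trans: "constant_diff g1 g2 x y \<Longrightarrow> constant_diff g1 g2 y z \<Longrightarrow> constant_diff g1 g2 x z"
  unfolding constant_diff_def by (rule littleo_trans[rotated])

lemma constant_diff_eq:
  assumes "constant_diff g1 g2 x y" "g1 x = g2 x" shows "g1 y = g2 y"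
  using assms by (simp add: constant_diff_def fermat_eq_iff)

text \<open>Case of a segment inside one chart for each antiderivative: \<open>K\<close>, the
  difference of the two represented derivatives, is o(t) at every h because both represent f
  there.\<close>

lemma constant_diff_chart:
  assumes g1: "antideriv_on f V g1" and g2: "antideriv_on f V g2"
    and r1: "loc_rep J g1 z V1 p1 P1 q1 \<alpha>1" and r2: "loc_rep J g2 z V2 p2 P2 q2 \<alpha>2"
    and x: "x \<in> J" and y: "y \<in> J" and seg_in: "\<And>h. h \<in> {0..1} \<Longrightarrow> st (fseg x y h) \<in> V \<inter> V1 \<inter> V2"
  shows "constant_diff g1 g2 x y"
proof -
  interpret C1: chart V1 p1 P1 q1 \<alpha>1 using r1 by (simp add: loc_rep_iff_chart)
  interpret C2: chart V2 p2 P2 q2 \<alpha>2 using r2 by (simp add: loc_rep_iff_chart)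
  interpret D1: chart V1 p1 P1 q1 "fpd p1 \<alpha>1" by (rule C1.chart_fpd)
  interpret D2: chart V2 p2 P2 q2 "fpd p2 \<alpha>2" by (rule C2.chart_fpd)
  let ?X = "rep_fermat x" and ?Y = "rep_fermat y"
  let ?l = "\<lambda>h t. ?X t + h * (?Y t - ?X t)"
  have l1: "\<forall>h\<in>{0..1}. ?X 0 + h * (?Y 0 - ?X 0) \<in> V1" and l2: "\<forall>h\<in>{0..1}. ?X 0 + h * (?Y 0 - ?X 0) \<in> V2"
    using seg_in by (auto simp: st_fseg) (auto simp: st_def)
  define G where "G t h = \<alpha>1 (argv p1 q1 (?l h) t) - \<alpha>2 (argv p2 q2 (?l h) t)" for t h
  define K where "K t h = fpd p1 \<alpha>1 (argv p1 q1 (?l h) t) - fpd p2 \<alpha>2 (argv p2 q2 (?l h) t)" for t h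
  have "usmall K"
  proof (rule usmall_if_pointwise)
    show "expandable K" unfolding K_def[abs_def]
      by (intro expandable_diff D1.expandable_on_line D2.expandable_on_line rep_Ro l1 l2)
    fix h :: real assume h: "h \<in> {0..1}"
    let ?z = "fseg x y h"
    have z: "?z \<in> J" "st ?z \<in> V" "st ?z \<in> V1" "st ?z \<in> V2" using seg[OF x y h] seg_in[OF h] by auto
    have "littleo (\<lambda>t. fpd p1 \<alpha>1 (argv p1 q1 (?l h) t) - rep_fermat (f ?z) t)"
      unfolding antideriv_on_ext_fpd[OF g1 r1 z(1,3,2)] 
      by (rule littleo_sym[OF chart_rep_fseg[OF D1.chart_axioms h z(3)]])
    moreover have "littleo (\<lambda>t. rep_fermat (f ?z) t - fpd p2 \<alpha>2 (argv p2 q2 (?l h) t))"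
      unfolding antideriv_on_ext_fpd[OF g2 r2 z(1,4,2)]
      by (rule chart_rep_fseg[OF D2.chart_axioms h z(4)])
    ultimately show "littleo (\<lambda>t. K t h)" unfolding K_def by (rule littleo_trans)
  qed
  moreover have "ubounded (\<lambda>t h. ?Y t - ?X t)"
    by (intro expandable_ubounded expandable_diff expandable_Ro rep_Ro)
  ultimately have K: "usmall (\<lambda>t h. (?Y t - ?X t) * K t h)" by (intro usmall_mult)
  have "\<forall>\<^sub>F t in germ0. \<forall>h\<in>{0..1}. (G t has_real_derivative (?Y t - ?X t) * K t h) (at h within {0..1})"
    using C1.DERIV_on_line[OF rep_Ro rep_Ro l1] C2.DERIV_on_line[OF rep_Ro rep_Ro l2]
  proof eventually_elim
    case (elim t)
    show ?case
    proof
      fix h :: real assume h: "h \<in> {0..1}"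
      show "(G t has_real_derivative (?Y t - ?X t) * K t h) (at h within {0..1})"
        using DERIV_diff[OF elim(1)[rule_format, OF h] elim(2)[rule_format, OF h]]
        unfolding G_def[abs_def] K_def by (simp only: right_diff_distrib)
    qed
  qed
  from usmall_littleo[OF usmall_integrated[OF K this], of 1] have G: "littleo (\<lambda>t. G t 1 - G t 0)" by simp
  have rep: "littleo (\<lambda>t. rep_fermat (g1 z) t - rep_fermat (g2 z) t - G t h)"
    if h: "h \<in> {0..1}" and z: "z = fseg x y h" for h z
  proof -
    have "g1 z = ext_app p1 \<alpha>1 q1 z" "g2 z = ext_app p2 \<alpha>2 q2 z"
      using r1 r2 seg_in[OF h] seg[OF x y h] z by (auto simp: loc_rep_iff_chart)
    then have "littleo (\<lambda>t. rep_fermat (g1 z) t - \<alpha>1 (argv p1 q1 (?l h) t))" 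
        "littleo (\<lambda>t. rep_fermat (g2 z) t - \<alpha>2 (argv p2 q2 (?l h) t))"
      using chart_rep_fseg[OF C1.chart_axioms h, of x y] chart_rep_fseg[OF C2.chart_axioms h, of x y] seg_in[OF h] z by auto
    from littleo_diff[OF this] show ?thesis by (simp add: G_def algebra_simps)
  qed
  from littleo_add[OF littleo_diff[OF rep[of 1 y] rep[of 0 x]] G] show ?thesis
    by (simp add: constant_diff_def algebra_simps)
qed

text \<open>No pair of charts need cover the whole segment. Being constant up to parameter h spreads
  within each chart pair, and connectedness of [0,1] carries it from 0 to 1.\<close>

lemma antideriv_on_constant_diff:
  assumes V: "open V" "convex V" and g1: "antideriv_on f V g1" and g2: "antideriv_on f V g2"
    and x: "x \<in> J" "st x \<in> V" and y: "y \<in> J" "st y \<in> V"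
  shows "constant_diff g1 g2 x y"
proof -
  have in_V: "st (fseg x y h) \<in> V" if "h \<in> {0..1}" for h
  proof -
    have "(1 - h) *\<^sub>R st x + h *\<^sub>R st y \<in> V" using V(2) x y that by (intro convexD_alt) auto
    then show ?thesis using that by (simp add: st_fseg algebra_simps)
  qed
  have "constant_diff g1 g2 x (fseg x y 1)"
  proof (rule connected_induction_simple[of "{0..1}" 0 1 "\<lambda>h. constant_diff g1 g2 x (fseg x y h)"])
    fix h0 :: real assume h0: "h0 \<in> {0..1}"
    let ?z = "fseg x y h0"
    have z: "?z \<in> J" "st ?z \<in> V" using seg[OF x(1) y(1) h0] in_V[OF h0] by auto
    obtain V1 p1 P1 q1 \<alpha>1 where V1: "V1 \<subseteq> V" and r1: "loc_rep J g1 ?z V1 p1 P1 q1 \<alpha>1"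
      using antideriv_onE[OF g1 z] .
    obtain V2 p2 P2 q2 \<alpha>2 where "V2 \<subseteq> V" and r2: "loc_rep J g2 ?z V2 p2 P2 q2 \<alpha>2"
      using antideriv_onE[OF g2 z] .
    have "open (V1 \<inter> V2)" "st ?z \<in> V1 \<inter> V2" using r1 r2 by (auto simp: loc_rep_def)
    then obtain e where e: "e > 0" "ball (st ?z) e \<subseteq> V1 \<inter> V2" by (meson open_contains_ball)
    \<comment> \<open>A ball is used because segments between points with parameters in
      \<open>T\<close> must stay inside both charts.\<close>
    define T where "T = {0..1} \<inter> (\<lambda>h. st x + h * (st y - st x)) -` ball (st ?z) e"
    have "openin (top_of_set {0..1}) T" unfolding T_def
      by (rule continuous_openin_preimage_gen) (auto intro!: continuous_intros)
    moreover have "h0 \<in> T" using h0 e by (simp add: T_def st_fseg)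
    moreover have "constant_diff g1 g2 (fseg x y h) (fseg x y h')" if h: "h \<in> T" "h' \<in> T" for h h'
    proof (rule constant_diff_chart[OF g1 g2 r1 r2])
      have hh: "h \<in> {0..1}" "h' \<in> {0..1}" using h by (auto simp: T_def)
      show "fseg x y h \<in> J" "fseg x y h' \<in> J" using seg x y hh by auto
      fix k :: real assume k: "k \<in> {0..1}"
      have "(1 - k) *\<^sub>R st (fseg x y h) + k *\<^sub>R st (fseg x y h') \<in> ball (st ?z) e"
        using h hh k by (intro convexD_alt convex_ball) (auto simp: T_def st_fseg)
      then have "st (fseg (fseg x y h) (fseg x y h') k) \<in> ball (st ?z) e"
        using k by (simp add: st_fseg[of k] algebra_simps)
      then show "st (fseg (fseg x y h) (fseg x y h') k) \<in> V \<inter> V1 \<inter> V2" using e V1 by blast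
    qed
    ultimately show "\<exists>T. openin (top_of_set {0..1}) T \<and> h0 \<in> T \<and>
        (\<forall>h\<in>T. \<forall>h'\<in>T. constant_diff g1 g2 x (fseg x y h) \<longrightarrow> constant_diff g1 g2 x (fseg x y h'))"
      by (intro exI[of _ T] conjI ballI impI) (auto elim: constant_diff_trans)
  qed (auto simp: constant_diff_refl)
  then show ?thesis by simp
qed

text \<open>The lower limit of integration is a real number, so the parameters \<open>q\<close> of f
  serve for the primitive as well; its value at a given point is corrected later by
  \<open>antideriv_on_add_constant\<close>.\<close>

lemma local_antideriv:
  assumes f: "qsmooth J f" and x: "x \<in> J"
  shows "\<exists>V g. open V \<and> convex V \<and> st x \<in> V \<and> antideriv_on f V g"
proof -
  obtain V p P q \<alpha> where r: "loc_rep J f x V p P q \<alpha>" using f x unfolding qsmooth_def by blast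
  interpret chart V p P q \<alpha> using r by (simp add: loc_rep_iff_chart)
  have "st x \<in> V" using r by (simp add: loc_rep_def)
  then obtain e where e: "e > 0" "cball (st x) e \<subseteq> V" using V by (meson open_contains_cball)
  define l r where "l = st x - e" and "r = st x + e"
  have lr: "{l..r} \<subseteq> V" using e by (auto simp: l_def r_def cball_eq_atLeastAtMost)
  interpret integration_box p P V l r by unfold_locales (rule P V lr)+
  let ?\<beta> = "last_integral p l \<alpha>" and ?W = "{l<..<r}"
  have C: "chart ?W p P q ?\<beta>" 
    unfolding chart_def using P q smooth_last_integral[OF smooth] by simp
  have C': "chart ?W p P q \<alpha>" using lr by (intro chart_subset) auto
  have "antideriv_on f ?W (ext_app p ?\<beta> q)" unfolding antideriv_on_def
  proof (intro ballI impI)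
    fix y assume y: "y \<in> J" "st y \<in> ?W"
    then have yV: "st y \<in> V" using lr by auto
    have "loc_rep J (ext_app p ?\<beta> q) y ?W p P q ?\<beta>" using C y by (simp add: loc_rep_iff_chart)
    moreover have "f y = ext_app p \<alpha> q y" using \<open>loc_rep J f x V p P q \<alpha>\<close> y(1) yV by (simp add: loc_rep_def)
    moreover have "ext_app p (fpd p ?\<beta>) q y = ext_app p \<alpha> q y"
      using chart.ext_app_eqI[OF C' fpd_last_integral[OF smooth] y(2)] .
    ultimately show "\<exists>W' p' P' q' \<alpha>'. W' \<subseteq> ?W \<and> loc_rep J (ext_app p ?\<beta> q) y W' p' P' q' \<alpha>'
        \<and> f y = ext_app p' (fpd p' \<alpha>') q' y"
      by (intro exI[of _ ?W] exI[of _ p] exI[of _ P] exI[of _ q] exI[of _ ?\<beta>]) simp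
  qed
  moreover have "st x \<in> ?W" using e by (simp add: l_def r_def)
  ultimately show ?thesis by (intro exI[of _ ?W] exI[of _ "ext_app p ?\<beta> q"]) auto
qed


section \<open>Antiderivatives vanishing at u, and their gluing\<close>

definition based_antideriv :: "(fermat \<Rightarrow> fermat) \<Rightarrow> fermat \<Rightarrow> real set \<Rightarrow> (fermat \<Rightarrow> fermat) \<Rightarrow> bool" where
  "based_antideriv f u V g \<longleftrightarrow> open V \<and> convex V \<and> st u \<in> V \<and> antideriv_on f V g \<and> g u = fzero"

text \<open>Convexity of both domains makes the overlap an interval; it contains the standard part
  of u, where the difference is 0.\<close>

lemma based_antideriv_unique:
  assumes g: "based_antideriv f u V g" and g': "based_antideriv f u V' g'"
    and u: "u \<in> J" and x: "x \<in> J" "st x \<in> V" "st x \<in> V'"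
  shows "g x = g' x"
proof -
  have V: "open (V \<inter> V')" "convex (V \<inter> V')" using g g' by (auto simp: based_antideriv_def convex_Int)
  have a: "antideriv_on f (V \<inter> V') g" "antideriv_on f (V \<inter> V') g'"
    using antideriv_on_subset[OF _ V(1)] g g' by (auto simp: based_antideriv_def)
  have "constant_diff g g' u x"
    by (rule antideriv_on_constant_diff[OF V a]) (use u x g g' in \<open>auto simp: based_antideriv_def\<close>)
  then show ?thesis by (rule constant_diff_eq) (use g g' in \<open>simp add: based_antideriv_def\<close>)
qed

lemma glue_antideriv:
  assumes V: "open V" "convex V" and V': "open V'" "convex V'"
    and g: "antideriv_on f V g" and g': "antideriv_on f V' g'" 
    and z: "z \<in> J" "st z \<in> V" "st z \<in> V'"
  shows "\<exists>G. antideriv_on f (V \<union> V') G \<and> (\<forall>y. st y \<in> V \<longrightarrow> G y = g y)"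
proof -
  \<comment> \<open>The gap is measured at a single common point z; on the rest of the overlap it is
    the same.\<close>
  define c where "c = abs_fermat (\<lambda>t. rep_fermat (g z) t - rep_fermat (g' z) t)"
  have c: "littleo (\<lambda>t. rep_fermat c t - (rep_fermat (g z) t - rep_fermat (g' z) t))"
    unfolding c_def by (intro rep_abs Ro_diff rep_Ro)
  define G where "G y = (if st y \<in> V then g y else fadd (g' y) c)" for y
  have VV: "open (V \<inter> V')" "convex (V \<inter> V')" using V V' by (auto simp: convex_Int)
  have "G y = fadd (g' y) c" if y: "y \<in> J" "st y \<in> V'" for y
  proof (cases "st y \<in> V")
    case True
    have "constant_diff g g' z y"
      by (rule antideriv_on_constant_diff[OF VV antideriv_on_subset[OF g VV(1)] antideriv_on_subset[OF g' VV(1)]])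
        (use y z True in auto)
    then have "littleo (\<lambda>t. (rep_fermat (g y) t - rep_fermat (g' y) t) - (rep_fermat (g z) t - rep_fermat (g' z) t))"
      by (simp add: constant_diff_def)
    from littleo_diff[OF littleo_diff[OF this c] rep_fadd[of "g' y" c]]
    have "littleo (\<lambda>t. rep_fermat (g y) t - rep_fermat (fadd (g' y) c) t)" by (simp add: algebra_simps)
    then show ?thesis using True by (simp add: G_def fermat_eq_iff)
  qed (simp add: G_def)
  then have "antideriv_on f V' G" by (intro antideriv_on_cong[OF antideriv_on_add_constant[OF g']])
  moreover have "antideriv_on f V G" by (rule antideriv_on_cong[OF g]) (simp add: G_def)
  ultimately show ?thesis by (intro exI[of _ G]) (auto intro: antideriv_on_Un simp: G_def)
qed

lemma based_antideriv_extend: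
  assumes g: "based_antideriv f u V g" and V': "open V'" "convex V'" and g': "antideriv_on f V' g'" 
    and z: "z \<in> J" "st z \<in> V" "st z \<in> V'"
  shows "\<exists>G. based_antideriv f u (V \<union> V') G"
proof -
  have V: "open V" "convex V" "antideriv_on f V g" using g by (auto simp: based_antideriv_def)
  obtain G where G: "antideriv_on f (V \<union> V') G" "\<forall>y. st y \<in> V \<longrightarrow> G y = g y"
    using glue_antideriv[OF V(1,2) V' V(3) g' z] by blast
  have "connected (V \<union> V')"
    using V V' z by (intro connected_Un convex_connected) auto
  \<comment> \<open>On the real line connected sets are convex.\<close>
  then have "convex (V \<union> V')"
    by (simp add: is_interval_connected_1[symmetric] is_interval_convex_1[symmetric])
  then show ?thesis using G g V V' by (auto simp: based_antideriv_def)
qed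

lemma based_antideriv_exists:
  assumes f: "qsmooth J f" and u: "u \<in> J" and x: "x \<in> J"
  shows "\<exists>V g. based_antideriv f u V g \<and> st x \<in> V"
proof -
  \<comment> \<open>\<open>Q\<close> concerns real points only, so the segment from u to x is
    followed through its standard parts.\<close>
  define Q where "Q s \<longleftrightarrow> (\<exists>V g. based_antideriv f u V g \<and> s \<in> V)" for s
  have "Q (st (fseg u x 1))"
  proof (rule connected_induction_simple[of "{0..1}" 0 1 "\<lambda>h. Q (st (fseg u x h))"])
    obtain V g where V: "open V" "convex V" "st u \<in> V" and g: "antideriv_on f V g"
      using local_antideriv[OF f u] by blast
    \<comment> \<open>The negative of \<open>g u\<close>: adding it normalises the value at
      u.\<close>
    define c where "c = abs_fermat (\<lambda>t. 0 - rep_fermat (g u) t)"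
    have c: "littleo (\<lambda>t. rep_fermat c t - (0 - rep_fermat (g u) t))"
      unfolding c_def by (intro rep_abs Ro_diff Ro_const rep_Ro)
    have "littleo (\<lambda>t. rep_fermat fzero t - 0)" unfolding fzero_def by (rule rep_abs[OF Ro_const])
    from littleo_diff[OF littleo_add[OF rep_fadd[of "g u" c] c] this] have "fadd (g u) c = fzero" 
      by (simp add: fermat_eq_iff algebra_simps)
    then have "based_antideriv f u V (\<lambda>y. fadd (g y) c)"
      using V antideriv_on_add_constant[OF g] by (simp add: based_antideriv_def)
    then show "Q (st (fseg u x 0))" using V unfolding Q_def by auto
  next
    fix h0 :: real assume h0: "h0 \<in> {0..1}"
    obtain V' g' where V': "open V'" "convex V'" "st (fseg u x h0) \<in> V'" and g': "antideriv_on f V' g'"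
      using local_antideriv[OF f seg[OF u x h0]] by blast
    define T where "T = {0..1} \<inter> (\<lambda>h. st u + h * (st x - st u)) -` V'"
    have "openin (top_of_set {0..1}) T" unfolding T_def
      by (rule continuous_openin_preimage_gen[OF _ V'(1)]) (auto intro!: continuous_intros)
    moreover have "h0 \<in> T" using V'(3) h0 by (simp add: T_def st_fseg)
    moreover have "Q (st (fseg u x h'))" if h: "h \<in> T" "h' \<in> T" and Q: "Q (st (fseg u x h))" for h h'
    proof -
      from Q obtain V g where V: "based_antideriv f u V g" "st (fseg u x h) \<in> V" unfolding Q_def by blast
      have hh: "h \<in> {0..1}" "st (fseg u x h) \<in> V'" "st (fseg u x h') \<in> V'" using h by (auto simp: T_def st_fseg)
      from based_antideriv_extend[OF V(1) V'(1,2) g' seg[OF u x hh(1)] V(2) hh(2)] hh(3)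
      show ?thesis unfolding Q_def by blast
    qed
    ultimately show "\<exists>T. openin (top_of_set {0..1}) T \<and> h0 \<in> T \<and>
        (\<forall>h\<in>T. \<forall>h'\<in>T. Q (st (fseg u x h)) \<longrightarrow> Q (st (fseg u x h')))"
      by (intro exI[of _ T] conjI ballI impI)
  qed auto
  then show ?thesis unfolding Q_def by simp
qed

theorem antideriv_exists_unique:
  assumes f: "qsmooth J f" and u: "u \<in> J"
  shows "\<exists>I. qsmooth J I \<and> (\<forall>x\<in>J. fermat_deriv J I x = f x) \<and> I u = fzero \<and>
             (\<forall>I'. qsmooth J I' \<and> (\<forall>x\<in>J. fermat_deriv J I' x = f x) \<and> I' u = fzero
                   \<longrightarrow> (\<forall>x\<in>J. I' x = I x))"
proof -
  \<comment> \<open>The value at x comes from any based antiderivative reaching x; by uniqueness the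
    choice does not influence it, so near x the function \<open>I\<close> agrees with one of
    them.\<close>
  define I where "I x = (SOME v. \<exists>V g. based_antideriv f u V g \<and> st x \<in> V \<and> v = g x)" for x
  have I: "I x = g x" if g: "based_antideriv f u V g" "x \<in> J" "st x \<in> V" for V g x
    unfolding I_def
  proof (rule some_equality)
    show "\<exists>V' g'. based_antideriv f u V' g' \<and> st x \<in> V' \<and> g x = g' x" using g by blast
    fix v assume "\<exists>V g. based_antideriv f u V g \<and> st x \<in> V \<and> v = g x"
    then obtain V' g' where "based_antideriv f u V' g'" "st x \<in> V'" "v = g' x" by blast
    then show "v = g x" using based_antideriv_unique[OF _ g(1) u g(2)] g(3) by simp
  qed
  have "antideriv_on f UNIV I" unfolding antideriv_on_def
  proof (intro ballI impI)
    fix x assume x: "x \<in> J"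
    obtain V g where g: "based_antideriv f u V g" and xV: "st x \<in> V" using based_antideriv_exists[OF f u x] by blast
    then have "antideriv_on f V g" by (simp add: based_antideriv_def)
    then have "antideriv_on f V I" by (rule antideriv_on_cong) (rule I[OF g])
    then obtain W p P q \<alpha> where "loc_rep J I x W p P q \<alpha>" "f x = ext_app p (fpd p \<alpha>) q x"
      by (rule antideriv_onE[OF _ x xV])
    then show "\<exists>W p P q \<alpha>. W \<subseteq> UNIV \<and> loc_rep J I x W p P q \<alpha> \<and> f x = ext_app p (fpd p \<alpha>) q x"
      by (intro exI conjI subset_UNIV)
  qed
  moreover have "I u = fzero"
  proof -
    obtain V g where g: "based_antideriv f u V g" using based_antideriv_exists[OF f u u] by blast
    then have "st u \<in> V" "g u = fzero" by (auto simp: based_antideriv_def)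
    then show ?thesis using I[OF g u] by simp
  qed
  \<comment> \<open>The whole line is an admissible domain, so global uniqueness is a case of
    \<open>based_antideriv_unique\<close>.\<close>
  moreover have "I' x = I x" if "antideriv_on f UNIV I'" "I' u = fzero" "x \<in> J" for I' x
    by (rule based_antideriv_unique[of f u UNIV I' UNIV I]) 
      (simp_all add: based_antideriv_def that u \<open>antideriv_on f UNIV I\<close> \<open>I u = fzero\<close>)
  ultimately show ?thesis unfolding antideriv_on_UNIV by blast
qed

end

theorem theorem13:
  fixes a b :: fext and J :: "fermat set" and f :: "fermat \<Rightarrow> fermat" and u :: fermat
  assumes "fermat_interval a b J"
    and "est a < est b"
    and "qsmooth J f"
    and "u \<in> J"
  shows "\<exists>I. qsmooth J I \<and> (\<forall>x\<in>J. fermat_deriv J I x = f x) \<and> I u = fzero \<and>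
             (\<forall>I'. qsmooth J I' \<and> (\<forall>x\<in>J. fermat_deriv J I' x = f x) \<and> I' u = fzero
                   \<longrightarrow> (\<forall>x\<in>J. I' x = I x))"
  using fermat_segment_set.antideriv_exists_unique[OF fermat_segment_set_interval[OF assms(1,2)] assms(3,4)] .

end
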